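(* Let $b\in\mathbb{R}$ and assume that $j:=\frac{n-2-b}{2}\in\mathbb{Z}\setminus\{1,\dots,n-2\}$. Then for all $u\in C_0^\infty(\mathbb{R}^n\setminus\{0\};\mathbb{C}^m)$ satisfying $P_ju=0$, $$\int_{\mathbb{R}^n} r^{-b}|(\sigma\cdot\nabla)u|^2\,dx\ \ge\ \int_{\mathbb{R}^n} r^{-b-2}|u|^2\,dx,$$ and the constant $1$ in the right hand side cannot be improved.
   Context: Let $n\ge2$, let $m$ be a positive integer, and let $\sigma_1,\dots,\sigma_n$ be Hermitian $m\times m$ complex matrices with $\sigma_i\sigma_j+\sigma_j\sigma_i=2\delta_{ij}I_m$ for $i,j=1,\dots,n$. Write $\sigma\cdot\nabla=\sum_{i=1}^n\sigma_i\partial_{x_i}$, $r=|x|$, and $|\cdot|$ for the Euclidean norm on $\mathbb{C}^m$. For $n=2$ the set $\{1,\dots,n-2\}$ is empty. $L:=\sum_{j<k}\sigma_j\sigma_k(x_j\partial_{x_k}-x_k\partial_{x_j})$ acts only in directions tangential to spheres centered at the origin and is regarded as a self-adjoint operator in $L^2(S^{n-1};\mathbb{C}^m)$. Its spectrum is discrete and equals $S_L=\mathbb{Z}\setminus\{1,\dots,n-2\}$; $E_k$ denotes the (finite-dimensional) eigenspace for $k\in S_L$. $P_k$ denotes the orthogonal projector in $L^2(\mathbb{R}^n;\mathbb{C}^m)$ induced by the orthogonal projection onto $E_k$ in $L^2(S^{n-1};\mathbb{C}^m)$, i.e. $(P_ku)(r,\cdot)$ is the $L^2(S^{n-1};\mathbb{C}^m)$-orthogonal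 projection of $u(r,\cdot)$ onto $E_k$ for each $r>0$. *)

theory Defs
  imports "HOL-Analysis.Analysis"
begin

text \<open>
  The space \<open>\<real>\<^sup>n\<close> is rendered as \<open>real ^ 'n\<close> with \<open>n = CARD('n)\<close>; the linear order on \<open>'n\<close> is only
  needed for the sum over \<open>i < k\<close> in the definition of the operator \<open>L\<close>. Elements of \<open>L\<^sup>2\<close> spaces are
  represented by functions, with equality almost everywhere in place of equality. Operators
  on \<open>L\<^sup>2\<close> spaces are represented by their graphs, closed under equality almost everywhere.
\<close>

section \<open>Clifford matrices and the Dirac operator\<close>

definition hermitian :: "complex ^ 'm ^ 'm \<Rightarrow> bool" where
  "hermitian A \<longleftrightarrow> (\<chi> a c. cnj (A $ c $ a)) = A"

definition clifford_family :: "('n \<Rightarrow> complex ^ 'm ^ 'm) \<Rightarrow> bool" where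
  "clifford_family \<sigma> \<longleftrightarrow>
     (\<forall>i. hermitian (\<sigma> i)) \<and>
     (\<forall>i k. \<sigma> i ** \<sigma> k + \<sigma> k ** \<sigma> i = mat (if i = k then 2 else 0))"

definition pderiv_at :: "'n \<Rightarrow> (real ^ 'n \<Rightarrow> complex ^ 'm) \<Rightarrow> real ^ 'n \<Rightarrow> complex ^ 'm" where
  "pderiv_at i u x = frechet_derivative u (at x) (axis i 1)"

definition dirac :: "('n \<Rightarrow> complex ^ 'm ^ 'm) \<Rightarrow> (real ^ 'n \<Rightarrow> complex ^ 'm) \<Rightarrow> real ^ 'n \<Rightarrow> complex ^ 'm" where
  "dirac \<sigma> u x = (\<Sum>i\<in>UNIV. \<sigma> i *v pderiv_at i u x)"


section \<open>Smooth functions\<close>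

text \<open>Meant for open sets \<open>S\<close> only, since the derivatives are taken at \<open>at x\<close>.\<close>

primrec higher_differentiable_on ::
    "'a::real_normed_vector set \<Rightarrow> ('a \<Rightarrow> 'b::real_normed_vector) \<Rightarrow> nat \<Rightarrow> bool" where
  "higher_differentiable_on S f 0 \<longleftrightarrow> continuous_on S f"
| "higher_differentiable_on S f (Suc k) \<longleftrightarrow>
     (\<forall>x\<in>S. f differentiable (at x)) \<and>
     (\<forall>v. higher_differentiable_on S (\<lambda>x. frechet_derivative f (at x) v) k)"

definition smooth_on :: "'a::real_normed_vector set \<Rightarrow> ('a \<Rightarrow> 'b::real_normed_vector) \<Rightarrow> bool" where
  "smooth_on S f \<longleftrightarrow> (\<forall>k. higher_differentiable_on S f k)"

text \<open>\<open>C\<^sub>0\<^sup>\<infinity>(\<real>\<^sup>n - {0})\<close>, each function being extended by zero to the origin.\<close>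

definition test_functions :: "('a::real_normed_vector \<Rightarrow> 'b::real_normed_vector) set" where
  "test_functions =
     {u. smooth_on UNIV u \<and> compact (closure {x. u x \<noteq> 0}) \<and> 0 \<notin> closure {x. u x \<noteq> 0}}"


section \<open>Square-integrable functions and the surface measure\<close>

definition L2 :: "'a measure \<Rightarrow> ('a \<Rightarrow> complex ^ 'm) set" where
  "L2 M = {f \<in> borel_measurable M. integrable M (\<lambda>x. (norm (f x))\<^sup>2)}"

definition L2_inner :: "'a measure \<Rightarrow> ('a \<Rightarrow> complex ^ 'm) \<Rightarrow> ('a \<Rightarrow> complex ^ 'm) \<Rightarrow> complex" where
  "L2_inner M f g = (LINT x|M. (\<Sum>a\<in>UNIV. f x $ a * cnj (g x $ a)))"

text \<open>
  The surface measure of a set \<open>A\<close> on the unit sphere is \<open>n\<close> times the volume of the cone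
  \<open>{t \<omega> | 0 < t < 1, \<omega> \<in> A}\<close>; this is the measure for which
  \<open>dx = r\<^sup>n\<^sup>-\<^sup>1 dr d\<omega>\<close>. Recall \<open>sgn x = x / |x|\<close>.
\<close>

definition sphere_measure :: "'a::euclidean_space measure" where
  "sphere_measure =
     scale_measure (of_nat DIM('a))
       (distr (restrict_space lborel (ball 0 1 - {0})) (restrict_space borel (sphere 0 1)) sgn)"

lemma space_sphere_measure: "space (sphere_measure :: 'a::euclidean_space measure) = sphere 0 1"
  by (simp add: sphere_measure_def space_scale_measure space_restrict_space)

lemma emeasure_sphere_measure:
  fixes A :: "'a::euclidean_space set"
  assumes A: "A \<in> sets borel" "A \<subseteq> sphere 0 1"
  shows "emeasure sphere_measure A =
    of_nat DIM('a) * emeasure lborel {x \<in> ball 0 1 - {0}. sgn x \<in> A}"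
proof -
  let ?R = "restrict_space lborel (ball 0 1 - {0}) :: 'a measure"
  have "(\<lambda>x::'a. x /\<^sub>R norm x) \<in> borel_measurable borel"
    by measurable
  then have "sgn \<in> borel_measurable (borel :: 'a measure)"
    by (simp add: sgn_div_norm[abs_def])
  then have m: "sgn \<in> measurable ?R (restrict_space borel (sphere 0 1))"
    by (intro measurable_restrict_space2 measurable_restrict_space1)
       (auto simp: space_restrict_space norm_sgn)
  have "A \<in> sets (restrict_space borel (sphere 0 1))"
    using A by (auto simp: sets_restrict_space_iff)
  then have "emeasure sphere_measure A = of_nat DIM('a) * emeasure ?R (sgn -` A \<inter> space ?R)"
    by (simp add: sphere_measure_def emeasure_distr[OF m])
  also have "emeasure ?R (sgn -` A \<inter> space ?R) = emeasure lborel (sgn -` A \<inter> space ?R)"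
    by (intro emeasure_restrict_space) (auto simp: space_restrict_space)
  also have "sgn -` A \<inter> space ?R = {x \<in> ball 0 1 - {0}. sgn x \<in> A}"
    by (auto simp: space_restrict_space)
  finally show ?thesis .
qed


section \<open>The angular operator, its eigenspaces and the projections\<close>

definition angular_diff ::
    "('n \<Rightarrow> complex ^ 'm ^ 'm) \<Rightarrow> (real ^ 'n::{finite,linorder} \<Rightarrow> complex ^ 'm) \<Rightarrow> real ^ 'n::{finite,linorder} \<Rightarrow> complex ^ 'm" where
  "angular_diff \<sigma> F x =
     (\<Sum>i\<in>UNIV. \<Sum>k\<in>{i<..}.
        (\<sigma> i ** \<sigma> k) *v ((x $ i) *\<^sub>R pderiv_at k F x - (x $ k) *\<^sub>R pderiv_at i F x))"

text \<open>
  The graph of \<open>L\<close> as a self-adjoint operator in \<open>L\<^sup>2\<close> of the sphere: the closure of the (symmetric,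
  essentially self-adjoint) differential expression acting on smooth functions on the sphere.
  The latter are the restrictions of functions \<open>F\<close> that are smooth off the origin; the result
  does not depend on the extension, as the expression is tangential.
\<close>

definition angular_op ::
    "('n \<Rightarrow> complex ^ 'm ^ 'm) \<Rightarrow>
     ((real ^ 'n::{finite,linorder} \<Rightarrow> complex ^ 'm) \<times> (real ^ 'n::{finite,linorder} \<Rightarrow> complex ^ 'm)) set" where
  "angular_op \<sigma> =
     {(f, g). f \<in> L2 sphere_measure \<and> g \<in> L2 sphere_measure \<and>
        (\<exists>F. (\<forall>k::nat. smooth_on (- {0}) (F k)) \<and>
          (\<lambda>k. LINT \<omega>|sphere_measure. (norm (F k \<omega> - f \<omega>))\<^sup>2) \<longlonglongrightarrow> 0 \<and>
          (\<lambda>k. LINT \<omega>|sphere_measure. (norm (angular_diff \<sigma> (F k) \<omega> - g \<omega>))\<^sup>2) \<longlonglongrightarrow> 0)}"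

definition eigenspace ::
    "('n \<Rightarrow> complex ^ 'm ^ 'm) \<Rightarrow> int \<Rightarrow> (real ^ 'n::{finite,linorder} \<Rightarrow> complex ^ 'm) set" where
  "eigenspace \<sigma> k = {f. (f, \<lambda>\<omega>. of_int k *\<^sub>R f \<omega>) \<in> angular_op \<sigma>}"

text \<open>\<open>g\<close> is the orthogonal projection of \<open>f\<close> onto the subspace \<open>V\<close> of \<open>L\<^sup>2\<close>.\<close>

definition is_orth_proj ::
    "'a measure \<Rightarrow> ('a \<Rightarrow> complex ^ 'm) set \<Rightarrow> ('a \<Rightarrow> complex ^ 'm) \<Rightarrow> ('a \<Rightarrow> complex ^ 'm) \<Rightarrow> bool" where
  "is_orth_proj M V f g \<longleftrightarrow>
     f \<in> L2 M \<and> g \<in> V \<and> (\<forall>h\<in>V. L2_inner M (\<lambda>x. f x - g x) h = 0)"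

text \<open>
  \<open>is_angular_proj \<sigma> k u v\<close> expresses \<open>P\<^sub>k u = v\<close>. Spherical slices of an element of \<open>L\<^sup>2(\<real>\<^sup>n)\<close> are
  defined and square-integrable for almost every radius only.
\<close>

definition is_angular_proj ::
    "('n \<Rightarrow> complex ^ 'm ^ 'm) \<Rightarrow> int \<Rightarrow>
     (real ^ 'n::{finite,linorder} \<Rightarrow> complex ^ 'm) \<Rightarrow> (real ^ 'n::{finite,linorder} \<Rightarrow> complex ^ 'm) \<Rightarrow> bool" where
  "is_angular_proj \<sigma> k u v \<longleftrightarrow>
     u \<in> L2 lborel \<and> v \<in> L2 lborel \<and>
     (AE r in lborel. r > 0 \<longrightarrow>
        is_orth_proj sphere_measure (eigenspace \<sigma> k) (\<lambda>\<omega>. u (r *\<^sub>R \<omega>)) (\<lambda>\<omega>. v (r *\<^sub>R \<omega>)))"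

end

theory Submission
  imports Defs
begin

text \<open>
  Write \<open>E = x \<cdot> \<nabla>\<close> for the Euler operator, \<open>D = \<sigma> \<cdot> \<nabla>\<close> for the Dirac operator, \<open>n\<close> for the dimension and
  \<open>c = - b - 2\<close>, so that \<open>2 j = n + c\<close>. Clifford multiplication by the vector \<open>x\<close> turns \<open>D\<close> into \<open>E + L\<close> and
  multiplies norms by \<open>|x|\<close>; hence \<open>|x|\<^sup>2 |D u|\<^sup>2 = |E u + L u|\<^sup>2\<close>. For the weight \<open>|x|\<^sup>c\<close> the operator
  \<open>E + j\<close> is skew-adjoint, precisely because \<open>2 j = n + c\<close>, whereas \<open>L - j\<close> is symmetric and commutes with it.
  The mixed term therefore vanishes, and (\<open>weighted_energy_identity\<close>)

  \<open>\<integral> |x|\<^sup>c\<^sup>+\<^sup>2 |D u|\<^sup>2 dx = \<integral> |x|\<^sup>c |(E + j) u|\<^sup>2 dx + \<integral> |x|\<^sup>c |(L - j) u|\<^sup>2 dx\<close>.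

  The eigenvalues of \<open>L\<close> are integers. If \<open>P\<^sub>j u = 0\<close>, only eigenvalues at distance at least \<open>1\<close> from \<open>j\<close>
  contribute to \<open>(L - j) u\<close>, so on each sphere this function is at least as large as \<open>u\<close> in \<open>L\<^sup>2\<close>
  (\<open>angular_spectral_gap\<close>). Integrating over the radii in polar coordinates gives the inequality.

  The spectral gap is obtained by duality against polynomials. Every homogeneous polynomial is a
  finite sum of polynomial eigenfunctions of \<open>L\<close> with integer eigenvalues
  (\<open>hom_poly_eigen_decomposition\<close>), polynomials are uniformly dense on the sphere, and \<open>L\<close> is symmetric
  because the surface measure is invariant under rotations (\<open>angular_diff_symmetric\<close>). These facts do the
  work of the spectral theorem.

  For sharpness, one of \<open>k = j - 1\<close> and \<open>k = j + 1\<close> is again an eigenvalue, since \<open>j\<close> lies outside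
  \<open>{1, \<dots>, n - 2}\<close>. Take \<open>u\<close> to be a radial factor times an eigenfunction for \<open>k\<close>. Then the second term
  of the identity equals \<open>\<integral> |x|\<^sup>c |u|\<^sup>2 dx\<close>, and the first one is the energy of the radial factor in the
  variable \<open>ln |x|\<close>, which becomes relatively small when the factor is stretched in that variable.
\<close>

section \<open>The Clifford calculus\<close>

definition clifford_mult :: "('n::finite \<Rightarrow> complex ^ 'm ^ 'm) \<Rightarrow> real ^ 'n \<Rightarrow> complex ^ 'm \<Rightarrow> complex ^ 'm" where
  "clifford_mult \<sigma> x v = (\<Sum>i\<in>UNIV. (x $ i) *\<^sub>R (\<sigma> i *v v))"

definition euler :: "('a::real_normed_vector \<Rightarrow> 'b::real_normed_vector) \<Rightarrow> 'a \<Rightarrow> 'b" where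
  "euler u x = frechet_derivative u (at x) x"

lemma bounded_linear_mv: "bounded_linear ((*v) (A :: complex ^ 'm ^ 'm))"
  by (rule matrix_vector_mul_bounded_linear)

lemmas mv_simps =
  bounded_linear.linear[OF bounded_linear_mv, THEN linear_add]
  bounded_linear.linear[OF bounded_linear_mv, THEN linear_diff]
  bounded_linear.linear[OF bounded_linear_mv, THEN linear_neg]
  bounded_linear.linear[OF bounded_linear_mv, THEN linear_scale]
  bounded_linear.linear[OF bounded_linear_mv, THEN linear_sum]
  bounded_linear.linear[OF bounded_linear_mv, THEN linear_0]

lemma clifford_anticomm:
  assumes "clifford_family \<sigma>"
  shows "\<sigma> i *v (\<sigma> k *v v) + \<sigma> k *v (\<sigma> i *v v) = (if i = k then 2 else 0) *\<^sub>R v"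
proof -
  have "\<sigma> i *v (\<sigma> k *v v) + \<sigma> k *v (\<sigma> i *v v) = (\<sigma> i ** \<sigma> k + \<sigma> k ** \<sigma> i) *v v"
    by (simp add: matrix_vector_mul_assoc matrix_vector_mult_add_rdistrib)
  also have "\<dots> = mat (if i = k then 2 else 0) *v v"
    using assms by (simp add: clifford_family_def)
  also have "\<dots> = (if i = k then 2 else 0) *\<^sub>R v"
    by (auto simp: vec_eq_iff matrix_vector_mult_def mat_def if_distrib[of "\<lambda>z. z * _"] scaleR_conv_of_real cong: if_cong)
  finally show ?thesis .
qed

lemma clifford_square:
  assumes "clifford_family \<sigma>"
  shows "\<sigma> i *v (\<sigma> i *v v) = v"
proof -
  have "2 *\<^sub>R (\<sigma> i *v (\<sigma> i *v v)) = 2 *\<^sub>R v"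
    using clifford_anticomm[OF assms, of i i v] by (simp add: scaleR_2)
  then show ?thesis by simp
qed

lemma clifford_swap:
  assumes "clifford_family \<sigma>" "i \<noteq> k"
  shows "\<sigma> k *v (\<sigma> i *v v) = - (\<sigma> i *v (\<sigma> k *v v))"
  using clifford_anticomm[OF assms(1), of i k v] assms(2)
  by (simp add: eq_neg_iff_add_eq_0 add.commute)

lemma clifford_swap_less:
  fixes \<sigma> :: "'n::{finite,linorder} \<Rightarrow> complex ^ 'm ^ 'm"
  assumes "clifford_family \<sigma>" "i < k"
  shows "\<sigma> k *v (\<sigma> i *v v) = - (\<sigma> i *v (\<sigma> k *v v))"
  using clifford_swap[OF assms(1), of i k v] assms(2) by simp

lemma inner_complex_vec: "inner v w = (\<Sum>a\<in>UNIV. Re (v $ a * cnj (w $ a)))" for v w :: "complex ^ 'm"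
  by (simp add: inner_vec_def inner_complex_def)

lemma hermitian_inner:
  assumes "hermitian A"
  shows "inner (A *v v) w = inner v (A *v w)"
proof -
  have A: "A $ a $ c = cnj (A $ c $ a)" for a c
    using assms by (auto simp: hermitian_def vec_eq_iff)
  have "inner (A *v v) w = (\<Sum>a\<in>UNIV. \<Sum>c\<in>UNIV. Re (A $ a $ c * v $ c * cnj (w $ a)))"
    by (simp add: inner_complex_vec matrix_vector_mult_def sum_distrib_right del: times_complex.sel)
  also have "\<dots> = (\<Sum>c\<in>UNIV. \<Sum>a\<in>UNIV. Re (v $ c * cnj (A $ c $ a * w $ a)))"
    by (subst sum.swap, intro sum.cong refl arg_cong[where f=Re]) (subst A, simp add: mult_ac)
  also have "\<dots> = inner v (A *v w)"
    by (simp add: inner_complex_vec matrix_vector_mult_def sum_distrib_left del: times_complex.sel)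
  finally show ?thesis .
qed

lemma clifford_inner:
  assumes "clifford_family \<sigma>"
  shows "inner (\<sigma> i *v v) w = inner v (\<sigma> i *v w)"
  using assms by (auto simp: clifford_family_def intro: hermitian_inner)

lemma linear_clifford_mult: "linear (clifford_mult \<sigma> x)"
  unfolding clifford_mult_def
  by (rule linearI) (simp_all add: mv_simps scaleR_add_right sum.distrib scaleR_sum_right mult.commute)

lemmas clifford_mult_simps =
  linear_clifford_mult[THEN linear_add] linear_clifford_mult[THEN linear_diff]
  linear_clifford_mult[THEN linear_scale] linear_clifford_mult[THEN linear_sum]
  linear_clifford_mult[THEN linear_0] linear_clifford_mult[THEN linear_neg]

text \<open>
  The sum over pairs \<open>i < k\<close> is the one in the definition of \<open>L\<close>.
\<close>

lemma sum_pairs_split: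
  fixes f :: "'n::{finite,linorder} \<Rightarrow> 'n \<Rightarrow> 'b::comm_monoid_add"
  shows "(\<Sum>i\<in>UNIV. \<Sum>k\<in>UNIV. f i k) = (\<Sum>i\<in>UNIV. f i i) + (\<Sum>i\<in>UNIV. \<Sum>k\<in>{i<..}. f i k + f k i)"
proof -
  have "(\<Sum>k\<in>UNIV. f i k) = f i i + ((\<Sum>k\<in>{i<..}. f i k) + (\<Sum>k\<in>{..<i}. f i k))" for i
  proof -
    have "(UNIV :: 'n set) = insert i ({i<..} \<union> {..<i})" by auto
    then have "(\<Sum>k\<in>UNIV. f i k) = (\<Sum>k\<in>insert i ({i<..} \<union> {..<i}). f i k)" by simp
    also have "\<dots> = f i i + ((\<Sum>k\<in>{i<..}. f i k) + (\<Sum>k\<in>{..<i}. f i k))"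
      by (subst sum.insert; (subst sum.union_disjoint)?) auto
    finally show ?thesis .
  qed
  then have "(\<Sum>i\<in>UNIV. \<Sum>k\<in>UNIV. f i k) = (\<Sum>i\<in>UNIV. f i i) +
      ((\<Sum>i\<in>UNIV. \<Sum>k\<in>{i<..}. f i k) + (\<Sum>i\<in>UNIV. \<Sum>k\<in>{..<i}. f i k))"
    by (simp add: sum.distrib)
  also have "(\<Sum>i\<in>UNIV. \<Sum>k\<in>{..<i}. f i k) = (\<Sum>i\<in>UNIV. \<Sum>k\<in>{i<..}. f k i)"
  proof -
    have "(\<Sum>i\<in>UNIV. \<Sum>k\<in>{..<i}. f i k) = (\<Sum>i\<in>UNIV. \<Sum>k | k \<in> UNIV \<and> k < i. f i k)"
      by (intro sum.cong) auto
    also have "\<dots> = (\<Sum>k\<in>UNIV. \<Sum>i | i \<in> UNIV \<and> k < i. f i k)"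
      by (rule sum.swap_restrict) auto
    also have "\<dots> = (\<Sum>i\<in>UNIV. \<Sum>k\<in>{i<..}. f k i)"
      by (intro sum.cong) auto
    finally show ?thesis .
  qed
  finally show ?thesis by (simp add: sum.distrib)
qed

lemma clifford_mult_twice:
  fixes \<sigma> :: "'n::{finite,linorder} \<Rightarrow> complex ^ 'm ^ 'm"
  assumes "clifford_family \<sigma>"
  shows "clifford_mult \<sigma> x (clifford_mult \<sigma> x v) = (norm x)\<^sup>2 *\<^sub>R v"
proof -
  have "clifford_mult \<sigma> x (clifford_mult \<sigma> x v) =
      (\<Sum>i\<in>UNIV. \<Sum>k\<in>UNIV. (x $ i * x $ k) *\<^sub>R (\<sigma> i *v (\<sigma> k *v v)))"
    by (simp add: clifford_mult_def mv_simps scaleR_sum_right)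
  also have "\<dots> = (\<Sum>i\<in>UNIV. (x $ i * x $ i) *\<^sub>R v)"
    unfolding sum_pairs_split
    by (simp add: clifford_square[OF assms] clifford_swap_less[OF assms] mult.commute)
  also have "\<dots> = (norm x)\<^sup>2 *\<^sub>R v"
    by (simp add: power2_norm_eq_inner inner_vec_def scaleR_sum_left)
  finally show ?thesis .
qed

lemma clifford_mult_inner:
  assumes "clifford_family \<sigma>"
  shows "inner (clifford_mult \<sigma> x v) w = inner v (clifford_mult \<sigma> x w)"
  by (simp add: clifford_mult_def inner_sum_left inner_sum_right clifford_inner[OF assms])

lemma norm_clifford_mult:
  fixes \<sigma> :: "'n::{finite,linorder} \<Rightarrow> complex ^ 'm ^ 'm"
  assumes "clifford_family \<sigma>"
  shows "(norm (clifford_mult \<sigma> x v))\<^sup>2 = (norm x)\<^sup>2 * (norm v)\<^sup>2"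
  unfolding power2_norm_eq_inner[of v] power2_norm_eq_inner[of "clifford_mult \<sigma> x v"]
  by (simp add: clifford_mult_inner[OF assms] clifford_mult_twice[OF assms])

lemma pderiv_at_eq:
  assumes "(u has_derivative u') (at x)"
  shows "pderiv_at i u x = u' (axis i 1)"
  using frechet_derivative_at[OF assms] by (simp add: pderiv_at_def)

lemma euler_eq:
  assumes "(u has_derivative u') (at x)"
  shows "euler u x = u' x"
  using frechet_derivative_at[OF assms] by (simp add: euler_def)

lemma frechet_derivative_vec_expand:
  fixes u :: "real ^ 'n \<Rightarrow> 'b::real_normed_vector"
  assumes "u differentiable (at x)"
  shows "frechet_derivative u (at x) v = (\<Sum>i\<in>UNIV. (v $ i) *\<^sub>R frechet_derivative u (at x) (axis i 1))"
proof -
  have "linear (frechet_derivative u (at x))"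
    using assms by (rule linear_frechet_derivative)
  then have "frechet_derivative u (at x) (\<Sum>i\<in>UNIV. (v $ i) *\<^sub>R axis i 1) =
     (\<Sum>i\<in>UNIV. (v $ i) *\<^sub>R frechet_derivative u (at x) (axis i 1))"
    by (simp add: linear_sum linear_scale)
  moreover have "(\<Sum>i\<in>UNIV. (v $ i) *\<^sub>R axis i (1::real)) = v"
    by (auto simp: vec_eq_iff axis_def if_distrib cong: if_cong)
  ultimately show ?thesis by simp
qed

lemma euler_expand:
  assumes "u differentiable (at x)"
  shows "euler u x = (\<Sum>i\<in>UNIV. (x $ i) *\<^sub>R pderiv_at i u x)"
  using frechet_derivative_vec_expand[OF assms, of x] by (simp add: euler_def pderiv_at_def)

text \<open>
  In \<open>\<Sum> x\<^sub>i \<sigma>\<^sub>i \<sigma>\<^sub>k \<partial>\<^sub>k\<close> the diagonal terms give the Euler operator because \<open>\<sigma>\<^sub>i\<^sup>2 = 1\<close>; the terms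
  \<open>(i, k)\<close> and \<open>(k, i)\<close> combine by anticommutation to the terms of \<open>L\<close>.
\<close>

lemma clifford_mult_dirac:
  assumes cl: "clifford_family \<sigma>" and d: "u differentiable (at x)"
  shows "clifford_mult \<sigma> x (dirac \<sigma> u x) = euler u x + angular_diff \<sigma> u x"
proof -
  have "clifford_mult \<sigma> x (dirac \<sigma> u x) =
     (\<Sum>i\<in>UNIV. \<Sum>k\<in>UNIV. (x $ i) *\<^sub>R (\<sigma> i *v (\<sigma> k *v pderiv_at k u x)))"
    by (simp add: clifford_mult_def dirac_def mv_simps scaleR_sum_right)
  also have "\<dots> = (\<Sum>i\<in>UNIV. (x $ i) *\<^sub>R pderiv_at i u x) +
      (\<Sum>i\<in>UNIV. \<Sum>k\<in>{i<..}. (x $ i) *\<^sub>R (\<sigma> i *v (\<sigma> k *v pderiv_at k u x))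
          + (x $ k) *\<^sub>R (\<sigma> k *v (\<sigma> i *v pderiv_at i u x)))"
    unfolding sum_pairs_split by (simp add: clifford_square[OF cl])
  also have "(\<Sum>i\<in>UNIV. \<Sum>k\<in>{i<..}. (x $ i) *\<^sub>R (\<sigma> i *v (\<sigma> k *v pderiv_at k u x))
          + (x $ k) *\<^sub>R (\<sigma> k *v (\<sigma> i *v pderiv_at i u x))) = angular_diff \<sigma> u x"
    unfolding angular_diff_def
    by (intro sum.cong refl)
       (simp add: matrix_vector_mul_assoc[symmetric] mv_simps clifford_swap_less[OF cl] algebra_simps)
  finally show ?thesis by (simp add: euler_expand[OF d])
qed

lemma clifford_mult_has_derivative:
  assumes "(q has_derivative q') (at x)"
  shows "((\<lambda>y. clifford_mult \<sigma> y (q y)) has_derivative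
     (\<lambda>h. clifford_mult \<sigma> h (q x) + clifford_mult \<sigma> x (q' h))) (at x)"
proof -
  have "((\<lambda>y. (y $ i) *\<^sub>R (\<sigma> i *v q y)) has_derivative
      (\<lambda>h. (x $ i) *\<^sub>R (\<sigma> i *v q' h) + (h $ i) *\<^sub>R (\<sigma> i *v q x))) (at x)" for i
    by (intro has_derivative_scaleR bounded_linear.has_derivative[OF bounded_linear_mv] assms
         bounded_linear_imp_has_derivative bounded_linear_vec_nth)
  then have "((\<lambda>y. \<Sum>i\<in>UNIV. (y $ i) *\<^sub>R (\<sigma> i *v q y)) has_derivative
      (\<lambda>h. \<Sum>i\<in>UNIV. (x $ i) *\<^sub>R (\<sigma> i *v q' h) + (h $ i) *\<^sub>R (\<sigma> i *v q x))) (at x)"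
    by (intro has_derivative_sum) auto
  then show ?thesis by (simp add: clifford_mult_def sum.distrib add.commute)
qed

lemma clifford_mult_axis: "clifford_mult \<sigma> (axis k 1) v = \<sigma> k *v v"
  by (simp add: clifford_mult_def axis_def if_distrib[of "\<lambda>c. c *\<^sub>R _"] cong: if_cong)

text \<open>
  Differentiating the factor \<open>x\<close> gives \<open>\<Sum> \<sigma>\<^sub>k \<sigma>\<^sub>k = n\<close>. In the remaining terms \<open>\<sigma>\<^sub>k\<close> has to be moved past \<open>\<sigma>\<^sub>i\<close>,
  and the anticommutators add up to \<open>2 E\<close>.
\<close>

lemma dirac_clifford_mult:
  fixes \<sigma> :: "'n::{finite,linorder} \<Rightarrow> complex ^ 'm ^ 'm"
  assumes cl: "clifford_family \<sigma>" and d: "q differentiable (at x)"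
  shows "dirac \<sigma> (\<lambda>y. clifford_mult \<sigma> y (q y)) x =
     real CARD('n) *\<^sub>R q x + 2 *\<^sub>R euler q x - clifford_mult \<sigma> x (dirac \<sigma> q x)"
proof -
  obtain q' where q': "(q has_derivative q') (at x)" using d by (auto simp: differentiable_def)
  have p: "pderiv_at k (\<lambda>y. clifford_mult \<sigma> y (q y)) x = \<sigma> k *v q x + clifford_mult \<sigma> x (pderiv_at k q x)" for k
    by (simp add: pderiv_at_eq[OF clifford_mult_has_derivative[OF q']] pderiv_at_eq[OF q'] clifford_mult_axis)
  have s: "\<sigma> k *v clifford_mult \<sigma> x v = 2 *\<^sub>R ((x $ k) *\<^sub>R v) - clifford_mult \<sigma> x (\<sigma> k *v v)" for k v
  proof -
    have "\<sigma> k *v clifford_mult \<sigma> x v + clifford_mult \<sigma> x (\<sigma> k *v v) =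
        (\<Sum>i\<in>UNIV. (x $ i) *\<^sub>R (\<sigma> k *v (\<sigma> i *v v) + \<sigma> i *v (\<sigma> k *v v)))"
      by (simp add: clifford_mult_def mv_simps sum.distrib scaleR_add_right)
    also have "\<dots> = (\<Sum>i\<in>UNIV. if i = k then 2 *\<^sub>R ((x $ k) *\<^sub>R v) else 0)"
      unfolding clifford_anticomm[OF cl] by (intro sum.cong) auto
    finally show ?thesis by (simp add: algebra_simps)
  qed
  have "dirac \<sigma> (\<lambda>y. clifford_mult \<sigma> y (q y)) x =
     (\<Sum>k\<in>UNIV. q x + (2 *\<^sub>R ((x $ k) *\<^sub>R pderiv_at k q x) - clifford_mult \<sigma> x (\<sigma> k *v pderiv_at k q x)))"
    by (simp add: dirac_def p mv_simps clifford_square[OF cl] s)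
  also have "\<dots> = real CARD('n) *\<^sub>R q x + 2 *\<^sub>R euler q x - clifford_mult \<sigma> x (dirac \<sigma> q x)"
    by (simp add: sum.distrib sum_subtractf euler_expand[OF d] dirac_def clifford_mult_simps
        scaleR_sum_right sum_constant_scaleR del: sum_constant)
  finally show ?thesis .
qed

text \<open>
  Clifford multiplication by \<open>x\<close> intertwines \<open>L\<close> with \<open>n - 1 - L\<close>. This symmetry of the spectrum
  produces the positive eigenvalues from the nonpositive ones.
\<close>

lemma angular_diff_clifford_mult:
  fixes \<sigma> :: "'n::{finite,linorder} \<Rightarrow> complex ^ 'm ^ 'm"
  assumes cl: "clifford_family \<sigma>" and d: "q differentiable (at x)"
  shows "angular_diff \<sigma> (\<lambda>y. clifford_mult \<sigma> y (q y)) x =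
     clifford_mult \<sigma> x ((real CARD('n) - 1) *\<^sub>R q x - angular_diff \<sigma> q x)"
proof -
  obtain q' where q': "(q has_derivative q') (at x)" using d by (auto simp: differentiable_def)
  note D = clifford_mult_has_derivative[OF q', of \<sigma>]
  have "clifford_mult \<sigma> x (dirac \<sigma> (\<lambda>y. clifford_mult \<sigma> y (q y)) x) =
     euler (\<lambda>y. clifford_mult \<sigma> y (q y)) x + angular_diff \<sigma> (\<lambda>y. clifford_mult \<sigma> y (q y)) x"
    by (rule clifford_mult_dirac[OF cl]) (use D in \<open>auto simp: differentiable_def\<close>)
  then have "angular_diff \<sigma> (\<lambda>y. clifford_mult \<sigma> y (q y)) x =
     clifford_mult \<sigma> x (dirac \<sigma> (\<lambda>y. clifford_mult \<sigma> y (q y)) x)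
      - clifford_mult \<sigma> x (q x) - clifford_mult \<sigma> x (euler q x)"
    by (simp add: euler_eq[OF D] euler_eq[OF q'])
  also have "\<dots> = clifford_mult \<sigma> x (real CARD('n) *\<^sub>R q x + 2 *\<^sub>R euler q x - (euler q x + angular_diff \<sigma> q x)
      - q x - euler q x)"
    by (simp only: dirac_clifford_mult[OF cl d] clifford_mult_dirac[OF cl d] linear_clifford_mult[THEN linear_diff])
  also have "real CARD('n) *\<^sub>R q x + 2 *\<^sub>R euler q x - (euler q x + angular_diff \<sigma> q x) - q x - euler q x
      = (real CARD('n) - 1) *\<^sub>R q x - angular_diff \<sigma> q x"
    by (simp add: scaleR_diff_left scaleR_2)
  finally show ?thesis .
qed

section \<open>Eigenfunctions of the angular operator among homogeneous polynomials\<close>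

text \<open>
  Homogeneous polynomials of degree \<open>d\<close>. They are encoded by Euler's identity instead of monomials:
  what matters below is how Euler and Dirac operator act on them, and smoothness is immediate.
\<close>

primrec hom_poly :: "nat \<Rightarrow> (real ^ 'n \<Rightarrow> complex ^ 'm) \<Rightarrow> bool" where
  "hom_poly 0 p \<longleftrightarrow> (\<exists>c. p = (\<lambda>_. c))"
| "hom_poly (Suc d) p \<longleftrightarrow> (\<forall>x. p differentiable (at x)) \<and> (\<forall>i. hom_poly d (pderiv_at i p)) \<and>
     (\<forall>x. euler p x = real (Suc d) *\<^sub>R p x)"

lemma has_derivative_imp_differentiable: "(f has_derivative f') F \<Longrightarrow> f differentiable F"
  by (auto simp: differentiable_def)

lemma hom_poly_differentiable: "hom_poly d p \<Longrightarrow> p differentiable (at x)"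
  by (cases d) auto

lemma hom_poly_has_derivative:
  "hom_poly d p \<Longrightarrow> (p has_derivative frechet_derivative p (at x)) (at x)"
  using hom_poly_differentiable frechet_derivative_works by blast

lemma hom_poly_euler: "hom_poly d p \<Longrightarrow> euler p x = real d *\<^sub>R p x"
  by (cases d) (auto simp: euler_def)

lemma pderiv_at_const: "pderiv_at i (\<lambda>_. c) = (\<lambda>_. 0)"
  by (auto simp: pderiv_at_def)

lemma hom_poly_zero: "hom_poly d (\<lambda>_. 0)"
  by (induction d) (auto simp: pderiv_at_const euler_def)

lemma hom_poly_add: "hom_poly d p \<Longrightarrow> hom_poly d q \<Longrightarrow> hom_poly d (\<lambda>x. p x + q x)"
proof (induction d arbitrary: p q)
  case (Suc d)
  note D = has_derivative_add[OF Suc.prems[THEN hom_poly_has_derivative]]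
  have "pderiv_at i (\<lambda>x. p x + q x) = (\<lambda>x. pderiv_at i p x + pderiv_at i q x)" for i
    by (rule ext) (simp add: pderiv_at_eq[OF D], simp add: pderiv_at_def)
  moreover have "euler (\<lambda>x. p x + q x) x = euler p x + euler q x" for x
    by (simp add: euler_eq[OF D], simp add: euler_def)
  ultimately show ?case
    using Suc has_derivative_imp_differentiable[OF D] by (auto simp: scaleR_add_right[symmetric])
qed auto

lemma hom_poly_bounded_linear:
  assumes T: "bounded_linear T"
  shows "hom_poly d p \<Longrightarrow> hom_poly d (\<lambda>x. T (p x))"
proof (induction d arbitrary: p)
  case (Suc d)
  note D = bounded_linear.has_derivative[OF T Suc.prems[THEN hom_poly_has_derivative]]
  have "pderiv_at i (\<lambda>x. T (p x)) = (\<lambda>x. T (pderiv_at i p x))" for i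
    by (rule ext) (simp add: pderiv_at_eq[OF D], simp add: pderiv_at_def)
  moreover have "euler (\<lambda>x. T (p x)) x = T (euler p x)" for x
    by (simp add: euler_eq[OF D], simp add: euler_def)
  ultimately show ?case
    using Suc has_derivative_imp_differentiable[OF D] by (auto simp: linear_scale[OF bounded_linear.linear[OF T]])
qed auto

lemma hom_poly_scaleR: "hom_poly d p \<Longrightarrow> hom_poly d (\<lambda>x. c *\<^sub>R p x)"
  by (rule hom_poly_bounded_linear[OF bounded_linear_scaleR_right])

lemma hom_poly_mv: "hom_poly d p \<Longrightarrow> hom_poly d (\<lambda>x. (A :: complex ^ 'm ^ 'm) *v p x)"
  by (rule hom_poly_bounded_linear[OF bounded_linear_mv])

lemma hom_poly_diff: "hom_poly d p \<Longrightarrow> hom_poly d q \<Longrightarrow> hom_poly d (\<lambda>x. p x - q x)"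
  using hom_poly_add[of d p "\<lambda>x. (-1) *\<^sub>R q x"] hom_poly_scaleR[of d q "-1"] by simp

lemma hom_poly_sum: "(\<And>i. i \<in> I \<Longrightarrow> hom_poly d (p i)) \<Longrightarrow> hom_poly d (\<lambda>x. \<Sum>i\<in>I. p i x)"
  by (induction I rule: infinite_finite_induct) (auto simp: hom_poly_zero intro: hom_poly_add)

lemma hom_poly_coord: "hom_poly d p \<Longrightarrow> hom_poly (Suc d) (\<lambda>x. (x $ i) *\<^sub>R p x)"
proof (induction d arbitrary: p)
  case 0
  then obtain c where p: "p = (\<lambda>_. c)" by auto
  have D: "((\<lambda>x. (x $ i) *\<^sub>R c) has_derivative (\<lambda>h. (h $ i) *\<^sub>R c)) (at x)" for x :: "real ^ 'a"
    by (intro bounded_linear.has_derivative[OF bounded_linear_scaleR_left]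
        bounded_linear_imp_has_derivative bounded_linear_vec_nth)
  then show ?case
    using D by (auto simp: p differentiable_def pderiv_at_eq[OF D, abs_def] euler_eq[OF D])
next
  case (Suc d)
  have D: "((\<lambda>x. (x $ i) *\<^sub>R p x) has_derivative
      (\<lambda>h. (x $ i) *\<^sub>R frechet_derivative p (at x) h + (h $ i) *\<^sub>R p x)) (at x)" for x :: "real ^ 'a"
    by (intro has_derivative_scaleR bounded_linear_imp_has_derivative bounded_linear_vec_nth
        hom_poly_has_derivative[OF Suc.prems])
  have "pderiv_at k (\<lambda>x. (x $ i) *\<^sub>R p x) = (\<lambda>x. (x $ i) *\<^sub>R pderiv_at k p x + (if i = k then 1 else 0) *\<^sub>R p x)" for k
    by (rule ext) (simp add: pderiv_at_eq[OF D], simp add: pderiv_at_def axis_def)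
  moreover have "hom_poly (Suc d) (\<lambda>x. (x $ i) *\<^sub>R pderiv_at k p x + (if i = k then 1 else 0) *\<^sub>R p x)" for k
    using Suc.prems by (intro hom_poly_add Suc.IH hom_poly_scaleR) auto
  moreover have "euler (\<lambda>x. (x $ i) *\<^sub>R p x) x = real (Suc (Suc d)) *\<^sub>R (x $ i) *\<^sub>R p x" for x
  proof -
    have "euler (\<lambda>x. (x $ i) *\<^sub>R p x) x = (x $ i) *\<^sub>R euler p x + (x $ i) *\<^sub>R p x"
      by (simp add: euler_eq[OF D], simp add: euler_def)
    also have "\<dots> = ((x $ i) * real (Suc d) + x $ i) *\<^sub>R p x"
      by (simp only: hom_poly_euler[OF Suc.prems] scaleR_add_left scaleR_scaleR)
    also have "(x $ i) * real (Suc d) + x $ i = real (Suc (Suc d)) * x $ i"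
      by (simp add: algebra_simps)
    finally show ?thesis by (simp only: scaleR_scaleR)
  qed
  ultimately show ?case
    unfolding hom_poly.simps(2)[of "Suc d"] using has_derivative_imp_differentiable[OF D]
    by (auto simp del: hom_poly.simps)
qed

lemma hom_poly_clifford_mult: "hom_poly d p \<Longrightarrow> hom_poly (Suc d) (\<lambda>x. clifford_mult \<sigma> x (p x))"
  unfolding clifford_mult_def by (intro hom_poly_sum hom_poly_coord hom_poly_mv)

lemma hom_poly_dirac: "hom_poly (Suc d) p \<Longrightarrow> hom_poly d (dirac \<sigma> p)"
  unfolding dirac_def[abs_def] by (intro hom_poly_sum hom_poly_mv) auto

lemma hom_poly_deriv: "hom_poly d p \<Longrightarrow> hom_poly (d - 1) (\<lambda>x. frechet_derivative p (at x) v)"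
proof (cases d)
  case (Suc e)
  assume p: "hom_poly d p"
  have "(\<lambda>x. frechet_derivative p (at x) v) = (\<lambda>x. \<Sum>i\<in>UNIV. (v $ i) *\<^sub>R pderiv_at i p x)"
    by (rule ext) (simp add: frechet_derivative_vec_expand[OF hom_poly_differentiable[OF p], of _ v] pderiv_at_def)
  moreover have "hom_poly e (\<lambda>x. \<Sum>i\<in>UNIV. (v $ i) *\<^sub>R pderiv_at i p x)"
    using p Suc by (intro hom_poly_sum hom_poly_scaleR) auto
  ultimately show ?thesis by (simp add: Suc)
qed auto

lemma hom_poly_continuous: "hom_poly d p \<Longrightarrow> continuous_on S p"
  using hom_poly_differentiable
  by (metis continuous_at_imp_continuous_on differentiable_imp_continuous_within)

lemma hom_poly_higher_differentiable: "hom_poly d p \<Longrightarrow> higher_differentiable_on S p k"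
proof (induction k arbitrary: d p)
  case 0
  then show ?case by (simp add: hom_poly_continuous)
next
  case (Suc k)
  then show ?case using hom_poly_differentiable hom_poly_deriv by fastforce
qed

lemma hom_poly_smooth: "hom_poly d p \<Longrightarrow> smooth_on S p"
  by (simp add: smooth_on_def hom_poly_higher_differentiable)

lemma angular_diff_eq:
  assumes "(F has_derivative F') (at x)"
  shows "angular_diff \<sigma> F x = (\<Sum>i\<in>UNIV. \<Sum>k\<in>{i<..}.
        (\<sigma> i ** \<sigma> k) *v ((x $ i) *\<^sub>R F' (axis k 1) - (x $ k) *\<^sub>R F' (axis i 1)))"
  by (simp add: angular_diff_def pderiv_at_eq[OF assms])

lemma angular_diff_add:
  assumes "f differentiable (at x)" "g differentiable (at x)"
  shows "angular_diff \<sigma> (\<lambda>x. f x + g x) x = angular_diff \<sigma> f x + angular_diff \<sigma> g x"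
proof -
  obtain f' g' where D: "(f has_derivative f') (at x)" "(g has_derivative g') (at x)"
    using assms by (auto simp: differentiable_def)
  show ?thesis
    by (simp add: angular_diff_eq[OF has_derivative_add[OF D]] D[THEN angular_diff_eq] mv_simps
        scaleR_add_right sum.distrib[symmetric] algebra_simps)
qed

lemma angular_diff_const: "angular_diff \<sigma> (\<lambda>_. c) x = 0"
  by (simp add: angular_diff_def pderiv_at_const mv_simps)

lemma angular_diff_scaleR:
  assumes "f differentiable (at x)"
  shows "angular_diff \<sigma> (\<lambda>x. c *\<^sub>R f x) x = c *\<^sub>R angular_diff \<sigma> f x"
proof -
  obtain f' where D: "(f has_derivative f') (at x)"
    using assms by (auto simp: differentiable_def)
  show ?thesis
    by (simp add: angular_diff_eq[OF has_derivative_scaleR_right[OF D]] angular_diff_eq[OF D] mv_simps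
        scaleR_sum_right scaleR_diff_right mult.commute)
qed

lemma angular_diff_sum:
  assumes "finite I" "\<And>i. i \<in> I \<Longrightarrow> f i differentiable (at x)"
  shows "angular_diff \<sigma> (\<lambda>x. \<Sum>i\<in>I. f i x) x = (\<Sum>i\<in>I. angular_diff \<sigma> (f i) x)"
  using assms
proof (induction I)
  case (insert i I)
  then show ?case by (simp add: angular_diff_add differentiable_sum)
qed (simp add: angular_diff_const)

lemma angular_diff_diff:
  assumes "f differentiable (at x)" "g differentiable (at x)"
  shows "angular_diff \<sigma> (\<lambda>x. f x - g x) x = angular_diff \<sigma> f x - angular_diff \<sigma> g x"
  using angular_diff_add[of f x "\<lambda>x. (-1) *\<^sub>R g x" \<sigma>] angular_diff_scaleR[of g x \<sigma> "-1"] assms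
    differentiable_minus[of g "at x"] by simp

definition angular_eigen ::
  "('n \<Rightarrow> complex ^ 'm ^ 'm) \<Rightarrow> int \<Rightarrow> (real ^ 'n::{finite,linorder} \<Rightarrow> complex ^ 'm) \<Rightarrow> bool" where
  "angular_eigen \<sigma> k q \<longleftrightarrow> (\<forall>x. angular_diff \<sigma> q x = of_int k *\<^sub>R q x)"

lemma clifford_mult_eigen:
  fixes \<sigma> :: "'n::{finite,linorder} \<Rightarrow> complex ^ 'm ^ 'm"
  assumes cl: "clifford_family \<sigma>" and q: "hom_poly d q" "angular_eigen \<sigma> (int CARD('n) - 1 - k) q"
  shows "angular_eigen \<sigma> k (\<lambda>x. clifford_mult \<sigma> x (q x))"
  unfolding angular_eigen_def
proof
  fix x
  have "angular_diff \<sigma> (\<lambda>y. clifford_mult \<sigma> y (q y)) x =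
      clifford_mult \<sigma> x ((real CARD('n) - 1) *\<^sub>R q x - (real CARD('n) - 1 - of_int k) *\<^sub>R q x)"
    using q(2) angular_diff_clifford_mult[OF cl hom_poly_differentiable[OF q(1), of x]]
    by (simp add: angular_eigen_def)
  also have "(real CARD('n) - 1) *\<^sub>R q x - (real CARD('n) - 1 - of_int k) *\<^sub>R q x = of_int k *\<^sub>R q x"
    by (simp add: scaleR_left_diff_distrib[symmetric])
  finally show "angular_diff \<sigma> (\<lambda>y. clifford_mult \<sigma> y (q y)) x = of_int k *\<^sub>R clifford_mult \<sigma> x (q x)"
    by (simp add: clifford_mult_simps)
qed

lemma hom_poly_clifford_dirac:
  assumes "clifford_family \<sigma>" "hom_poly d p"
  shows "clifford_mult \<sigma> x (dirac \<sigma> p x) = real d *\<^sub>R p x + angular_diff \<sigma> p x"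
  using clifford_mult_dirac[OF assms(1) hom_poly_differentiable[OF assms(2)]] hom_poly_euler[OF assms(2)]
  by simp

text \<open>
  By induction on the degree. For \<open>p\<close> of degree \<open>d + 1\<close>, the polynomial \<open>x D p = (L + d + 1) p\<close> is a
  finite sum of eigenfunctions \<open>s\<^sub>k\<close>: the induction hypothesis applies to \<open>D p\<close>, and multiplication by
  \<open>x\<close> maps eigenfunctions to eigenfunctions. Dividing \<open>s\<^sub>k\<close> by \<open>k + d + 1\<close> inverts \<open>L + d + 1\<close> up to its
  kernel, and the remainder is an eigenfunction for \<open>-(d + 1)\<close>. The range of \<open>k\<close> is part of the
  statement because it guarantees that the divisor is not zero.
\<close>

lemma hom_poly_eigen_decomposition:
  fixes \<sigma> :: "'n::{finite,linorder} \<Rightarrow> complex ^ 'm ^ 'm"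
  assumes n: "CARD('n) \<ge> 2" and cl: "clifford_family \<sigma>" and p: "hom_poly d p"
  shows "\<exists>q. (\<forall>k. hom_poly d (q k) \<and> angular_eigen \<sigma> k (q k)) \<and>
    (\<forall>x. p x = (\<Sum>k\<in>{- int d..int d + int CARD('n) - 2}. q k x))"
  using p
proof (induction d arbitrary: p)
  case 0
  then obtain c where p: "p = (\<lambda>_. c)" by auto
  have "p x = (\<Sum>k\<in>{- int 0..int 0 + int CARD('n) - 2}. (if k = 0 then p else (\<lambda>_. 0)) x)" for x
    using n by (simp add: if_distrib[of "\<lambda>f. f x"] cong: if_cong)
  then show ?case
    by (intro exI[of _ "\<lambda>k. if k = 0 then p else (\<lambda>_. 0)"])
       (auto simp: p angular_eigen_def angular_diff_const)
next
  case (Suc d)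
  define n where "n = int CARD('n)"
  obtain q where q: "\<And>k. hom_poly d (q k)" "\<And>k. angular_eigen \<sigma> k (q k)"
    and ps: "\<And>x. dirac \<sigma> p x = (\<Sum>k\<in>{- int d..int d + n - 2}. q k x)"
    using Suc.IH[OF hom_poly_dirac[OF Suc.prems]] unfolding n_def by blast
  define s where "s k x = clifford_mult \<sigma> x (q (n - 1 - k) x)" for k x
  have s: "hom_poly (Suc d) (s k)" "angular_eigen \<sigma> k (s k)" for k
    using hom_poly_clifford_mult[OF q(1), of \<sigma> "n - 1 - k"]
      clifford_mult_eigen[OF cl q(1), of k "n - 1 - k"] q(2)[of "n - 1 - k"]
    by (auto simp: s_def[abs_def] n_def simp del: hom_poly.simps)
  define K where "K = {1 - int d..n - 1 + int d}"
  have K: "k + int d + 1 \<noteq> 0" if "k \<in> K" for k using that by (auto simp: K_def)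
  then have K': "real_of_int k + (real d + 1) \<noteq> 0" if "k \<in> K" for k
    using that by (metis (no_types, opaque_lifting) add.assoc of_int_0_eq_iff of_int_1 of_int_add of_int_of_nat_eq)
  have ss: "(\<Sum>k\<in>K. s k x) = real (Suc d) *\<^sub>R p x + angular_diff \<sigma> p x" for x
  proof -
    have "(\<Sum>k\<in>K. s k x) = (\<Sum>k\<in>{- int d..int d + n - 2}. clifford_mult \<sigma> x (q k x))"
      by (rule sum.reindex_bij_witness[of _ "\<lambda>k. n - 1 - k" "\<lambda>k. n - 1 - k"]) (auto simp: K_def s_def)
    also have "\<dots> = clifford_mult \<sigma> x (dirac \<sigma> p x)"
      by (simp add: ps clifford_mult_simps)
    finally show ?thesis using hom_poly_clifford_dirac[OF cl Suc.prems] by simp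
  qed
  \<comment> \<open>the inverse of \<open>L + d + 1\<close> on the eigenfunction \<open>s k\<close>\<close>
  define t where "t k x = (1 / (real_of_int k + (real d + 1))) *\<^sub>R s k x" for k x
  have t: "hom_poly (Suc d) (t k)" "angular_eigen \<sigma> k (t k)" for k
    using hom_poly_scaleR[OF s(1)] s(2)
    by (auto simp: t_def[abs_def] angular_eigen_def angular_diff_scaleR[OF hom_poly_differentiable[OF s(1)]])
  define r where "r x = p x - (\<Sum>k\<in>K. t k x)" for x
  have r: "hom_poly (Suc d) r"
    unfolding r_def[abs_def] by (intro hom_poly_diff hom_poly_sum Suc.prems t)
  have "angular_diff \<sigma> r x = of_int (- int (Suc d)) *\<^sub>R r x" for x
  proof -
    have "angular_diff \<sigma> r x = angular_diff \<sigma> p x - (\<Sum>k\<in>K. angular_diff \<sigma> (t k) x)"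
      unfolding r_def[abs_def]
      by (subst angular_diff_diff, rule hom_poly_differentiable[OF Suc.prems],
          rule hom_poly_differentiable[OF hom_poly_sum[OF t(1)]], subst angular_diff_sum)
         (auto simp: K_def hom_poly_differentiable[OF t(1)])
    also have "\<dots> = ((\<Sum>k\<in>K. s k x) - (\<Sum>k\<in>K. of_int k *\<^sub>R t k x)) - real (Suc d) *\<^sub>R p x"
      using t(2) by (simp add: angular_eigen_def ss)
    also have "(\<Sum>k\<in>K. s k x) - (\<Sum>k\<in>K. of_int k *\<^sub>R t k x) = (\<Sum>k\<in>K. real (Suc d) *\<^sub>R t k x)"
      unfolding sum_subtractf[symmetric]
    proof (rule sum.cong[OF refl])
      fix k assume k: "k \<in> K"
      have "s k x = (of_int k + (real d + 1)) *\<^sub>R t k x" using K'[OF k] by (simp add: t_def)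
      then show "s k x - of_int k *\<^sub>R t k x = real (Suc d) *\<^sub>R t k x"
        by (simp add: scaleR_left_diff_distrib[symmetric])
    qed
    also have "(\<Sum>k\<in>K. real (Suc d) *\<^sub>R t k x) - real (Suc d) *\<^sub>R p x = - (real (Suc d) *\<^sub>R r x)"
      by (simp only: r_def scaleR_diff_right scaleR_sum_right minus_diff_eq)
    finally show ?thesis by (simp only: of_int_minus of_int_of_nat_eq scaleR_minus_left)
  qed
  then have re: "angular_eigen \<sigma> (- int (Suc d)) r" by (simp add: angular_eigen_def)
  define q' where "q' k = (if k = - int (Suc d) then r else if k \<in> K then t k else (\<lambda>_. 0))" for k
  have "(\<Sum>k\<in>{- int (Suc d)..int (Suc d) + int CARD('n) - 2}. q' k x) = p x" for x
  proof -
    have "(\<Sum>k\<in>{- int (Suc d)..int (Suc d) + int CARD('n) - 2}. q' k x) = (\<Sum>k\<in>insert (- int (Suc d)) K. q' k x)"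
      by (rule sum.mono_neutral_right) (auto simp: K_def n_def q'_def)
    also have "\<dots> = r x + (\<Sum>k\<in>K. t k x)"
      by (subst sum.insert) (auto simp: K_def q'_def intro!: arg_cong2[where f="(+)"] sum.cong)
    finally show ?thesis by (simp add: r_def)
  qed
  moreover have "hom_poly (Suc d) (q' k) \<and> angular_eigen \<sigma> k (q' k)" for k
    using r re t by (simp add: q'_def hom_poly_zero angular_eigen_def angular_diff_const del: hom_poly.simps)
  ultimately show ?case by (intro exI[of _ q']) auto
qed

section \<open>Polynomials as sums of eigenfunctions\<close>

lemma higher_differentiable_on_subset:
  "higher_differentiable_on T f k \<Longrightarrow> S \<subseteq> T \<Longrightarrow> higher_differentiable_on S f k"
  by (induction k arbitrary: f) (auto intro: continuous_on_subset)

lemma smooth_on_subset: "smooth_on T f \<Longrightarrow> S \<subseteq> T \<Longrightarrow> smooth_on S f"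
  by (auto simp: smooth_on_def intro: higher_differentiable_on_subset)

lemma higher_differentiable_on_add:
  "higher_differentiable_on UNIV f k \<Longrightarrow> higher_differentiable_on UNIV g k \<Longrightarrow>
   higher_differentiable_on UNIV (\<lambda>x. f x + g x) k"
proof (induction k arbitrary: f g)
  case 0
  then show ?case by (auto intro: continuous_on_add)
next
  case (Suc k)
  have "frechet_derivative (\<lambda>x. f x + g x) (at x) v =
      frechet_derivative f (at x) v + frechet_derivative g (at x) v" for x v
  proof -
    have "((\<lambda>x. f x + g x) has_derivative
        (\<lambda>v. frechet_derivative f (at x) v + frechet_derivative g (at x) v)) (at x)"
      using Suc.prems by (intro has_derivative_add) (auto simp: frechet_derivative_works[symmetric])
    from frechet_derivative_at[OF this] show ?thesis by metis
  qed
  then show ?case using Suc by auto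
qed

lemma smooth_on_add: "smooth_on UNIV f \<Longrightarrow> smooth_on UNIV g \<Longrightarrow> smooth_on UNIV (\<lambda>x. f x + g x)"
  by (auto simp: smooth_on_def intro: higher_differentiable_on_add)

lemma smooth_on_differentiable: "smooth_on S f \<Longrightarrow> x \<in> S \<Longrightarrow> f differentiable (at x)"
  by (auto simp: smooth_on_def dest: spec[of _ "Suc 0"])

inductive hom_poly_sum :: "(real ^ 'n \<Rightarrow> complex ^ 'm) \<Rightarrow> bool" where
  hom: "hom_poly d p \<Longrightarrow> hom_poly_sum p"
| add: "hom_poly_sum p \<Longrightarrow> hom_poly_sum q \<Longrightarrow> hom_poly_sum (\<lambda>x. p x + q x)"

lemma hom_poly_sum_scaleR: "hom_poly_sum p \<Longrightarrow> hom_poly_sum (\<lambda>x. c *\<^sub>R p x)"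
  by (induction rule: hom_poly_sum.induct)
     (auto simp: scaleR_add_right intro: hom_poly_sum.intros hom_poly_scaleR)

lemma hom_poly_sum_coord: "hom_poly_sum p \<Longrightarrow> hom_poly_sum (\<lambda>x. (x $ i) *\<^sub>R p x)"
proof (induction rule: hom_poly_sum.induct)
  case (hom d p)
  then show ?case by (rule hom_poly_sum.hom[OF hom_poly_coord])
qed (auto simp: scaleR_add_right intro: hom_poly_sum.add)

lemma hom_poly_sum_sum:
  assumes "\<And>i. i \<in> I \<Longrightarrow> hom_poly_sum (p i)"
  shows "hom_poly_sum (\<lambda>x. \<Sum>i\<in>I. p i x)"
  using assms
  by (induction I rule: infinite_finite_induct)
     (auto intro: hom_poly_sum.intros hom_poly_zero[of 0])

text \<open>
  Closure under multiplication by a scalar polynomial, by induction on the way that the scalar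
  polynomial is built; products are then covered by two successive multiplications.
\<close>

lemma hom_poly_sum_mult:
  fixes s :: "real ^ 'n \<Rightarrow> real"
  assumes "real_polynomial_function s"
  shows "hom_poly_sum p \<Longrightarrow> hom_poly_sum (\<lambda>x. s x *\<^sub>R p x)"
  using assms
proof (induction s arbitrary: p rule: real_polynomial_function.induct)
  case (linear f)
  interpret f: bounded_linear f by fact
  have fx: "f x = (\<Sum>i\<in>UNIV. f (axis i 1) * x $ i)" for x
  proof -
    have "f x = f (\<Sum>i\<in>UNIV. (x $ i) *\<^sub>R axis i 1)"
      by (rule arg_cong[where f=f]) (auto simp: vec_eq_iff axis_def if_distrib cong: if_cong)
    then show ?thesis by (simp add: f.sum f.scaleR mult.commute)
  qed
  have eq: "f x *\<^sub>R p x = (\<Sum>i\<in>UNIV. f (axis i 1) *\<^sub>R ((x $ i) *\<^sub>R p x))" for x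
    by (subst fx) (simp add: scaleR_sum_left)
  have "hom_poly_sum (\<lambda>x. \<Sum>i\<in>UNIV. f (axis i 1) *\<^sub>R ((x $ i) *\<^sub>R p x))"
    by (rule hom_poly_sum_sum, rule hom_poly_sum_scaleR, rule hom_poly_sum_coord, rule linear(2))
  then show ?case by (simp only: eq)
next
  case (const c)
  then show ?case by (rule hom_poly_sum_scaleR)
next
  case (add f g)
  then show ?case by (simp add: scaleR_add_left hom_poly_sum.add)
next
  case (mult f g)
  have "hom_poly_sum (\<lambda>x. f x *\<^sub>R (g x *\<^sub>R p x))"
    by (intro mult)
  then show ?case by simp
qed

lemma polynomial_function_hom_poly_sum:
  fixes p :: "real ^ 'n \<Rightarrow> complex ^ 'm"
  assumes "polynomial_function p"
  shows "hom_poly_sum p"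
proof -
  have "p = (\<lambda>x. \<Sum>b\<in>Basis. (p x \<bullet> b) *\<^sub>R b)"
    by (simp add: euclidean_representation)
  moreover have "real_polynomial_function (\<lambda>x. p x \<bullet> b)" for b
    using assms bounded_linear_inner_left[of b] by (auto simp: polynomial_function_def o_def)
  then have "hom_poly_sum (\<lambda>x. \<Sum>b\<in>Basis. (p x \<bullet> b) *\<^sub>R b)"
    by (intro hom_poly_sum_sum hom_poly_sum_mult hom_poly_sum.hom[of 0]) auto
  ultimately show ?thesis by simp
qed

lemma hom_poly_sum_eigen_decomposition:
  fixes \<sigma> :: "'n::{finite,linorder} \<Rightarrow> complex ^ 'm ^ 'm"
  assumes n: "CARD('n) \<ge> 2" and cl: "clifford_family \<sigma>" and p: "hom_poly_sum p"
  shows "\<exists>N q. (\<forall>k. smooth_on UNIV (q k) \<and> angular_eigen \<sigma> k (q k)) \<and>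
    (\<forall>x. p x = (\<Sum>k\<in>{- int N..int N}. q k x))"
  using p
proof (induction rule: hom_poly_sum.induct)
  case (hom d p)
  obtain q where q: "\<And>k. hom_poly d (q k)" "\<And>k. angular_eigen \<sigma> k (q k)"
    and ps: "\<And>x. p x = (\<Sum>k\<in>{- int d..int d + int CARD('n) - 2}. q k x)"
    using hom_poly_eigen_decomposition[OF n cl hom] by blast
  define K where "K = {- int d..int d + int CARD('n) - 2}"
  define q' where "q' k = (if k \<in> K then q k else (\<lambda>_. 0))" for k
  have "p x = (\<Sum>k\<in>{- int (d + CARD('n))..int (d + CARD('n))}. q' k x)" for x
    unfolding ps by (rule sum.mono_neutral_cong_left) (auto simp: q'_def K_def)
  moreover have "smooth_on UNIV (q' k) \<and> angular_eigen \<sigma> k (q' k)" for k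
    using q hom_poly_smooth[OF q(1)[of k]] hom_poly_smooth[OF hom_poly_zero]
    by (auto simp: q'_def angular_eigen_def angular_diff_const)
  ultimately show ?case by blast
next
  case (add p p')
  then obtain N q N' q' where q: "\<And>k. smooth_on UNIV (q k)" "\<And>k. angular_eigen \<sigma> k (q k)"
    "\<And>x. p x = (\<Sum>k\<in>{- int N..int N}. q k x)"
    and q': "\<And>k. smooth_on UNIV (q' k)" "\<And>k. angular_eigen \<sigma> k (q' k)"
    "\<And>x. p' x = (\<Sum>k\<in>{- int N'..int N'}. q' k x)" by metis
  define t where "t k = (if \<bar>k\<bar> \<le> int N then q k else (\<lambda>_. 0))" for k
  define t' where "t' k = (if \<bar>k\<bar> \<le> int N' then q' k else (\<lambda>_. 0))" for k
  define M where "M = max N N'"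
  have "p x = (\<Sum>k\<in>{- int M..int M}. t k x)" "p' x = (\<Sum>k\<in>{- int M..int M}. t' k x)" for x
    unfolding q(3) q'(3) by (rule sum.mono_neutral_cong_left; force simp: t_def t'_def M_def)+
  then have "p x + p' x = (\<Sum>k\<in>{- int M..int M}. t k x + t' k x)" for x
    by (simp add: sum.distrib)
  moreover have "smooth_on UNIV (t k)" "smooth_on UNIV (t' k)" "angular_eigen \<sigma> k (t k)" "angular_eigen \<sigma> k (t' k)" for k
    using q q' hom_poly_smooth[OF hom_poly_zero]
    by (auto simp: t_def t'_def angular_eigen_def angular_diff_const)
  moreover from this have "smooth_on UNIV (\<lambda>x. t k x + t' k x) \<and> angular_eigen \<sigma> k (\<lambda>x. t k x + t' k x)" for k
  proof -
    have "t k differentiable (at x)" "t' k differentiable (at x)" for x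
      using smooth_on_differentiable[OF \<open>smooth_on UNIV (t k)\<close>] smooth_on_differentiable[OF \<open>smooth_on UNIV (t' k)\<close>]
      by auto
    then show ?thesis
      using \<open>angular_eigen \<sigma> k (t k)\<close> \<open>angular_eigen \<sigma> k (t' k)\<close>
        smooth_on_add[OF \<open>smooth_on UNIV (t k)\<close> \<open>smooth_on UNIV (t' k)\<close>]
      by (simp add: angular_eigen_def angular_diff_add scaleR_add_right)
  qed
  ultimately show ?case by (intro exI[of _ M] exI[of _ "\<lambda>k x. t k x + t' k x"]) blast
qed

section \<open>Rotation invariance and the surface measure\<close>

lemma nn_integral_lborel_affine:
  fixes f :: "'a::euclidean_space \<Rightarrow> ennreal" and c :: real
  assumes f [measurable]: "f \<in> borel_measurable borel" and c: "c \<noteq> 0"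
  shows "(\<integral>\<^sup>+ x. f x \<partial>lborel) = ennreal (\<bar>c\<bar> ^ DIM('a)) * (\<integral>\<^sup>+ x. f (t + c *\<^sub>R x) \<partial>lborel)"
  by (subst lborel_affine[OF c, of t])
     (simp add: nn_integral_density nn_integral_distr nn_integral_cmult)

text \<open>
  Uniqueness of a translation-invariant measure, made explicit. For Borel sets \<open>A\<close>, \<open>B\<close> integrate
  \<open>1\<^sub>A(R x) 1\<^sub>B(R x + y)\<close> over all \<open>x\<close>, \<open>y\<close> in both orders: this yields
  \<open>|R\<^sup>-\<^sup>1 A| |B| = |R\<^sup>-\<^sup>1 B| |A|\<close>. For the unit ball \<open>B\<close>, which \<open>R\<close> preserves, it says \<open>|R\<^sup>-\<^sup>1 A| = |A|\<close>.
\<close>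

lemma lborel_orthogonal_transformation:
  fixes R :: "'a::euclidean_space \<Rightarrow> 'a"
  assumes R: "orthogonal_transformation R"
  shows "distr lborel borel R = lborel"
proof -
  have lin: "linear R" using R by (rule orthogonal_transformation_linear)
  have [measurable]: "R \<in> borel_measurable borel"
    using lin by (intro borel_measurable_continuous_onI linear_continuous_on) (simp add: linear_conv_bounded_linear)
  let ?m = "\<lambda>A::'a set. emeasure lborel A" and ?r = "\<lambda>A. emeasure lborel (R -` A)"
  \<comment> \<open>Tonelli for \<open>1\<^sub>A(R x) 1\<^sub>B(R x + y)\<close>\<close>
  have key: "?r A * ?m B = ?r B * ?m A" if [measurable]: "A \<in> sets borel" "B \<in> sets borel" for A B
  proof -
    have R': "R -` A \<in> sets borel" if "A \<in> sets borel" for A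
      using measurable_sets[of R borel borel A] that by simp
    have r: "(\<integral>\<^sup>+ x. indicator A (R x) \<partial>lborel) = ?r A" if "A \<in> sets borel" for A
    proof -
      have "(\<lambda>x. indicator A (R x)) = (indicator (R -` A) :: 'a \<Rightarrow> ennreal)" by (auto simp: indicator_def)
      then show ?thesis using R'[OF that] by simp
    qed
    have "?r A * ?m B = (\<integral>\<^sup>+ x. indicator A (R x) * ?m B \<partial>lborel)"
      using r[OF that(1)] by (simp add: nn_integral_multc)
    also have "\<dots> = (\<integral>\<^sup>+ x. \<integral>\<^sup>+ y. indicator A (R x) * indicator B (R x + y) \<partial>lborel \<partial>lborel)"
    proof (rule nn_integral_cong)
      fix x
      have "?m B = (\<integral>\<^sup>+ y. indicator B (R x + y) \<partial>lborel)"
        using nn_integral_lborel_affine[of "indicator B" 1 "R x"] that by simp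
      then show "indicator A (R x) * ?m B = (\<integral>\<^sup>+ y. indicator A (R x) * indicator B (R x + y) \<partial>lborel)"
        by (simp add: nn_integral_cmult)
    qed
    also have "\<dots> = (\<integral>\<^sup>+ y. \<integral>\<^sup>+ x. indicator A (R x) * indicator B (R x + y) \<partial>lborel \<partial>lborel)"
      by (rule lborel_pair.Fubini') simp
    also have "\<dots> = (\<integral>\<^sup>+ y. \<integral>\<^sup>+ x. indicator A (R x - y) * indicator B (R x) \<partial>lborel \<partial>lborel)"
    proof (rule nn_integral_cong)
      fix y
      \<comment> \<open>shifting \<open>x\<close> by \<open>z\<close> moves \<open>R x + y\<close> to \<open>R x\<close>\<close>
      obtain z where z: "R z = - y"
        using orthogonal_transformation_surj[OF R] by (metis surjD)
      have "(\<integral>\<^sup>+ x. indicator A (R x) * indicator B (R x + y) \<partial>lborel) =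
        (\<integral>\<^sup>+ x. indicator A (R (z + 1 *\<^sub>R x)) * indicator B (R (z + 1 *\<^sub>R x) + y) \<partial>lborel)"
        using nn_integral_lborel_affine[of "\<lambda>x. indicator A (R x) * indicator B (R x + y)" 1 z] by simp
      then show "(\<integral>\<^sup>+ x. indicator A (R x) * indicator B (R x + y) \<partial>lborel) =
        (\<integral>\<^sup>+ x. indicator A (R x - y) * indicator B (R x) \<partial>lborel)"
        by (simp add: linear_add[OF lin] z)
    qed
    also have "\<dots> = (\<integral>\<^sup>+ x. \<integral>\<^sup>+ y. indicator A (R x - y) * indicator B (R x) \<partial>lborel \<partial>lborel)"
      by (rule lborel_pair.Fubini') simp
    also have "\<dots> = (\<integral>\<^sup>+ x. ?m A * indicator B (R x) \<partial>lborel)"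
    proof (rule nn_integral_cong)
      fix x
      have "?m A = (\<integral>\<^sup>+ y. indicator A (R x - y) \<partial>lborel)"
        using nn_integral_lborel_affine[of "indicator A" "-1" "R x"] that by simp
      then show "(\<integral>\<^sup>+ y. indicator A (R x - y) * indicator B (R x) \<partial>lborel) = ?m A * indicator B (R x)"
        by (simp add: nn_integral_multc)
    qed
    also have "\<dots> = ?r B * ?m A"
      using r[OF that(2)] by (simp add: nn_integral_cmult mult.commute)
    finally show ?thesis .
  qed
  have ball: "R -` ball 0 1 = ball 0 1"
    using orthogonal_transformation_norm[OF R] by auto
  have "unit_ball_vol (real DIM('a)) \<noteq> 0"
    using unit_ball_vol_pos[of "real DIM('a)"] by linarith
  then have b: "?m (ball 0 1) \<noteq> 0" "?m (ball 0 1) \<noteq> \<infinity>"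
    using emeasure_lborel_ball_finite[of "0::'a" 1]
    by (auto simp: emeasure_ball)
  show ?thesis
  proof (rule measure_eqI)
    fix A assume "A \<in> sets (distr lborel borel R)"
    then have A: "A \<in> sets borel" by simp
    then have "?m (ball 0 1) * ?r A = ?m (ball 0 1) * ?m A"
      using key[of A "ball 0 1"] by (simp add: ball mult.commute)
    then have "?r A = ?m A" unfolding ennreal_mult_cancel_left using b by (auto simp only: infinity_ennreal_def)
    then show "emeasure (distr lborel borel R) A = ?m A"
      using A by (simp add: emeasure_distr)
  qed simp
qed

lemma sets_sphere_measure [measurable_cong, simp]:
  "sets (sphere_measure :: 'a::euclidean_space measure) = sets (restrict_space borel (sphere 0 1))"
  by (simp add: sphere_measure_def)

lemma borel_measurable_sgn [measurable]: "sgn \<in> borel_measurable (borel :: 'a::euclidean_space measure)"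
proof -
  have "(\<lambda>x::'a. x /\<^sub>R norm x) \<in> borel_measurable borel" by measurable
  then show ?thesis by (simp add: sgn_div_norm[abs_def])
qed

lemma nn_integral_sphere_measure:
  fixes f :: "'a::euclidean_space \<Rightarrow> ennreal"
  assumes [measurable]: "f \<in> borel_measurable borel"
  shows "(\<integral>\<^sup>+ \<omega>. f \<omega> \<partial>sphere_measure) =
    of_nat DIM('a) * (\<integral>\<^sup>+ x. f (sgn x) * indicator (ball 0 1 - {0}) x \<partial>lborel)"
proof -
  let ?R = "restrict_space lborel (ball 0 1 - {0}) :: 'a measure"
  have m: "sgn \<in> measurable ?R (restrict_space borel (sphere 0 1))"
    by (intro measurable_restrict_space2 measurable_restrict_space1)
       (auto simp: space_restrict_space norm_sgn)
  have f: "f \<in> borel_measurable (restrict_space borel (sphere 0 1))"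
    by (intro measurable_restrict_space1) simp
  then have f': "f \<in> borel_measurable (distr ?R (restrict_space borel (sphere 0 1)) sgn)" by simp
  show ?thesis
    unfolding sphere_measure_def
    by (subst nn_integral_scale_measure)
       (auto simp: f f' nn_integral_distr[OF m f'] nn_integral_restrict_space)
qed

lemma finite_measure_sphere_measure: "finite_measure (sphere_measure :: 'a::euclidean_space measure)"
proof
  have "emeasure sphere_measure (sphere 0 1 :: 'a set) \<le> of_nat DIM('a) * emeasure lborel (ball (0::'a) 1)"
    by (subst emeasure_sphere_measure) (auto intro!: mult_left_mono emeasure_mono)
  also have "\<dots> < \<infinity>"
    using emeasure_lborel_ball_finite[of "0::'a" 1] by (simp add: ennreal_mult_eq_top_iff less_top[symmetric] ennreal_of_nat_eq_real_of_nat)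
  finally show "emeasure (sphere_measure :: 'a measure) (space sphere_measure) \<noteq> \<infinity>"
    by (simp add: space_sphere_measure less_top[symmetric])
qed

interpretation sphere: finite_measure "sphere_measure :: 'a::euclidean_space measure"
  by (rule finite_measure_sphere_measure)

lemma measurable_sphere_borel:
  "f \<in> borel_measurable borel \<Longrightarrow> f \<in> borel_measurable (sphere_measure :: 'a::euclidean_space measure)"
  by (simp add: measurable_restrict_space1 measurable_cong_sets[OF sets_sphere_measure refl])

lemma continuous_on_sphere_measurable:
  fixes f :: "'a::euclidean_space \<Rightarrow> 'b::euclidean_space"
  assumes "continuous_on (sphere 0 1) f"
  shows "f \<in> borel_measurable sphere_measure"
  using borel_measurable_continuous_on_restrict[OF assms]
  by (simp add: measurable_cong_sets[OF sets_sphere_measure refl])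

lemma continuous_on_sphere_integrable:
  fixes f :: "'a::euclidean_space \<Rightarrow> 'b::euclidean_space"
  assumes "continuous_on (sphere 0 1) f"
  shows "integrable sphere_measure f"
proof -
  have "compact (f ` sphere 0 1)"
    using assms by (intro compact_continuous_image) auto
  then obtain B where "\<And>x. x \<in> sphere 0 1 \<Longrightarrow> norm (f x) \<le> B"
    by (meson bounded_iff compact_imp_bounded image_eqI)
  then show ?thesis
    using continuous_on_sphere_measurable[OF assms]
    by (intro sphere.integrable_const_bound[of _ B]) (auto simp: space_sphere_measure)
qed

text \<open>
  The cone over \<open>R\<^sup>-\<^sup>1 A\<close> is the preimage under \<open>R\<close> of the cone over \<open>A\<close>.
\<close>

lemma sphere_measure_orthogonal_transformation:
  fixes R :: "'a::euclidean_space \<Rightarrow> 'a"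
  assumes R: "orthogonal_transformation R"
  shows "distr sphere_measure sphere_measure R = sphere_measure"
proof (rule measure_eqI)
  have lin: "linear R" using R by (rule orthogonal_transformation_linear)
  have n: "norm (R x) = norm x" for x using R by (rule orthogonal_transformation_norm)
  have mR: "R \<in> borel_measurable borel"
    using lin by (intro borel_measurable_continuous_onI linear_continuous_on) (simp add: linear_conv_bounded_linear)
  have m: "R \<in> measurable sphere_measure sphere_measure"
    unfolding measurable_cong_sets[OF sets_sphere_measure sets_sphere_measure]
    by (intro measurable_restrict_space2 measurable_restrict_space1 mR) (auto simp: space_restrict_space n)
  fix A assume "A \<in> sets (distr sphere_measure sphere_measure R)"
  then have A: "A \<in> sets sphere_measure" by (simp del: sets_sphere_measure)
  then have A': "A \<in> sets borel" "A \<subseteq> sphere 0 1"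
    by (auto simp: sets_restrict_space_iff)
  have RA: "R -` A \<inter> sphere 0 1 \<in> sets borel"
    using measurable_sets[OF mR A'(1)] by auto
  have sg: "sgn (R x) = R (sgn x)" for x
    by (simp add: sgn_div_norm n linear_scale[OF lin])
  have B: "{x \<in> ball 0 1 - {0}. sgn x \<in> A} \<in> sets borel"
  proof -
    have "{x \<in> ball 0 1 - {0}. sgn x \<in> A} = (ball 0 1 - {0}) \<inter> (sgn -` A \<inter> space borel)" by auto
    then show ?thesis using measurable_sets[OF borel_measurable_sgn A'(1)] by (simp only:) auto
  qed
  have "emeasure (distr sphere_measure sphere_measure R) A = emeasure sphere_measure (R -` A \<inter> sphere 0 1)"
    using A m by (simp add: emeasure_distr space_sphere_measure del: sets_sphere_measure)
  also have "\<dots> = of_nat DIM('a) * emeasure lborel {x \<in> ball 0 1 - {0}. sgn x \<in> R -` A \<inter> sphere 0 1}"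
    using RA by (intro emeasure_sphere_measure) auto
  also have "{x \<in> ball 0 1 - {0}. sgn x \<in> R -` A \<inter> sphere 0 1} = R -` {x \<in> ball 0 1 - {0}. sgn x \<in> A}"
  proof -
    have "R x = 0 \<longleftrightarrow> x = 0" for x using n[of x] by (metis norm_eq_zero)
    then show ?thesis using n by (auto simp: sg norm_sgn)
  qed
  also have "emeasure lborel \<dots> = emeasure (distr lborel borel R) {x \<in> ball 0 1 - {0}. sgn x \<in> A}"
    using mR B by (simp add: emeasure_distr)
  also have "\<dots> = emeasure lborel {x \<in> ball 0 1 - {0}. sgn x \<in> A}"
    by (simp add: lborel_orthogonal_transformation[OF R])
  finally show "emeasure (distr sphere_measure sphere_measure R) A = emeasure sphere_measure A"
    using A' by (simp add: emeasure_sphere_measure)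
qed simp

section \<open>Symmetry of the angular operator\<close>

text \<open>
  Rotation by the angle \<open>t\<close> in the plane of the coordinates \<open>i\<close> and \<open>k\<close>, written as a perturbation of
  the identity so that derivative and continuity in \<open>t\<close> can be read off.
\<close>

definition plane_rotation :: "'n::finite \<Rightarrow> 'n \<Rightarrow> real \<Rightarrow> real ^ 'n \<Rightarrow> real ^ 'n" where
  "plane_rotation i k t x = x + (cos t * x $ i - sin t * x $ k - x $ i) *\<^sub>R axis i 1
     + (sin t * x $ i + cos t * x $ k - x $ k) *\<^sub>R axis k 1"

lemma plane_rotation_nth:
  "i \<noteq> k \<Longrightarrow> plane_rotation i k t x $ l =
    (if l = i then cos t * x $ i - sin t * x $ k else if l = k then sin t * x $ i + cos t * x $ k else x $ l)"
  by (auto simp: plane_rotation_def axis_def)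

lemma orthogonal_transformation_plane_rotation:
  assumes "i \<noteq> k"
  shows "orthogonal_transformation (plane_rotation i k t)"
  unfolding orthogonal_transformation
proof (intro conjI allI)
  show "linear (plane_rotation i k t)"
    using assms by (auto intro!: linearI simp: vec_eq_iff plane_rotation_nth algebra_simps)
  fix x :: "real ^ 'a"
  have split: "(\<Sum>l\<in>UNIV. f l) = f i + f k + (\<Sum>l\<in>UNIV - {i} - {k}. f l)" for f :: "'a \<Rightarrow> real"
    using assms sum.remove[of UNIV i f] sum.remove[of "UNIV - {i}" k f] by simp
  have "(c * a - s * b)\<^sup>2 + (s * a + c * b)\<^sup>2 = (c\<^sup>2 + s\<^sup>2) * (a\<^sup>2 + b\<^sup>2)" for a b c s :: real
    by algebra
  from this[of "cos t" "x $ i" "sin t" "x $ k"]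
  have "(cos t * x $ i - sin t * x $ k)\<^sup>2 + (sin t * x $ i + cos t * x $ k)\<^sup>2 = (x $ i)\<^sup>2 + (x $ k)\<^sup>2"
    by simp
  then have "(\<Sum>l\<in>UNIV. (plane_rotation i k t x $ l)\<^sup>2) = (\<Sum>l\<in>UNIV. (x $ l)\<^sup>2)"
    unfolding split using assms by (simp add: plane_rotation_nth)
  then show "norm (plane_rotation i k t x) = norm x"
    by (simp add: norm_eq_sqrt_inner inner_vec_def power2_eq_square)
qed

lemma plane_rotation_has_vector_derivative:
  assumes "i \<noteq> k"
  shows "((\<lambda>t. plane_rotation i k t x) has_vector_derivative
     (plane_rotation i k t x $ i) *\<^sub>R axis k 1 - (plane_rotation i k t x $ k) *\<^sub>R axis i 1) (at t within T)"
proof -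
  have "((\<lambda>t. plane_rotation i k t x) has_vector_derivative
     (- sin t * x $ i - cos t * x $ k) *\<^sub>R axis i 1 + (cos t * x $ i - sin t * x $ k) *\<^sub>R axis k 1) (at t within T)"
    unfolding plane_rotation_def
    by (auto intro!: derivative_eq_intros simp: has_real_derivative_iff_has_vector_derivative[symmetric])
  moreover have "(- sin t * x $ i - cos t * x $ k) *\<^sub>R axis i 1 + (cos t * x $ i - sin t * x $ k) *\<^sub>R axis k 1 =
      (plane_rotation i k t x $ i) *\<^sub>R axis k 1 - (plane_rotation i k t x $ k) *\<^sub>R axis i (1::real)"
    using assms by (auto simp: plane_rotation_nth vec_eq_iff axis_def)
  ultimately show ?thesis by simp
qed

text \<open>
  Averaging over the circle group: the integral is the same along every rotation of the sphere, and
  along a full turn the derivative of \<open>H\<close> integrates to \<open>0\<close>.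
\<close>

lemma sphere_integral_rotation_derivative:
  fixes H :: "real ^ 'n \<Rightarrow> real"
  assumes ik: "i \<noteq> k" and H: "\<And>x. x \<noteq> 0 \<Longrightarrow> (H has_derivative H' x) (at x)"
    and cont: "continuous_on (- {0}) (\<lambda>x. H' x ((x $ i) *\<^sub>R axis k 1 - (x $ k) *\<^sub>R axis i 1))"
  shows "(LINT \<omega>|sphere_measure. H' \<omega> ((\<omega> $ i) *\<^sub>R axis k 1 - (\<omega> $ k) *\<^sub>R axis i 1)) = 0"
proof -
  let ?R = "plane_rotation i k"
  define M where "M = restrict_space (lborel :: real measure) {0..2 * pi}"
  let ?S = "sphere_measure :: (real ^ 'n) measure"
  define G0 where "G0 x = H' x ((x $ i) *\<^sub>R axis k 1 - (x $ k) *\<^sub>R axis i 1)" for x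
  \<comment> \<open>cutting off at the origin makes the integrand Borel measurable on the whole space\<close>
  define G where "G x = indicator (- {0}) x *\<^sub>R G0 x" for x :: "real ^ 'n"
  note orth = orthogonal_transformation_plane_rotation[OF ik]
  have nR: "norm (?R t x) = norm x" for t x by (rule orthogonal_transformation_norm[OF orth])
  have G0c: "continuous_on (- {0}) G0" using cont by (simp add: G0_def[abs_def])
  have Gm [measurable]: "G \<in> borel_measurable borel"
    unfolding G_def[abs_def] by (intro borel_measurable_continuous_on_indicator G0c) auto
  have Gc: "continuous_on (sphere 0 1) G"
    by (rule continuous_on_eq[OF continuous_on_subset[OF G0c]]) (auto simp: G_def indicator_def)
  have "compact (G ` sphere 0 1)"
    using Gc by (intro compact_continuous_image) auto
  then obtain B where B: "\<And>x. x \<in> sphere 0 1 \<Longrightarrow> norm (G x) \<le> B"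
    by (meson bounded_iff compact_imp_bounded image_eqI)
  have Rcont: "continuous_on UNIV (\<lambda>z. ?R (fst z) (snd z))"
    unfolding plane_rotation_def by (intro continuous_intros)
  have Rm: "(\<lambda>z. ?R (fst z) (snd z)) \<in> borel_measurable (borel \<Otimes>\<^sub>M borel)"
    using borel_measurable_continuous_onI[OF Rcont] by (simp add: borel_prod)
  interpret M: finite_measure M
    by standard (simp add: M_def emeasure_restrict_space space_restrict_space)
  interpret P: pair_sigma_finite M ?S
    by (intro pair_sigma_finite.intro M.sigma_finite_measure_axioms sphere.sigma_finite_measure_axioms)
  interpret PF: finite_measure "M \<Otimes>\<^sub>M ?S"
    by (rule finite_measure_pair_measure[OF finite_measure_sphere_measure M.finite_measure_axioms])
  have id: "(\<lambda>z. (fst z, snd z)) \<in> M \<Otimes>\<^sub>M ?S \<rightarrow>\<^sub>M borel \<Otimes>\<^sub>M borel"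
  proof (intro measurable_Pair)
    have "(\<lambda>t. t) \<in> borel_measurable M" by (simp add: M_def measurable_restrict_space1)
    then show "fst \<in> borel_measurable (M \<Otimes>\<^sub>M ?S)" by (rule measurable_compose[OF measurable_fst])
    have "(\<lambda>t. t) \<in> borel_measurable ?S" by (rule measurable_sphere_borel) simp
    then show "snd \<in> borel_measurable (M \<Otimes>\<^sub>M ?S)" by (rule measurable_compose[OF measurable_snd])
  qed
  have GRm: "(\<lambda>(t, \<omega>). G (?R t \<omega>)) \<in> borel_measurable (M \<Otimes>\<^sub>M ?S)"
    using measurable_compose[OF measurable_compose[OF id Rm] Gm] by (simp add: case_prod_beta)
  have int: "integrable (M \<Otimes>\<^sub>M ?S) (\<lambda>(t, \<omega>). G (?R t \<omega>))"
    using B by (intro PF.integrable_const_bound[OF _ GRm, of B])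
      (auto simp: space_pair_measure space_sphere_measure nR)
  \<comment> \<open>the fundamental theorem of calculus along the orbit, which is closed\<close>
  have zero: "(LINT t|M. G (?R t \<omega>)) = 0" if \<omega>: "\<omega> \<in> space ?S" for \<omega>
  proof -
    have nz: "?R t \<omega> \<noteq> 0" for t
      using nR[of t \<omega>] \<omega> by (auto simp: space_sphere_measure)
    have D: "((\<lambda>t. H (?R t \<omega>)) has_vector_derivative G (?R t \<omega>)) (at t within {0..2 * pi})" for t
    proof -
      let ?v = "(?R t \<omega> $ i) *\<^sub>R axis k 1 - (?R t \<omega> $ k) *\<^sub>R axis i (1::real)"
      have "((\<lambda>t. ?R t \<omega>) has_derivative (\<lambda>s. s *\<^sub>R ?v)) (at t within {0..2 * pi})"
        using plane_rotation_has_vector_derivative[OF ik] by (simp add: has_vector_derivative_def)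
      from has_derivative_compose[OF this H[OF nz]]
      have "((\<lambda>t. H (?R t \<omega>)) has_derivative (\<lambda>s. H' (?R t \<omega>) (s *\<^sub>R ?v))) (at t within {0..2 * pi})" .
      then show ?thesis
        using linear_scale[OF has_derivative_linear[OF H[OF nz]]] nz
        by (simp add: has_vector_derivative_def G_def G0_def)
    qed
    have c: "continuous_on {0..2 * pi} (\<lambda>t. G0 (?R t \<omega>))"
    proof (rule continuous_on_compose2[OF G0c])
      show "continuous_on {0..2 * pi} (\<lambda>t. ?R t \<omega>)"
        unfolding plane_rotation_def by (intro continuous_intros)
    qed (use nz in auto)
    have "(LINT t|M. G (?R t \<omega>)) = (LINT t|lborel. indicator {0..2 * pi} t *\<^sub>R G (?R t \<omega>))"
      unfolding M_def by (subst integral_restrict_space) auto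
    also have "\<dots> = H (?R (2 * pi) \<omega>) - H (?R 0 \<omega>)"
      using D c nz by (intro integral_FTC_atLeastAtMost) (auto simp: G_def)
    also have "?R (2 * pi) \<omega> = ?R 0 \<omega>" by (simp add: plane_rotation_def)
    finally show ?thesis by simp
  qed
  have inv: "(LINT \<omega>|?S. G (?R t \<omega>)) = (LINT \<omega>|?S. G \<omega>)" for t
  proof -
    have "?R t \<in> borel_measurable borel"
      unfolding plane_rotation_def[abs_def] by (intro borel_measurable_continuous_onI continuous_intros)
    then have m: "?R t \<in> ?S \<rightarrow>\<^sub>M ?S"
      unfolding measurable_cong_sets[OF sets_sphere_measure sets_sphere_measure]
      by (intro measurable_restrict_space2 measurable_restrict_space1) (auto simp: space_restrict_space nR)
    have "(LINT \<omega>|?S. G \<omega>) = (LINT \<omega>|distr ?S ?S (?R t). G \<omega>)"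
      by (simp add: sphere_measure_orthogonal_transformation[OF orth])
    also have "\<dots> = (LINT \<omega>|?S. G (?R t \<omega>))"
      by (intro integral_distr m measurable_sphere_borel Gm)
    finally show ?thesis by simp
  qed
  have "(LINT \<omega>|?S. LINT t|M. G (?R t \<omega>)) = (LINT t|M. LINT \<omega>|?S. G (?R t \<omega>))"
    by (rule P.Fubini_integral[OF int])
  also have "\<dots> = measure M (space M) *\<^sub>R (LINT \<omega>|?S. G \<omega>)"
    by (simp add: inv)
  also have "measure M (space M) = 2 * pi"
    by (simp add: M_def measure_restrict_space space_restrict_space)
  also have "(LINT \<omega>|?S. LINT t|M. G (?R t \<omega>)) = 0"
    using zero by (simp cong: Bochner_Integration.integral_cong)
  finally have "(LINT \<omega>|?S. G \<omega>) = 0" by simp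
  moreover have "(LINT \<omega>|?S. G \<omega>) = (LINT \<omega>|?S. G0 \<omega>)"
    by (intro Bochner_Integration.integral_cong) (auto simp: G_def indicator_def space_sphere_measure)
  ultimately show ?thesis by (simp add: G0_def)
qed


abbreviation C1_off :: "('a::real_normed_vector \<Rightarrow> 'b::real_normed_vector) \<Rightarrow> bool" where
  "C1_off f \<equiv> higher_differentiable_on (- {0}) f (Suc 0)"

lemma C1_off_has_derivative:
  "C1_off f \<Longrightarrow> x \<noteq> 0 \<Longrightarrow> (f has_derivative frechet_derivative f (at x)) (at x)"
  by (auto simp: frechet_derivative_works[symmetric])

lemma C1_off_continuous: "C1_off f \<Longrightarrow> continuous_on (- {0}) f"
  by (auto intro!: continuous_at_imp_continuous_on differentiable_imp_continuous_within)

lemma C1_off_continuous_pderiv_at: "C1_off f \<Longrightarrow> continuous_on (- {0}) (pderiv_at i f)"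
  by (auto simp: pderiv_at_def[abs_def])

lemma continuous_on_mv [continuous_intros]:
  "continuous_on S f \<Longrightarrow> continuous_on S (\<lambda>x. (A :: complex ^ 'm ^ 'm) *v f x)"
  by (rule bounded_linear.continuous_on[OF bounded_linear_mv])

lemma continuous_on_angular_diff:
  "C1_off f \<Longrightarrow> continuous_on (- {0}) (angular_diff \<sigma> f)"
  unfolding angular_diff_def[abs_def]
  by (intro continuous_intros C1_off_continuous_pderiv_at)

lemma continuous_on_sphere_off: "continuous_on (- {0}) f \<Longrightarrow> continuous_on (sphere 0 1) f"
  by (erule continuous_on_subset) auto

lemma C1_off_smooth: "smooth_on (- {0}) f \<Longrightarrow> C1_off f"
  by (simp only: smooth_on_def)

text \<open>
  The derivatives in \<open>L\<close> are taken along the generators of the rotations. In particular \<open>L\<close> commutes with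
  multiplication by radial functions.
\<close>

lemma angular_diff_directional:
  assumes "(f has_derivative f') (at x)"
  shows "angular_diff \<sigma> f x = (\<Sum>i\<in>UNIV. \<Sum>k\<in>{i<..}.
      \<sigma> i *v (\<sigma> k *v f' ((x $ i) *\<^sub>R axis k 1 - (x $ k) *\<^sub>R axis i 1)))"
proof -
  have "linear f'" using assms by (rule has_derivative_linear)
  then show ?thesis
    by (simp add: angular_diff_eq[OF assms] matrix_vector_mul_assoc linear_diff linear_scale)
qed

text \<open>
  The matrices \<open>\<sigma>\<^sub>i \<sigma>\<^sub>k\<close> with \<open>i < k\<close> are skew-Hermitian, so \<open>\<langle>L f, g\<rangle> - \<langle>f, L g\<rangle>\<close> is the sum of the rotation
  derivatives of \<open>\<langle>\<sigma>\<^sub>i \<sigma>\<^sub>k f, g\<rangle>\<close>.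
\<close>

theorem angular_diff_symmetric:
  fixes f g :: "real ^ 'n::{finite,linorder} \<Rightarrow> complex ^ 'm"
  assumes cl: "clifford_family \<sigma>" and f: "C1_off f" and g: "C1_off g"
  shows "(LINT \<omega>|sphere_measure. inner (angular_diff \<sigma> f \<omega>) (g \<omega>)) =
    (LINT \<omega>|sphere_measure. inner (f \<omega>) (angular_diff \<sigma> g \<omega>))"
proof -
  let ?A = "\<lambda>i k x. (x $ i) *\<^sub>R axis k 1 - (x $ k) *\<^sub>R axis i (1::real)"
  let ?f = "\<lambda>x. frechet_derivative f (at x)" and ?g = "\<lambda>x. frechet_derivative g (at x)"
  define H' where "H' i k x v = inner (\<sigma> i *v (\<sigma> k *v f x)) (?g x v) + inner (\<sigma> i *v (\<sigma> k *v ?f x v)) (g x)"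
    for i k x v
  have D: "((\<lambda>x. inner (\<sigma> i *v (\<sigma> k *v f x)) (g x)) has_derivative H' i k x) (at x)" if "x \<noteq> 0" for i k x
    unfolding H'_def
    by (intro has_derivative_inner bounded_linear.has_derivative[OF bounded_linear_mv]
        C1_off_has_derivative[OF f that] C1_off_has_derivative[OF g that])
  have Df: "?f x (?A i k x) = (x $ i) *\<^sub>R pderiv_at k f x - (x $ k) *\<^sub>R pderiv_at i f x" if "x \<noteq> 0" for i k x
    using has_derivative_linear[OF C1_off_has_derivative[OF f that]]
    by (simp add: linear_diff linear_scale pderiv_at_def)
  have Dg: "?g x (?A i k x) = (x $ i) *\<^sub>R pderiv_at k g x - (x $ k) *\<^sub>R pderiv_at i g x" if "x \<noteq> 0" for i k x
    using has_derivative_linear[OF C1_off_has_derivative[OF g that]]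
    by (simp add: linear_diff linear_scale pderiv_at_def)
  have c: "continuous_on (- {0}) (\<lambda>x. H' i k x (?A i k x))" for i k
  proof -
    have "continuous_on (- {0}) (\<lambda>x. inner (\<sigma> i *v (\<sigma> k *v f x)) ((x $ i) *\<^sub>R pderiv_at k g x - (x $ k) *\<^sub>R pderiv_at i g x)
      + inner (\<sigma> i *v (\<sigma> k *v ((x $ i) *\<^sub>R pderiv_at k f x - (x $ k) *\<^sub>R pderiv_at i f x))) (g x))"
      by (intro continuous_intros C1_off_continuous_pderiv_at C1_off_continuous f g)
    then show ?thesis
      by (rule continuous_on_eq) (simp add: H'_def Df Dg)
  qed
  have z: "(LINT \<omega>|sphere_measure. H' i k \<omega> (?A i k \<omega>)) = 0" if "i < k" for i k
    using that by (intro sphere_integral_rotation_derivative[OF _ D c]) auto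
  have skew: "inner v (\<sigma> i *v (\<sigma> k *v w)) = - inner (\<sigma> i *v (\<sigma> k *v v)) w" if "i < k" for i k v w
    using clifford_swap_less[OF cl that, of v] by (simp add: clifford_inner[OF cl, symmetric])
  have eq: "inner (angular_diff \<sigma> f x) (g x) - inner (f x) (angular_diff \<sigma> g x) =
      (\<Sum>i\<in>UNIV. \<Sum>k\<in>{i<..}. H' i k x (?A i k x))" if "x \<noteq> 0" for x
    by (simp add: angular_diff_directional[OF C1_off_has_derivative[OF f that]]
        angular_diff_directional[OF C1_off_has_derivative[OF g that]]
        inner_sum_left inner_sum_right skew H'_def sum.distrib sum_negf)
  have "(LINT \<omega>|sphere_measure. inner (angular_diff \<sigma> f \<omega>) (g \<omega>) - inner (f \<omega>) (angular_diff \<sigma> g \<omega>)) =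
      (LINT \<omega>|sphere_measure. (\<Sum>i\<in>UNIV. \<Sum>k\<in>{i<..}. H' i k \<omega> (?A i k \<omega>)))"
    by (rule Bochner_Integration.integral_cong[OF refl], rule eq) (auto simp: space_sphere_measure)
  also have "\<dots> = (\<Sum>i\<in>UNIV. \<Sum>k\<in>{i<..}. LINT \<omega>|sphere_measure. H' i k \<omega> (?A i k \<omega>))"
    using continuous_on_sphere_integrable[OF continuous_on_sphere_off[OF c]]
    by (subst Bochner_Integration.integral_sum, simp, subst Bochner_Integration.integral_sum) auto
  also have "\<dots> = 0" using z by (intro sum.neutral ballI) auto
  finally show ?thesis
    by (subst (asm) Bochner_Integration.integral_diff)
      (auto intro!: continuous_on_sphere_integrable continuous_on_sphere_off continuous_intros
        continuous_on_angular_diff[OF f] continuous_on_angular_diff[OF g] C1_off_continuous[OF f] C1_off_continuous[OF g]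
        simp del: higher_differentiable_on.simps)
qed

section \<open>The spectral gap on the sphere\<close>

lemma smooth_on_C1_off: "smooth_on UNIV f \<Longrightarrow> C1_off f"
  using smooth_on_subset C1_off_smooth by blast

lemma smooth_on_continuous: "smooth_on UNIV f \<Longrightarrow> continuous_on S f"
  by (auto simp: smooth_on_def dest!: spec[of _ 0] intro: continuous_on_subset)

lemma angular_eigen_orthogonal:
  assumes cl: "clifford_family \<sigma>" and q: "smooth_on UNIV q" "angular_eigen \<sigma> k q"
    and q': "smooth_on UNIV q'" "angular_eigen \<sigma> l q'" and "k \<noteq> l"
  shows "(LINT \<omega>|sphere_measure. inner (q \<omega>) (q' \<omega>)) = 0"
proof -
  have "of_int k * (LINT \<omega>|sphere_measure. inner (q \<omega>) (q' \<omega>)) =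
     (LINT \<omega>|sphere_measure. inner (angular_diff \<sigma> q \<omega>) (q' \<omega>))"
    using q(2) by (simp add: angular_eigen_def)
  also have "\<dots> = (LINT \<omega>|sphere_measure. inner (q \<omega>) (angular_diff \<sigma> q' \<omega>))"
    by (intro angular_diff_symmetric cl smooth_on_C1_off q q')
  also have "\<dots> = of_int l * (LINT \<omega>|sphere_measure. inner (q \<omega>) (q' \<omega>))"
    using q'(2) by (simp add: angular_eigen_def)
  finally show ?thesis using \<open>k \<noteq> l\<close> by simp
qed

lemma norm_angular_eigen_sum:
  assumes cl: "clifford_family \<sigma>" and K: "finite K"
    and q: "\<And>k. smooth_on UNIV (q k)" "\<And>k. angular_eigen \<sigma> k (q k)"
  shows "(LINT \<omega>|sphere_measure. (norm (\<Sum>k\<in>K. c k *\<^sub>R q k \<omega>))\<^sup>2) =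
    (\<Sum>k\<in>K. (c k)\<^sup>2 * (LINT \<omega>|sphere_measure. (norm (q k \<omega>))\<^sup>2))"
proof -
  have int: "integrable sphere_measure (\<lambda>\<omega>. inner (q k \<omega>) (q l \<omega>))" for k l
    by (intro continuous_on_sphere_integrable continuous_intros smooth_on_continuous q)
  have "(LINT \<omega>|sphere_measure. (norm (\<Sum>k\<in>K. c k *\<^sub>R q k \<omega>))\<^sup>2) =
    (LINT \<omega>|sphere_measure. (\<Sum>k\<in>K. \<Sum>l\<in>K. c k * c l * inner (q k \<omega>) (q l \<omega>)))"
    by (simp only: power2_norm_eq_inner inner_sum_left)
      (simp only: inner_sum_right inner_scaleR_left inner_scaleR_right mult_ac)
  also have "\<dots> = (\<Sum>k\<in>K. \<Sum>l\<in>K. c k * c l * (LINT \<omega>|sphere_measure. inner (q k \<omega>) (q l \<omega>)))"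
    using int by (subst Bochner_Integration.integral_sum, simp, subst Bochner_Integration.integral_sum) auto
  also have "\<dots> = (\<Sum>k\<in>K. \<Sum>l\<in>K. if l = k then c k * c k * (LINT \<omega>|sphere_measure. inner (q k \<omega>) (q k \<omega>)) else 0)"
    using angular_eigen_orthogonal[OF cl q q] by (intro sum.cong refl) auto
  finally show ?thesis using K by (simp add: power2_norm_eq_inner) (simp add: power2_eq_square)
qed

text \<open>
  Let \<open>B = L - j\<close> and let \<open>p = \<Sum> q\<^sub>k\<close> be a polynomial close to \<open>f\<close>, decomposed into eigenfunctions. Put
  \<open>r = \<Sum> q\<^sub>k / (k - j)\<close>, summed over \<open>k \<noteq> j\<close>. Then \<open>\<langle>f, p\<rangle> = \<langle>B f, r\<rangle>\<close>, as \<open>f\<close> is orthogonal to \<open>q\<^sub>j\<close>, and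
  \<open>\<parallel>r\<parallel> \<le> \<parallel>p\<parallel>\<close>, as \<open>|k - j| \<ge> 1\<close>. Consequently
  \<open>\<parallel>f\<parallel>\<^sup>2 = 2 \<langle>f, p\<rangle> - \<parallel>p\<parallel>\<^sup>2 + \<parallel>f - p\<parallel>\<^sup>2 \<le> \<parallel>B f\<parallel>\<^sup>2 + \<parallel>r\<parallel>\<^sup>2 - \<parallel>p\<parallel>\<^sup>2 + \<parallel>f - p\<parallel>\<^sup>2 \<le> \<parallel>B f\<parallel>\<^sup>2 + \<parallel>f - p\<parallel>\<^sup>2\<close>.
\<close>

theorem angular_spectral_gap:
  fixes \<sigma> :: "'n::{finite,linorder} \<Rightarrow> complex ^ 'm ^ 'm"
  assumes n: "CARD('n) \<ge> 2" and cl: "clifford_family \<sigma>" and f: "C1_off f"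
    and perp: "\<And>p. smooth_on UNIV p \<Longrightarrow> angular_eigen \<sigma> j p \<Longrightarrow>
      (LINT \<omega>|sphere_measure. inner (f \<omega>) (p \<omega>)) = 0"
  shows "(LINT \<omega>|sphere_measure. (norm (f \<omega>))\<^sup>2) \<le>
     (LINT \<omega>|sphere_measure. (norm (angular_diff \<sigma> f \<omega> - of_int j *\<^sub>R f \<omega>))\<^sup>2)"
proof (rule field_le_epsilon)
  fix \<epsilon> :: real assume \<epsilon>: "\<epsilon> > 0"
  let ?S = "sphere_measure :: (real ^ 'n::{finite,linorder}) measure"
  define m where "m = measure ?S (space ?S)"
  \<comment> \<open>chosen such that the error \<open>\<parallel>f - p\<parallel>\<^sup>2\<close> is at most \<open>e\<^sup>2 m \<le> \<epsilon>\<close>\<close>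
  define e where "e = sqrt (\<epsilon> / (m + 1))"
  have m: "m \<ge> 0" by (simp add: m_def)
  have e: "e > 0" "e\<^sup>2 * m \<le> \<epsilon>"
    using \<epsilon> m by (auto simp: e_def field_simps)
  define B where "B x = angular_diff \<sigma> f x - of_int j *\<^sub>R f x" for x
  have fc: "continuous_on (sphere 0 1) f"
    by (intro continuous_on_sphere_off C1_off_continuous f)
  have Lc: "continuous_on (sphere 0 1) (angular_diff \<sigma> f)"
    by (intro continuous_on_sphere_off continuous_on_angular_diff f)
  have Bc: "continuous_on (sphere 0 1) B"
    unfolding B_def[abs_def] by (intro continuous_intros fc Lc)
  obtain p where p: "polynomial_function p" "\<And>x. x \<in> sphere 0 1 \<Longrightarrow> norm (f x - p x) < e"
    using Stone_Weierstrass_polynomial_function[of "sphere 0 1" f e] fc e by auto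
  obtain N q where q: "\<And>k. smooth_on UNIV (q k)" "\<And>k. angular_eigen \<sigma> k (q k)"
    and pq: "\<And>x. p x = (\<Sum>k\<in>{- int N..int N}. q k x)"
    using hom_poly_sum_eigen_decomposition[OF n cl polynomial_function_hom_poly_sum[OF p(1)]] by metis
  define K where "K = {- int N..int N}"
  define c where "c k = (if k = j then 0 else 1 / (of_int k - of_int j :: real))" for k
  define r where "r x = (\<Sum>k\<in>K. c k *\<^sub>R q k x)" for x
  have qc: "continuous_on S (q k)" for k and S :: "(real ^ 'n::{finite,linorder}) set"
    by (intro smooth_on_continuous q)
  have pc: "continuous_on S p" for S :: "(real ^ 'n::{finite,linorder}) set"
    unfolding pq[abs_def] by (intro continuous_intros qc)
  have rc: "continuous_on S r" for S :: "(real ^ 'n::{finite,linorder}) set"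
    unfolding r_def[abs_def] by (intro continuous_intros qc)
  note int = continuous_on_sphere_integrable
  have Bq: "(LINT \<omega>|?S. inner (B \<omega>) (q k \<omega>)) = (of_int k - of_int j) * (LINT \<omega>|?S. inner (f \<omega>) (q k \<omega>))" for k
  proof -
    have "(LINT \<omega>|?S. inner (B \<omega>) (q k \<omega>)) =
       (LINT \<omega>|?S. inner (angular_diff \<sigma> f \<omega>) (q k \<omega>)) - of_int j * (LINT \<omega>|?S. inner (f \<omega>) (q k \<omega>))"
      unfolding B_def inner_diff_left
      by (subst Bochner_Integration.integral_diff)
        (auto intro!: int continuous_intros Lc fc qc)
    also have "(LINT \<omega>|?S. inner (angular_diff \<sigma> f \<omega>) (q k \<omega>)) = (LINT \<omega>|?S. inner (f \<omega>) (angular_diff \<sigma> (q k) \<omega>))"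
      by (intro angular_diff_symmetric cl f smooth_on_C1_off q)
    also have "\<dots> = of_int k * (LINT \<omega>|?S. inner (f \<omega>) (q k \<omega>))"
      using q(2)[of k] by (simp add: angular_eigen_def)
    finally show ?thesis by (simp add: algebra_simps)
  qed
  have fp: "(LINT \<omega>|?S. inner (f \<omega>) (p \<omega>)) = (LINT \<omega>|?S. inner (B \<omega>) (r \<omega>))"
  proof -
    have "(LINT \<omega>|?S. inner (B \<omega>) (r \<omega>)) = (\<Sum>k\<in>K. c k * (LINT \<omega>|?S. inner (B \<omega>) (q k \<omega>)))"
      unfolding r_def inner_sum_right inner_scaleR_right
      by (subst Bochner_Integration.integral_sum) (auto intro!: int continuous_intros Bc qc)
    also have "\<dots> = (\<Sum>k\<in>K. (LINT \<omega>|?S. inner (f \<omega>) (q k \<omega>)))"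
      using perp[OF q] by (intro sum.cong refl) (auto simp: Bq c_def)
    also have "\<dots> = (LINT \<omega>|?S. inner (f \<omega>) (p \<omega>))"
      unfolding pq K_def[symmetric] inner_sum_right
      by (subst Bochner_Integration.integral_sum) (auto intro!: int continuous_intros fc qc)
    finally show ?thesis by simp
  qed
  have rp: "(LINT \<omega>|?S. (norm (r \<omega>))\<^sup>2) \<le> (LINT \<omega>|?S. (norm (p \<omega>))\<^sup>2)"
  proof -
    have K: "finite K" by (simp add: K_def)
    have "(c k)\<^sup>2 \<le> 1" for k
    proof (cases "k = j")
      case False
      then have "1 \<le> \<bar>real_of_int k - real_of_int j\<bar>" by linarith
      then have "\<bar>c k\<bar> \<le> 1" using False by (simp add: c_def divide_le_eq)
      then show ?thesis by (simp add: abs_square_le_1)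
    qed (simp add: c_def)
    then have "(\<Sum>k\<in>K. (c k)\<^sup>2 * (LINT \<omega>|?S. (norm (q k \<omega>))\<^sup>2)) \<le> (\<Sum>k\<in>K. 1\<^sup>2 * (LINT \<omega>|?S. (norm (q k \<omega>))\<^sup>2))"
      by (intro sum_mono mult_right_mono) auto
    then have "(LINT \<omega>|?S. (norm (\<Sum>k\<in>K. c k *\<^sub>R q k \<omega>))\<^sup>2) \<le> (LINT \<omega>|?S. (norm (\<Sum>k\<in>K. 1 *\<^sub>R q k \<omega>))\<^sup>2)"
      by (simp only: norm_angular_eigen_sum[OF cl K q])
    then show ?thesis by (simp add: r_def pq K_def)
  qed
  have "(LINT \<omega>|?S. (norm (f \<omega>))\<^sup>2) = (LINT \<omega>|?S. 2 * inner (f \<omega>) (p \<omega>) - (norm (p \<omega>))\<^sup>2 + (norm (f \<omega> - p \<omega>))\<^sup>2)"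
    by (intro Bochner_Integration.integral_cong refl)
      (simp add: power2_norm_eq_inner inner_diff_left inner_diff_right inner_commute)
  also have "\<dots> = 2 * (LINT \<omega>|?S. inner (f \<omega>) (p \<omega>)) - (LINT \<omega>|?S. (norm (p \<omega>))\<^sup>2) + (LINT \<omega>|?S. (norm (f \<omega> - p \<omega>))\<^sup>2)"
    by (subst Bochner_Integration.integral_add Bochner_Integration.integral_diff;
        (intro int continuous_intros fc pc)?)+ simp
  also have "(LINT \<omega>|?S. (norm (f \<omega> - p \<omega>))\<^sup>2) \<le> (LINT \<omega>|?S. e\<^sup>2)"
    using p(2) by (intro integral_mono int continuous_intros fc pc)
      (auto simp: space_sphere_measure intro!: power_mono less_imp_le[OF p(2)])
  also have "(LINT \<omega>|?S. e\<^sup>2) \<le> \<epsilon>"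
    using e by (simp add: m_def mult.commute)
  also have "2 * (LINT \<omega>|?S. inner (f \<omega>) (p \<omega>)) = (LINT \<omega>|?S. 2 * inner (B \<omega>) (r \<omega>))"
    by (simp add: fp)
  also have "\<dots> \<le> (LINT \<omega>|?S. (norm (B \<omega>))\<^sup>2 + (norm (r \<omega>))\<^sup>2)"
  proof (intro integral_mono int continuous_intros Bc rc)
    fix \<omega>
    have "0 \<le> (norm (B \<omega> - r \<omega>))\<^sup>2" by simp
    then show "2 * inner (B \<omega>) (r \<omega>) \<le> (norm (B \<omega>))\<^sup>2 + (norm (r \<omega>))\<^sup>2"
      by (simp add: power2_norm_eq_inner inner_diff_left inner_diff_right inner_commute)
  qed
  also have "\<dots> = (LINT \<omega>|?S. (norm (B \<omega>))\<^sup>2) + (LINT \<omega>|?S. (norm (r \<omega>))\<^sup>2)"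
    by (intro Bochner_Integration.integral_add int continuous_intros Bc rc)
  finally show "(LINT \<omega>|?S. (norm (f \<omega>))\<^sup>2) \<le>
      (LINT \<omega>|?S. (norm (angular_diff \<sigma> f \<omega> - of_int j *\<^sub>R f \<omega>))\<^sup>2) + \<epsilon>"
    using rp by (simp add: B_def)
qed

section \<open>Polar coordinates\<close>

lemma nn_integral_power_tail:
  assumes "a > 0" "d > 0"
  shows "(\<integral>\<^sup>+ s. ennreal (1 / s ^ (d + 1)) * indicator {a..} s \<partial>lborel) = ennreal (1 / (real d * a ^ d))"
proof -
  have lim: "((\<lambda>s::real. - 1 / (real d * s ^ d)) \<longlongrightarrow> 0) at_top"
  proof -
    have "((\<lambda>s::real. (- 1 / real d) * inverse (s ^ d)) \<longlongrightarrow> (- 1 / real d) * 0) at_top"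
      using assms by (intro tendsto_intros tendsto_inverse_0_at_top filterlim_pow_at_top filterlim_ident) auto
    then show ?thesis by (simp add: field_simps)
  qed
  have "(\<integral>\<^sup>+ s. ennreal (1 / s ^ (d + 1)) * indicator {a..} s \<partial>lborel) = ennreal (0 - (- 1 / (real d * a ^ d)))"
  proof (rule nn_integral_FTC_atLeast[OF _ _ _ lim])
    fix s assume "a \<le> s"
    then have s: "s > 0" using assms by simp
    show "((\<lambda>s. - 1 / (real d * s ^ d)) has_field_derivative 1 / s ^ (d + 1)) (at s)"
      using s assms by (auto intro!: derivative_eq_intros simp: field_simps power_diff power2_eq_square)
    show "0 \<le> 1 / s ^ (d + 1)" using s by simp
  qed simp
  then show ?thesis by simp
qed

text \<open>
  The surface integral is an integral over the unit ball \<open>y\<close>, as in the definition of the surface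
  measure. The radius \<open>r = s |y|\<close> makes the argument of \<open>F\<close> equal to \<open>s y\<close>, then \<open>z = s y\<close> replaces \<open>y\<close>.
  After Tonelli the weight of \<open>F z\<close> is \<open>n |z|\<^sup>n \<integral> s\<^sup>-\<^sup>n\<^sup>-\<^sup>1 ds\<close> over \<open>s > |z|\<close>, which is \<open>1\<close>.
\<close>

theorem nn_integral_polar:
  fixes F :: "'a::euclidean_space \<Rightarrow> ennreal"
  assumes F [measurable]: "F \<in> borel_measurable borel"
  shows "(\<integral>\<^sup>+ x. F x \<partial>lborel) =
    (\<integral>\<^sup>+ r. ennreal (r ^ (DIM('a) - 1)) * indicator {0<..} r * (\<integral>\<^sup>+ \<omega>. F (r *\<^sub>R \<omega>) \<partial>sphere_measure) \<partial>lborel)"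
proof -
  define d where "d = DIM('a)"
  have d: "d > 0" by (simp add: d_def)
  define D where "D = ball (0::'a) 1 - {0}"
  have [measurable]: "D \<in> sets borel" by (simp add: D_def)
  let ?w = "\<lambda>r::real. ennreal (r ^ (d - 1)) * indicator {0<..} r"
  let ?P = "\<lambda>r y. ?w r * (F (r *\<^sub>R sgn y) * indicator D y)"
  let ?G = "\<lambda>y s. ?w s * (ennreal (norm y ^ d) * F (s *\<^sub>R y) * indicator D y)"
  let ?H = "\<lambda>z s. F z * ennreal (norm z ^ d) * indicator {z. z \<noteq> 0 \<and> norm z < s} z * ennreal (1 / s ^ (d + 1))"
  have "(\<integral>\<^sup>+ r. ?w r * (\<integral>\<^sup>+ \<omega>. F (r *\<^sub>R \<omega>) \<partial>sphere_measure) \<partial>lborel)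
     = (\<integral>\<^sup>+ r. of_nat d * (\<integral>\<^sup>+ y. ?P r y \<partial>lborel) \<partial>lborel)"
  proof (rule nn_integral_cong)
    fix r :: real
    have "(\<integral>\<^sup>+ \<omega>. F (r *\<^sub>R \<omega>) \<partial>sphere_measure) = of_nat d * (\<integral>\<^sup>+ y. F (r *\<^sub>R sgn y) * indicator D y \<partial>lborel)"
      by (simp add: nn_integral_sphere_measure D_def d_def)
    moreover have "(\<integral>\<^sup>+ y. ?P r y \<partial>lborel) =
        ?w r * (\<integral>\<^sup>+ y. F (r *\<^sub>R sgn y) * indicator D y \<partial>lborel)"
      by (rule nn_integral_cmult) simp
    ultimately show "?w r * (\<integral>\<^sup>+ \<omega>. F (r *\<^sub>R \<omega>) \<partial>sphere_measure) =
        of_nat d * (\<integral>\<^sup>+ y. ?P r y \<partial>lborel)"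
      by (simp only: mult_ac)
  qed
  also have "\<dots> = of_nat d * (\<integral>\<^sup>+ r. \<integral>\<^sup>+ y. ?P r y \<partial>lborel \<partial>lborel)"
    by (rule nn_integral_cmult) simp
  also have "(\<integral>\<^sup>+ r. \<integral>\<^sup>+ y. ?P r y \<partial>lborel \<partial>lborel)
     = (\<integral>\<^sup>+ y. \<integral>\<^sup>+ r. ?P r y \<partial>lborel \<partial>lborel)"
    by (rule lborel_pair.Fubini') simp
  \<comment> \<open>substitution \<open>r = s |y|\<close>\<close>
  also have "\<dots> = (\<integral>\<^sup>+ y. \<integral>\<^sup>+ s. ?G y s \<partial>lborel \<partial>lborel)"
  proof (rule nn_integral_cong)
    fix y :: 'a
    show "(\<integral>\<^sup>+ r. ?P r y \<partial>lborel) =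
      (\<integral>\<^sup>+ s. ?G y s \<partial>lborel)"
    proof (cases "y = 0")
      case False
      then have y: "norm y > 0" by simp
      have "(\<integral>\<^sup>+ r. ?P r y \<partial>lborel) =
         ennreal (norm y) * (\<integral>\<^sup>+ s. ?w (norm y * s) * (F ((norm y * s) *\<^sub>R sgn y) * indicator D y) \<partial>lborel)"
        using y nn_integral_lborel_affine[of "\<lambda>r. ?P r y" "norm y" 0] by simp
      also have "\<dots> = (\<integral>\<^sup>+ s. ennreal (norm y) * (?w (norm y * s) * (F ((norm y * s) *\<^sub>R sgn y) * indicator D y)) \<partial>lborel)"
        by (rule nn_integral_cmult[symmetric]) simp
      also have "\<dots> = (\<integral>\<^sup>+ s. ?G y s \<partial>lborel)"
      proof (rule nn_integral_cong)
        fix s :: real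
        show "ennreal (norm y) * (?w (norm y * s) * (F ((norm y * s) *\<^sub>R sgn y) * indicator D y)) =
           ?G y s"
        proof (cases "s > 0")
          case True
          have "(norm y * s) *\<^sub>R sgn y = s *\<^sub>R y" using y by (simp add: sgn_div_norm)
          moreover have e: "ennreal (norm y) * ennreal ((norm y * s) ^ (d - 1)) = ennreal (s ^ (d - 1)) * ennreal (norm y ^ d)"
            using d True by (simp add: ennreal_mult[symmetric] power_mult_distrib power_eq_if[of _ d] mult_ac)
          moreover have "indicator {0<..} (norm y * s) = (1::ennreal)" "indicator {0<..} s = (1::ennreal)"
            using True y by auto
          ultimately show ?thesis by (simp only: mult_1_right mult.assoc[symmetric] e)
        qed (use y in \<open>simp add: zero_less_mult_iff\<close>)
      qed
      finally show ?thesis .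
    qed (simp add: D_def)
  qed
  also have "\<dots> = (\<integral>\<^sup>+ s. \<integral>\<^sup>+ y. ?G y s \<partial>lborel \<partial>lborel)"
    by (rule lborel_pair.Fubini') simp
  \<comment> \<open>substitution \<open>z = s y\<close>\<close>
  also have "\<dots> = (\<integral>\<^sup>+ s. \<integral>\<^sup>+ z. ?H z s \<partial>lborel \<partial>lborel)"
  proof (rule nn_integral_cong)
    fix s :: real
    show "(\<integral>\<^sup>+ y. ?G y s \<partial>lborel) =
      (\<integral>\<^sup>+ z. ?H z s \<partial>lborel)"
    proof (cases "s > 0")
      case True
      have "(\<integral>\<^sup>+ y. ?G y s \<partial>lborel) =
        ennreal ((1 / s) ^ d) * (\<integral>\<^sup>+ z. ?w s * (ennreal (norm ((1 / s) *\<^sub>R z) ^ d) * F (s *\<^sub>R ((1 / s) *\<^sub>R z)) * indicator D ((1 / s) *\<^sub>R z)) \<partial>lborel)"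
        using True nn_integral_lborel_affine[of "\<lambda>y. ?G y s" "1 / s" 0]
        by (simp add: d_def)
      also have "\<dots> = (\<integral>\<^sup>+ z. ennreal ((1 / s) ^ d) * (?w s * (ennreal (norm ((1 / s) *\<^sub>R z) ^ d) * F (s *\<^sub>R ((1 / s) *\<^sub>R z)) * indicator D ((1 / s) *\<^sub>R z))) \<partial>lborel)"
        by (rule nn_integral_cmult[symmetric]) simp
      also have "\<dots> = (\<integral>\<^sup>+ z. ?H z s \<partial>lborel)"
      proof (rule nn_integral_cong)
        fix z :: 'a
        have i: "indicator D ((1 / s) *\<^sub>R z) = (indicator {z. z \<noteq> 0 \<and> norm z < s} z :: ennreal)"
          using True by (auto simp: D_def indicator_def field_simps)
        have "(1 / s) ^ d * s ^ (d - 1) * norm ((1 / s) *\<^sub>R z) ^ d = norm z ^ d * (1 / s ^ (d + 1)) * (1 / s ^ d * (s * s ^ (d - 1)))"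
          using True by (simp add: field_simps)
        also have "s * s ^ (d - 1) = s ^ d" using d by (simp add: power_eq_if[of _ d])
        finally have e: "ennreal ((1 / s) ^ d) * ennreal (s ^ (d - 1)) * ennreal (norm ((1 / s) *\<^sub>R z) ^ d) = ennreal (norm z ^ d) * ennreal (1 / s ^ (d + 1))"
          using True by (simp add: ennreal_mult[symmetric])
        have sz: "s *\<^sub>R ((1 / s) *\<^sub>R z) = z" "indicator {0<..} s = (1::ennreal)" using True by auto
        have "ennreal ((1 / s) ^ d) * (?w s * (ennreal (norm ((1 / s) *\<^sub>R z) ^ d) * F (s *\<^sub>R ((1 / s) *\<^sub>R z)) * indicator D ((1 / s) *\<^sub>R z)))
          = ennreal ((1 / s) ^ d) * ennreal (s ^ (d - 1)) * ennreal (norm ((1 / s) *\<^sub>R z) ^ d) * (F z * indicator {z. z \<noteq> 0 \<and> norm z < s} z)"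
          by (simp only: i sz mult_1_right mult.assoc)
        then show "ennreal ((1 / s) ^ d) * (?w s * (ennreal (norm ((1 / s) *\<^sub>R z) ^ d) * F (s *\<^sub>R ((1 / s) *\<^sub>R z)) * indicator D ((1 / s) *\<^sub>R z))) =
          ?H z s"
          by (simp only: e) (simp only: mult_ac)
      qed
      finally show ?thesis .
    next
      case False
      then have "{z :: 'a. z \<noteq> 0 \<and> norm z < s} = {}" by (auto simp: not_less intro: order_trans)
      then show ?thesis using False by simp
    qed
  qed
  also have "\<dots> = (\<integral>\<^sup>+ z. \<integral>\<^sup>+ s. ?H z s \<partial>lborel \<partial>lborel)"
    by (rule lborel_pair.Fubini') measurable
  also have "of_nat d * \<dots> = (\<integral>\<^sup>+ z. of_nat d * (\<integral>\<^sup>+ s. ?H z s \<partial>lborel) \<partial>lborel)"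
    by (rule nn_integral_cmult[symmetric]) measurable
  also have "\<dots> = (\<integral>\<^sup>+ z. F z \<partial>lborel)"
  proof (rule nn_integral_cong_AE)
    have "AE z in lborel. z \<noteq> (0::'a)" by (rule AE_lborel_singleton)
    then show "AE z in lborel. of_nat d * (\<integral>\<^sup>+ s. ?H z s \<partial>lborel) = F z"
    proof eventually_elim
      case (elim z)
      then have z: "norm z > 0" by simp
      have "(\<integral>\<^sup>+ s. ?H z s \<partial>lborel) =
        (\<integral>\<^sup>+ s. F z * ennreal (norm z ^ d) * (ennreal (1 / s ^ (d + 1)) * indicator {norm z..} s) \<partial>lborel)"
      proof (rule nn_integral_cong_AE)
        have "AE s in lborel. s \<noteq> norm z" by (rule AE_lborel_singleton)
        then show "AE s in lborel. ?H z s =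
          F z * ennreal (norm z ^ d) * (ennreal (1 / s ^ (d + 1)) * indicator {norm z..} s)"
          by eventually_elim (use z in \<open>auto simp: indicator_def\<close>)
      qed
      also have "\<dots> = F z * ennreal (norm z ^ d) * ennreal (1 / (real d * norm z ^ d))"
        by (subst nn_integral_cmult) (use nn_integral_power_tail[OF z d] in auto)
      finally have "of_nat d * (\<integral>\<^sup>+ s. ?H z s \<partial>lborel)
        = F z * (ennreal (real d) * ennreal (norm z ^ d) * ennreal (1 / (real d * norm z ^ d)))"
        by (simp add: ennreal_of_nat_eq_real_of_nat mult_ac)
      also have "ennreal (real d) * ennreal (norm z ^ d) * ennreal (1 / (real d * norm z ^ d)) = 1"
        using z d by (simp add: ennreal_mult[symmetric])
      finally show ?case by simp
    qed
  qed
  finally show ?thesis by (simp add: d_def)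
qed


text \<open>
  On every sphere the positive and the negative part of \<open>F\<close> have equal integrals, so they do on the whole
  space.
\<close>

lemma integral_polar_eq_zero:
  fixes F :: "'a::euclidean_space \<Rightarrow> real"
  assumes F: "integrable lborel F"
    and int: "\<And>r. r > 0 \<Longrightarrow> integrable sphere_measure (\<lambda>\<omega>. F (r *\<^sub>R \<omega>))"
    and zero: "\<And>r. r > 0 \<Longrightarrow> (LINT \<omega>|sphere_measure. F (r *\<^sub>R \<omega>)) = 0"
  shows "integral\<^sup>L lborel F = 0"
proof -
  have [measurable]: "F \<in> borel_measurable borel" using borel_measurable_integrable[OF F] by simp
  have eq: "(\<integral>\<^sup>+ \<omega>. ennreal (F (r *\<^sub>R \<omega>)) \<partial>sphere_measure) = (\<integral>\<^sup>+ \<omega>. ennreal (- F (r *\<^sub>R \<omega>)) \<partial>sphere_measure)"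
    if r: "r > 0" for r
  proof -
    have "(\<integral>\<^sup>+ \<omega>. ennreal (F (r *\<^sub>R \<omega>)) \<partial>sphere_measure) \<noteq> \<infinity>" "(\<integral>\<^sup>+ \<omega>. ennreal (- F (r *\<^sub>R \<omega>)) \<partial>sphere_measure) \<noteq> \<infinity>"
      using int[OF r] by (auto simp: real_integrable_def)
    moreover have "enn2real (\<integral>\<^sup>+ \<omega>. ennreal (F (r *\<^sub>R \<omega>)) \<partial>sphere_measure) = enn2real (\<integral>\<^sup>+ \<omega>. ennreal (- F (r *\<^sub>R \<omega>)) \<partial>sphere_measure)"
      using zero[OF r] by (simp add: real_lebesgue_integral_def[OF int[OF r]])
    ultimately show ?thesis by (metis ennreal_enn2real infinity_ennreal_def less_top)
  qed
  have "(\<integral>\<^sup>+ x. ennreal (F x) \<partial>lborel) = (\<integral>\<^sup>+ x. ennreal (- F x) \<partial>lborel)"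
    by (simp add: nn_integral_polar[of "\<lambda>x. ennreal (F x)"] nn_integral_polar[of "\<lambda>x. ennreal (- F x)"])
      (intro nn_integral_cong, auto simp: indicator_def eq)
  then show ?thesis by (simp add: real_lebesgue_integral_def[OF F])
qed

lemma integral_polar_mono:
  fixes f g :: "'a::euclidean_space \<Rightarrow> real"
  assumes f: "integrable lborel f" "\<And>x. 0 \<le> f x" and g: "integrable lborel g" "\<And>x. 0 \<le> g x"
    and le: "AE r in lborel. r > 0 \<longrightarrow>
      integrable sphere_measure (\<lambda>\<omega>. f (r *\<^sub>R \<omega>)) \<and> integrable sphere_measure (\<lambda>\<omega>. g (r *\<^sub>R \<omega>)) \<and>
      (LINT \<omega>|sphere_measure. f (r *\<^sub>R \<omega>)) \<le> (LINT \<omega>|sphere_measure. g (r *\<^sub>R \<omega>))"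
  shows "integral\<^sup>L lborel f \<le> integral\<^sup>L lborel g"
proof -
  have [measurable]: "f \<in> borel_measurable borel" "g \<in> borel_measurable borel"
    using borel_measurable_integrable[OF f(1)] borel_measurable_integrable[OF g(1)] by auto
  have "ennreal (integral\<^sup>L lborel f) = (\<integral>\<^sup>+ x. ennreal (f x) \<partial>lborel)"
    using f by (simp add: nn_integral_eq_integral)
  also have "\<dots> \<le> (\<integral>\<^sup>+ x. ennreal (g x) \<partial>lborel)"
    unfolding nn_integral_polar[of "\<lambda>x. ennreal (f x)", simplified] nn_integral_polar[of "\<lambda>x. ennreal (g x)", simplified]
  proof (rule nn_integral_mono_AE)
    show "AE r in lborel. ennreal (r ^ (DIM('a) - Suc 0)) * indicator {0<..} r * (\<integral>\<^sup>+ \<omega>. ennreal (f (r *\<^sub>R \<omega>)) \<partial>sphere_measure)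
      \<le> ennreal (r ^ (DIM('a) - Suc 0)) * indicator {0<..} r * (\<integral>\<^sup>+ \<omega>. ennreal (g (r *\<^sub>R \<omega>)) \<partial>sphere_measure)"
      using le
    proof eventually_elim
      case (elim r)
      show ?case
      proof (cases "r > 0")
        case True
        then show ?thesis
          using elim f(2) g(2) by (intro mult_left_mono) (auto simp: nn_integral_eq_integral)
      qed simp
    qed
  qed
  also have "\<dots> = ennreal (integral\<^sup>L lborel g)"
    using g by (simp add: nn_integral_eq_integral)
  finally show ?thesis using g by (simp add: integral_nonneg)
qed

section \<open>The energy identity\<close>

text \<open>
  The functions of interest are controlled away from the origin only and vanish outside a compact
  set that avoids it; weights such as \<open>|x|\<^sup>c\<close> then do no harm.
\<close>

lemma continuous_on_extend_zero:
  fixes f :: "'a::euclidean_space \<Rightarrow> 'b::euclidean_space"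
  assumes K: "compact K" "0 \<notin> K" and f: "continuous_on (- {0}) f" "\<And>x. x \<notin> K \<Longrightarrow> f x = 0"
  shows "continuous_on S f"
proof -
  have "continuous_on (- {0} \<union> - K) f"
  proof (rule continuous_on_open_Un)
    show "continuous_on (- K) f"
      by (rule continuous_on_eq[of _ "\<lambda>_. 0"]) (use f in auto)
    show "open (- K)" using K compact_imp_closed open_Compl by blast
  qed (use f in auto)
  then show ?thesis by (rule continuous_on_subset) (use K in auto)
qed

lemma integrable_extend_zero:
  fixes f :: "'a::euclidean_space \<Rightarrow> 'b::euclidean_space"
  assumes K: "compact K" "0 \<notin> K" and f: "continuous_on (- {0}) f" "\<And>x. x \<notin> K \<Longrightarrow> f x = 0"
  shows "integrable lborel f"
proof -
  have "integrable lborel (\<lambda>x. indicator K x *\<^sub>R f x)"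
    by (intro borel_integrable_compact K continuous_on_extend_zero[OF K f]) auto
  moreover have "(\<lambda>x. indicator K x *\<^sub>R f x) = f" using f(2) by (auto simp: indicator_def)
  ultimately show ?thesis by simp
qed

lemma bounded_extend_zero:
  fixes f :: "'a::euclidean_space \<Rightarrow> 'b::euclidean_space"
  assumes K: "compact K" "0 \<notin> K" and f: "continuous_on (- {0}) f" "\<And>x. x \<notin> K \<Longrightarrow> f x = 0"
  obtains B where "B \<ge> 0" "\<And>x. norm (f x) \<le> B"
proof -
  have "compact (f ` K)"
    using K continuous_on_extend_zero[OF K f] by (intro compact_continuous_image)
  then obtain B where B: "\<And>x. x \<in> K \<Longrightarrow> norm (f x) \<le> B"
    by (meson bounded_iff compact_imp_bounded image_eqI)
  have "norm (f x) \<le> max 0 B" for x using B[of x] f(2)[of x] by (cases "x \<in> K") auto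
  then show ?thesis using that[of "max 0 B"] by auto
qed

lemma has_derivative_zero_outside:
  assumes "closed K" "\<And>x. x \<notin> K \<Longrightarrow> u x = 0" "x \<notin> K"
  shows "(u has_derivative (\<lambda>_. 0)) (at x)"
  by (rule has_derivative_transform_within_open[of "\<lambda>_. 0" _ _ _ "- K"])
    (use assms in \<open>auto intro: open_Compl\<close>)

lemma angular_diff_zero_outside:
  assumes "closed K" "\<And>x. x \<notin> K \<Longrightarrow> u x = 0" "x \<notin> K"
  shows "angular_diff \<sigma> u x = 0"
  by (simp add: angular_diff_eq[OF has_derivative_zero_outside[OF assms]] mv_simps)

lemma has_derivative_dilation:
  assumes "(f has_derivative f') (at (r *\<^sub>R x))"
  shows "((\<lambda>x. f (r *\<^sub>R x)) has_derivative (\<lambda>h. f' (r *\<^sub>R h))) (at x)"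
proof -
  have "((\<lambda>x. r *\<^sub>R x) has_derivative (\<lambda>h. r *\<^sub>R h)) (at x)" by (auto intro!: derivative_eq_intros)
  from has_derivative_compose[OF this assms] show ?thesis .
qed

lemma C1_off_dilation:
  fixes f :: "'a::real_normed_vector \<Rightarrow> 'b::real_normed_vector"
  assumes f: "C1_off f" and r: "r \<noteq> 0"
  shows "C1_off (\<lambda>x. f (r *\<^sub>R x))"
proof -
  have D: "((\<lambda>x. f (r *\<^sub>R x)) has_derivative (\<lambda>h. frechet_derivative f (at (r *\<^sub>R x)) (r *\<^sub>R h))) (at x)"
    if "x \<noteq> 0" for x
    by (intro has_derivative_dilation C1_off_has_derivative f) (use that r in auto)
  have c: "continuous_on (- {0}) (\<lambda>x. frechet_derivative f (at (r *\<^sub>R x)) (r *\<^sub>R v))" for v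
  proof (rule continuous_on_compose2[of "- {0}" "\<lambda>y. frechet_derivative f (at y) (r *\<^sub>R v)"])
    show "continuous_on (- {0}) (\<lambda>y. frechet_derivative f (at y) (r *\<^sub>R v))" using f by simp
  qed (use r in \<open>auto intro!: continuous_intros\<close>)
  have "continuous_on (- {0}) (\<lambda>x. frechet_derivative (\<lambda>x. f (r *\<^sub>R x)) (at x) v)" for v
    by (rule continuous_on_eq[OF c[of v]]) (simp add: frechet_derivative_at[OF D, symmetric])
  then show ?thesis using has_derivative_imp_differentiable[OF D] by simp
qed

lemma angular_diff_dilation:
  assumes "f differentiable (at (r *\<^sub>R x))"
  shows "angular_diff \<sigma> (\<lambda>x. f (r *\<^sub>R x)) x = angular_diff \<sigma> f (r *\<^sub>R x)"
proof -
  obtain f' where f': "(f has_derivative f') (at (r *\<^sub>R x))" using assms by (auto simp: differentiable_def)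
  have "linear f'" using f' by (rule has_derivative_linear)
  then show ?thesis
    by (simp add: angular_diff_eq[OF f'] angular_diff_eq[OF has_derivative_dilation[OF f']] linear_scale mult.commute)
qed

text \<open>
  \<open>L\<close> commutes with dilations and \<open>|x|\<^sup>c\<close> is constant on spheres, so symmetry on the unit sphere gives it for
  every radius.
\<close>

lemma weighted_angular_diff_symmetric:
  fixes f g :: "real ^ 'n::{finite,linorder} \<Rightarrow> complex ^ 'm"
  assumes cl: "clifford_family \<sigma>" and K: "compact K" "0 \<notin> K"
    and f: "C1_off f" and g: "C1_off g" "\<And>x. x \<notin> K \<Longrightarrow> g x = 0"
  shows "(LINT x|lborel. norm x powr c * inner (f x) (angular_diff \<sigma> g x)) =
    (LINT x|lborel. norm x powr c * inner (angular_diff \<sigma> f x) (g x))"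
proof -
  have Lg: "angular_diff \<sigma> g x = 0" if "x \<notin> K" for x
    using K that by (intro angular_diff_zero_outside g compact_imp_closed)
  note conts = continuous_on_angular_diff[OF f] continuous_on_angular_diff[OF g(1)]
    C1_off_continuous[OF f] C1_off_continuous[OF g(1)]
  have i: "integrable lborel (\<lambda>x. norm x powr c * inner (f x) (angular_diff \<sigma> g x))"
     "integrable lborel (\<lambda>x. norm x powr c * inner (angular_diff \<sigma> f x) (g x))"
    by (rule integrable_extend_zero[OF K]; auto intro!: continuous_intros conts simp: Lg g)+
  have "(LINT x|lborel. norm x powr c * inner (f x) (angular_diff \<sigma> g x) - norm x powr c * inner (angular_diff \<sigma> f x) (g x)) = 0"
  proof (rule integral_polar_eq_zero)
    fix r :: real assume r: "r > 0"
    let ?d = "\<lambda>r \<omega>. norm (r *\<^sub>R \<omega>) powr c * inner (f (r *\<^sub>R \<omega>)) (angular_diff \<sigma> g (r *\<^sub>R \<omega>)) -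
        norm (r *\<^sub>R \<omega>) powr c * inner (angular_diff \<sigma> f (r *\<^sub>R \<omega>)) (g (r *\<^sub>R \<omega>))"
    note fr = C1_off_dilation[OF f, of r] and gr = C1_off_dilation[OF g(1), of r]
    have eq: "?d r \<omega> =
      r powr c * (inner (f (r *\<^sub>R \<omega>)) (angular_diff \<sigma> (\<lambda>x. g (r *\<^sub>R x)) \<omega>) -
        inner (angular_diff \<sigma> (\<lambda>x. f (r *\<^sub>R x)) \<omega>) (g (r *\<^sub>R \<omega>)))" if "\<omega> \<in> space sphere_measure" for \<omega>
    proof -
      have "r *\<^sub>R \<omega> \<noteq> 0" using that r by (auto simp: space_sphere_measure)
      then have "f differentiable (at (r *\<^sub>R \<omega>))" "g differentiable (at (r *\<^sub>R \<omega>))"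
        using f g(1) by auto
      then show ?thesis using that r
        by (simp add: angular_diff_dilation space_sphere_measure right_diff_distrib)
    qed
    have ic: "integrable sphere_measure (\<lambda>\<omega>. inner (f (r *\<^sub>R \<omega>)) (angular_diff \<sigma> (\<lambda>x. g (r *\<^sub>R x)) \<omega>))"
      "integrable sphere_measure (\<lambda>\<omega>. inner (angular_diff \<sigma> (\<lambda>x. f (r *\<^sub>R x)) \<omega>) (g (r *\<^sub>R \<omega>)))"
      using r by (intro continuous_on_sphere_integrable continuous_on_sphere_off continuous_intros
          continuous_on_angular_diff[OF fr] continuous_on_angular_diff[OF gr]
          C1_off_continuous[OF fr] C1_off_continuous[OF gr]; simp)+
    show "integrable sphere_measure (\<lambda>\<omega>. ?d r \<omega>)"
      using ic by (subst Bochner_Integration.integrable_cong[OF refl eq]) auto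
    show "(LINT \<omega>|sphere_measure. ?d r \<omega>) = 0"
      using ic r angular_diff_symmetric[OF cl fr gr]
      by (subst Bochner_Integration.integral_cong[OF refl eq]) auto
  qed (use i in simp)
  then show ?thesis using i by simp
qed

lemma integral_dilation:
  fixes f :: "'a::euclidean_space \<Rightarrow> real"
  assumes [measurable]: "f \<in> borel_measurable borel" and s: "s > 0"
  shows "integral\<^sup>L lborel f = s ^ DIM('a) * (LINT x|lborel. f (s *\<^sub>R x))"
proof -
  have "integral\<^sup>L lborel f = integral\<^sup>L (density (distr lborel borel (\<lambda>x. 0 + s *\<^sub>R x)) (\<lambda>_. ennreal (s ^ DIM('a)))) f"
    using lborel_affine[of s "0::'a"] s by (simp add: ennreal_power)
  also have "\<dots> = s ^ DIM('a) * (LINT x|lborel. f (s *\<^sub>R x))"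
    using s by (subst integral_density) (auto simp: integral_distr)
  finally show ?thesis .
qed

lemma difference_quotient_tendsto:
  assumes f: "(f has_vector_derivative D) (at x)" and h: "h \<longlonglongrightarrow> 0" "\<And>m. h m \<noteq> (0::real)"
  shows "(\<lambda>m. (f (x + h m) - f x) /\<^sub>R h m) \<longlonglongrightarrow> D"
proof -
  have "((\<lambda>y. norm (f (x + y) - f x - y *\<^sub>R D) / norm y) \<longlongrightarrow> 0) (at 0)"
    using f unfolding has_vector_derivative_def has_derivative_at by (rule conjunct2)
  moreover have "filterlim h (at 0) sequentially"
    using h(1) by (rule filterlim_atI) (simp add: h(2))
  ultimately have "(\<lambda>m. norm (f (x + h m) - f x - h m *\<^sub>R D) / norm (h m)) \<longlonglongrightarrow> 0"
    by (rule filterlim_compose)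
  moreover have "norm (f (x + h m) - f x - h m *\<^sub>R D) / norm (h m) = norm ((f (x + h m) - f x) /\<^sub>R h m - D)" for m
  proof -
    have "(f (x + h m) - f x - h m *\<^sub>R D) /\<^sub>R h m = (f (x + h m) - f x) /\<^sub>R h m - (h m *\<^sub>R D) /\<^sub>R h m"
      by (rule scaleR_diff_right)
    also have "(h m *\<^sub>R D) /\<^sub>R h m = D" using h(2)[of m] by simp
    finally have "norm ((f (x + h m) - f x) /\<^sub>R h m - D) = norm ((f (x + h m) - f x - h m *\<^sub>R D) /\<^sub>R h m)"
      by (rule arg_cong[OF sym])
    also have "\<dots> = norm (f (x + h m) - f x - h m *\<^sub>R D) / norm (h m)"
      by (simp only: norm_scaleR real_norm_def abs_inverse divide_inverse mult.commute)
    finally show ?thesis ..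
  qed
  ultimately have "(\<lambda>m. norm ((f (x + h m) - f x) /\<^sub>R h m - D)) \<longlonglongrightarrow> 0" by (simp only:)
  then show ?thesis by (rule LIM_zero_cancel[OF tendsto_norm_zero_cancel])
qed

lemma has_derivative_extend_zero:
  assumes K: "compact K" "0 \<notin> K" and u: "C1_off u" "\<And>x. x \<notin> K \<Longrightarrow> u x = 0"
  shows "(u has_derivative frechet_derivative u (at x)) (at x)"
proof (cases "x = 0")
  case True
  have "u differentiable (at x)"
    using has_derivative_imp_differentiable[OF has_derivative_zero_outside[OF compact_imp_closed[OF K(1)] u(2)]] K True by auto
  then show ?thesis by (simp add: frechet_derivative_works)
qed (intro C1_off_has_derivative u)

lemma lipschitz_extend_zero:
  fixes u :: "real ^ 'n \<Rightarrow> complex ^ 'm"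
  assumes K: "compact K" "0 \<notin> K" and u: "C1_off u" "\<And>x. x \<notin> K \<Longrightarrow> u x = 0"
  obtains M where "M \<ge> 0" "\<And>x y. norm (u x - u y) \<le> M * norm (x - y)"
proof -
  note D = has_derivative_extend_zero[OF K u]
  have "\<exists>B\<ge>0. \<forall>x. norm (pderiv_at i u x) \<le> B" for i
  proof -
    have "pderiv_at i u x = 0" if "x \<notin> K" for x
      using pderiv_at_eq[OF has_derivative_zero_outside[OF compact_imp_closed[OF K(1)] u(2)]] that by auto
    from bounded_extend_zero[OF K C1_off_continuous_pderiv_at[OF u(1)] this] show ?thesis by metis
  qed
  then obtain B where B: "\<And>i. B i \<ge> 0" "\<And>i x. norm (pderiv_at i u x) \<le> B i" by metis
  define M where "M = (\<Sum>i\<in>UNIV. B i)"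
  have "onorm (frechet_derivative u (at x)) \<le> M" for x
  proof (rule onorm_bound)
    show "M \<ge> 0" using B by (simp add: M_def sum_nonneg)
    fix v
    have "norm (frechet_derivative u (at x) v) = norm (\<Sum>i\<in>UNIV. (v $ i) *\<^sub>R pderiv_at i u x)"
      using frechet_derivative_vec_expand[OF has_derivative_imp_differentiable[OF D], of x v]
      by (simp add: pderiv_at_def)
    also have "\<dots> \<le> (\<Sum>i\<in>UNIV. B i * norm v)"
    proof (rule sum_norm_le)
      fix i
      have "\<bar>v $ i\<bar> * norm (pderiv_at i u x) \<le> norm v * B i"
        by (intro mult_mono component_le_norm_cart B) auto
      then show "norm ((v $ i) *\<^sub>R pderiv_at i u x) \<le> B i * norm v" by (simp add: mult.commute)
    qed
    finally show "norm (frechet_derivative u (at x) v) \<le> M * norm v"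
      by (simp add: M_def sum_distrib_right)
  qed
  then have "norm (u x - u y) \<le> M * norm (x - y)" for x y
    using D by (intro differentiable_bound[of UNIV u "\<lambda>x. frechet_derivative u (at x)" M]) auto
  moreover have "M \<ge> 0" using B by (simp add: M_def sum_nonneg)
  ultimately show ?thesis using that by blast
qed

lemma euler_zero_outside:
  assumes "closed K" "\<And>x. x \<notin> K \<Longrightarrow> u x = 0" "x \<notin> K"
  shows "euler u x = 0"
  by (simp add: euler_eq[OF has_derivative_zero_outside[OF assms]])

lemma continuous_on_euler: "C1_off (u :: real ^ 'n \<Rightarrow> complex ^ 'm) \<Longrightarrow> continuous_on (- {0}) (euler u)"
proof -
  assume u: "C1_off u"
  have "continuous_on (- {0}) (\<lambda>x. \<Sum>i\<in>UNIV. (x $ i) *\<^sub>R pderiv_at i u x)"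
    by (intro continuous_intros C1_off_continuous_pderiv_at u)
  then show ?thesis
    by (rule continuous_on_eq) (use u in \<open>auto simp: euler_expand\<close>)
qed

text \<open>
  Formally this is skew-adjointness of \<open>E + (n + c) / 2\<close> combined with \<open>[E, L] = 0\<close>. To use first
  derivatives of \<open>u\<close> only, the commutator is replaced by its group version, \<open>L\<close> commuting with
  dilations. Let \<open>B = L - t\<close>, \<open>u\<^sub>s(x) = u(s x)\<close> and \<open>Q(s) = \<integral> |x|\<^sup>c \<langle>u\<^sub>s, B u\<^sub>s\<rangle> dx\<close>. Scaling gives
  \<open>Q(s) = s\<^sup>-\<^sup>n\<^sup>-\<^sup>c Q(1)\<close>, and symmetry of \<open>B\<close> gives \<open>Q(s) - Q(1) = \<integral> |x|\<^sup>c \<langle>u\<^sub>s - u, B u\<^sub>s + B u\<rangle> dx\<close>.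
  Divide by \<open>s - 1\<close> and let \<open>s\<close> tend to \<open>1\<close>.
\<close>

theorem weighted_cross_term:
  fixes \<sigma> :: "'n::{finite,linorder} \<Rightarrow> complex ^ 'm ^ 'm" and c t :: real
  assumes cl: "clifford_family \<sigma>" and K: "compact K" "0 \<notin> K"
    and u: "C1_off u" "\<And>x. x \<notin> K \<Longrightarrow> u x = 0"
  shows "2 * (LINT x|lborel. norm x powr c * inner (euler u x) (angular_diff \<sigma> u x - t *\<^sub>R u x)) =
    - (real CARD('n) + c) * (LINT x|lborel. norm x powr c * inner (u x) (angular_diff \<sigma> u x - t *\<^sub>R u x))"
proof -
  define B where "B x = angular_diff \<sigma> u x - t *\<^sub>R u x" for x
  define w where "w x = norm x powr c" for x :: "real ^ 'n::{finite,linorder}"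
  define \<kappa> where "\<kappa> = real CARD('n) + c"
  define Q where "Q s = (LINT x|lborel. w x * inner (u (s *\<^sub>R x)) (B (s *\<^sub>R x)))" for s
  note uc = C1_off_continuous[OF u(1)] and Lc = continuous_on_angular_diff[OF u(1), of \<sigma>]
  have L0: "angular_diff \<sigma> u x = 0" if "x \<notin> K" for x
    using K that by (intro angular_diff_zero_outside u compact_imp_closed)
  have Bc: "continuous_on (- {0}) B" unfolding B_def[abs_def] by (intro continuous_intros uc Lc)
  have B0: "B x = 0" if "x \<notin> K" for x using that by (simp add: B_def L0 u)
  have wc: "continuous_on (- {0}) w" unfolding w_def[abs_def] by (auto intro!: continuous_intros)
  have w_scale: "w (s *\<^sub>R x) = s powr c * w x" if "s > 0" for s x
    using that by (simp add: w_def powr_mult)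
  have uUc: "continuous_on UNIV u" by (rule continuous_on_extend_zero[OF K uc u(2)])
  have BUc: "continuous_on UNIV B" by (rule continuous_on_extend_zero[OF K Bc B0])
  have dil: "continuous_on (- {0}) (\<lambda>x. u (s *\<^sub>R x))" "continuous_on (- {0}) (\<lambda>x. B (s *\<^sub>R x))" for s
    by (auto intro!: continuous_on_compose2[OF uUc] continuous_on_compose2[OF BUc] continuous_intros)
  have Q_scale: "Q s = s powr (- \<kappa>) * Q 1" if s: "s > 0" for s
  proof -
    have "continuous_on UNIV (\<lambda>z. w z * inner (u z) (B z))"
      by (rule continuous_on_extend_zero[OF K]) (auto intro!: continuous_intros wc uc Bc simp: B0)
    then have "(\<lambda>z. w z * inner (u z) (B z)) \<in> borel_measurable borel"
      by (rule borel_measurable_continuous_onI)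
    from integral_dilation[OF this s] have "Q 1 = s ^ CARD('n) * (s powr c * Q s)"
      by (simp add: Q_def w_scale[OF s] mult.assoc)
    then have "Q 1 = s powr \<kappa> * Q s"
      using s by (simp add: \<kappa>_def powr_add powr_realpow)
    then show ?thesis using s by (simp add: powr_minus field_simps)
  qed
  have Q_diff: "Q s - Q 1 = (LINT x|lborel. w x * inner (u (s *\<^sub>R x) - u x) (B (s *\<^sub>R x) + B x))" if s: "s > 0" for s
  proof -
    \<comment> \<open>the support of the dilated function\<close>
    define K' where "K' = (\<lambda>x. (1 / s) *\<^sub>R x) ` K"
    have K': "compact K'" "0 \<notin> K'"
      using K s by (auto simp: K'_def intro!: compact_continuous_image continuous_intros)
    have K's: "s *\<^sub>R x \<notin> K" if "x \<notin> K'" for x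
    proof
      assume "s *\<^sub>R x \<in> K"
      moreover have "x = (1 / s) *\<^sub>R (s *\<^sub>R x)" using s by simp
      ultimately have "x \<in> K'" unfolding K'_def by (rule rev_image_eqI)
      then show False using that by simp
    qed
    note us = C1_off_dilation[OF u(1), of s]
    have Lus: "angular_diff \<sigma> (\<lambda>x. u (s *\<^sub>R x)) x = angular_diff \<sigma> u (s *\<^sub>R x)" if "x \<noteq> 0" for x
      using that s u(1) by (intro angular_diff_dilation) auto
    have i1: "integrable lborel (\<lambda>x. w x * inner (u (s *\<^sub>R x)) (B (s *\<^sub>R x)))"
      by (rule integrable_extend_zero[OF K']) (auto intro!: continuous_intros wc dil simp: B0 K's)
    have i2: "integrable lborel (\<lambda>x. w x * inner (u (s *\<^sub>R x)) (B x))"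
      "integrable lborel (\<lambda>x. w x * inner (u x) (B (s *\<^sub>R x)))"
      "integrable lborel (\<lambda>x. w x * inner (u x) (B x))"
      "integrable lborel (\<lambda>x. w x * inner (u (s *\<^sub>R x)) (angular_diff \<sigma> u x))"
      "integrable lborel (\<lambda>x. w x * (t * inner (u (s *\<^sub>R x)) (u x)))"
      by (rule integrable_extend_zero[OF K]; auto intro!: continuous_intros wc dil uc Bc Lc simp: B0 L0 u)+
    have "(LINT x|lborel. w x * inner (u (s *\<^sub>R x)) (B x)) =
      (LINT x|lborel. w x * inner (u (s *\<^sub>R x)) (angular_diff \<sigma> u x)) - (LINT x|lborel. w x * (t * inner (u (s *\<^sub>R x)) (u x)))"
      using i2(4,5) by (subst Bochner_Integration.integral_diff[symmetric]) (auto simp: B_def inner_diff_right right_diff_distrib)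
    also have "(LINT x|lborel. w x * inner (u (s *\<^sub>R x)) (angular_diff \<sigma> u x)) =
        (LINT x|lborel. w x * inner (angular_diff \<sigma> (\<lambda>x. u (s *\<^sub>R x)) x) (u x))"
      unfolding w_def using s by (intro weighted_angular_diff_symmetric[OF cl K us u]) auto
    also have "\<dots> = (LINT x|lborel. w x * inner (angular_diff \<sigma> u (s *\<^sub>R x)) (u x))"
    proof (intro Bochner_Integration.integral_cong refl)
      fix x
      show "w x * inner (angular_diff \<sigma> (\<lambda>x. u (s *\<^sub>R x)) x) (u x) = w x * inner (angular_diff \<sigma> u (s *\<^sub>R x)) (u x)"
        by (cases "x = 0") (simp_all add: w_def Lus)
    qed
    also have "\<dots> - (LINT x|lborel. w x * (t * inner (u (s *\<^sub>R x)) (u x))) = (LINT x|lborel. w x * inner (u x) (B (s *\<^sub>R x)))"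
    proof -
      have "w x * inner (angular_diff \<sigma> u (s *\<^sub>R x)) (u x) = w x * inner (u x) (B (s *\<^sub>R x)) + w x * (t * inner (u (s *\<^sub>R x)) (u x))" for x
        by (simp add: B_def inner_diff_right right_diff_distrib inner_commute)
      then show ?thesis using i2(2,5) by simp
    qed
    finally have sym: "(LINT x|lborel. w x * inner (u (s *\<^sub>R x)) (B x)) = (LINT x|lborel. w x * inner (u x) (B (s *\<^sub>R x)))" .
    have "(LINT x|lborel. w x * inner (u (s *\<^sub>R x) - u x) (B (s *\<^sub>R x) + B x)) =
      (LINT x|lborel. (w x * inner (u (s *\<^sub>R x)) (B (s *\<^sub>R x)) + w x * inner (u (s *\<^sub>R x)) (B x))
         - (w x * inner (u x) (B (s *\<^sub>R x)) + w x * inner (u x) (B x)))"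
      by (intro Bochner_Integration.integral_cong refl) (simp add: inner_diff_left inner_add_right algebra_simps)
    also have "\<dots> = Q s - Q 1"
      using i1 i2(1,2,3) sym by (simp add: Q_def)
    finally show ?thesis by simp
  qed
  \<comment> \<open>constants for the domination of the difference quotients: \<open>M\<close> is a Lipschitz constant of \<open>u\<close>, and for factors \<open>s \<in> [1, 2]\<close> all supports lie in the annulus \<open>A\<close>\<close>
  obtain M where M: "M \<ge> 0" "\<And>x y. norm (u x - u y) \<le> M * norm (x - y)"
    using lipschitz_extend_zero[OF K u] by metis
  obtain b where b: "b \<ge> 0" "\<And>x. norm (B x) \<le> b"
    using bounded_extend_zero[OF K Bc B0] by metis
  obtain R where R: "\<And>x. x \<in> K \<Longrightarrow> norm x \<le> R"
    using compact_imp_bounded[OF K(1)] by (auto simp: bounded_iff)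
  obtain a where a: "a > 0" "\<And>x. x \<in> K \<Longrightarrow> a \<le> norm x"
    using separate_point_closed[OF compact_imp_closed[OF K(1)] K(2)] by auto
  define A where "A = cball (0 :: real ^ 'n::{finite,linorder}) R - ball 0 (a / 2)"
  define h where "h m = inverse (real (Suc m))" for m
  have h: "h \<longlonglongrightarrow> 0" "\<And>m. h m \<noteq> 0" "\<And>m. h m > 0" "\<And>m. h m \<le> 1"
    using LIMSEQ_inverse_real_of_nat by (auto simp: h_def[abs_def] divide_simps)
  define D where "D m x = w x * inner ((u ((1 + h m) *\<^sub>R x) - u x) /\<^sub>R h m) (B ((1 + h m) *\<^sub>R x) + B x)" for m x
  have Dint: "(LINT x|lborel. D m x) = (Q (1 + h m) - Q 1) /\<^sub>R h m" for m
  proof -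
    have "1 + h m > 0" using h(3)[of m] by simp
    have "D m = (\<lambda>x. inverse (h m) * (w x * inner (u ((1 + h m) *\<^sub>R x) - u x) (B ((1 + h m) *\<^sub>R x) + B x)))"
      unfolding D_def by (rule ext) (simp only: inner_scaleR_left mult.left_commute)
    then show ?thesis using Q_diff[OF \<open>1 + h m > 0\<close>] by simp
  qed
  have "(\<lambda>m. LINT x|lborel. D m x) \<longlonglongrightarrow> (LINT x|lborel. w x * inner (euler u x) (B x + B x))"
  proof (rule integral_dominated_convergence)
    have wm: "w \<in> borel_measurable borel" unfolding w_def by measurable
    have [measurable]: "u \<in> borel_measurable borel" "B \<in> borel_measurable borel"
      using uUc BUc by (auto intro: borel_measurable_continuous_onI)
    have "continuous_on (- {0}) (\<lambda>x. w x * inner (euler u x) (B x + B x))"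
      by (intro continuous_intros wc Bc continuous_on_euler u)
    from integrable_extend_zero[OF K this]
    show "(\<lambda>x. w x * inner (euler u x) (B x + B x)) \<in> borel_measurable lborel"
      using B0 by (intro borel_measurable_integrable) auto
    show "D m \<in> borel_measurable lborel" for m
      unfolding D_def using wm by measurable
    show "integrable lborel (\<lambda>x. indicator A x *\<^sub>R (w x * (M * norm x * (2 * b))))"
    proof (rule borel_integrable_compact)
      show "compact A" unfolding A_def by (intro compact_diff) auto
      show "continuous_on A (\<lambda>x. w x * (M * norm x * (2 * b)))"
        using a by (intro continuous_intros continuous_on_subset[OF wc]) (auto simp: A_def)
    qed
    show "AE x in lborel. (\<lambda>m. D m x) \<longlonglongrightarrow> w x * inner (euler u x) (B x + B x)"
    proof (rule AE_I2)
      fix x :: "real ^ 'n::{finite,linorder}"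
      have s: "((\<lambda>s. s *\<^sub>R x) has_derivative (\<lambda>s. s *\<^sub>R x)) (at (1::real))"
        by (auto intro!: derivative_eq_intros)
      have "(u has_derivative frechet_derivative u (at x)) (at (1 *\<^sub>R x))"
        using has_derivative_extend_zero[OF K u, of x] by simp
      from has_derivative_compose[OF s this]
      have "((\<lambda>s. u (s *\<^sub>R x)) has_derivative (\<lambda>s. frechet_derivative u (at x) (s *\<^sub>R x))) (at 1)" by simp
      then have "((\<lambda>s. u (s *\<^sub>R x)) has_vector_derivative euler u x) (at 1)"
        using linear_scale[OF has_derivative_linear[OF has_derivative_extend_zero[OF K u, of x]]]
        by (simp add: has_vector_derivative_def euler_def)
      from difference_quotient_tendsto[OF this h(1,2)]
      have 1: "(\<lambda>m. (u ((1 + h m) *\<^sub>R x) - u x) /\<^sub>R h m) \<longlonglongrightarrow> euler u x" by simp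
      have "(\<lambda>m. (1 + h m) *\<^sub>R x) \<longlonglongrightarrow> (1 + 0) *\<^sub>R x" by (intro tendsto_intros h)
      then have 2: "(\<lambda>m. B ((1 + h m) *\<^sub>R x)) \<longlonglongrightarrow> B x"
        using continuous_on_tendsto_compose[OF BUc] by auto
      show "(\<lambda>m. D m x) \<longlonglongrightarrow> w x * inner (euler u x) (B x + B x)"
        unfolding D_def by (intro tendsto_intros 1 2)
    qed
    show "AE x in lborel. norm (D m x) \<le> indicator A x *\<^sub>R (w x * (M * norm x * (2 * b)))" for m
    proof (rule AE_I2)
      fix x
      let ?s = "1 + h m"
      have w: "w x \<ge> 0" by (simp add: w_def)
      show "norm (D m x) \<le> indicator A x *\<^sub>R (w x * (M * norm x * (2 * b)))"
      proof (cases "x \<in> A")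
        case True
        have "norm (u (?s *\<^sub>R x) - u x) \<le> M * norm (?s *\<^sub>R x - x)" by (rule M)
        also have "?s *\<^sub>R x - x = h m *\<^sub>R x" by (simp add: scaleR_left_distrib)
        finally have "norm (u (?s *\<^sub>R x) - u x) \<le> h m * (M * norm x)"
          using h(3)[of m] by (simp add: mult_ac)
        then have "norm (u (?s *\<^sub>R x) - u x) / h m \<le> M * norm x"
          by (simp only: pos_divide_le_eq[OF h(3)] mult.commute[of _ "h m"])
        moreover have "norm ((u (?s *\<^sub>R x) - u x) /\<^sub>R h m) = norm (u (?s *\<^sub>R x) - u x) / h m"
          by (simp only: norm_scaleR abs_inverse abs_of_pos[OF h(3)] divide_inverse mult.commute)
        ultimately have "norm ((u (?s *\<^sub>R x) - u x) /\<^sub>R h m) \<le> M * norm x" by (simp only:)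
        moreover have "norm (B (?s *\<^sub>R x) + B x) \<le> 2 * b"
          using norm_triangle_ineq[of "B (?s *\<^sub>R x)" "B x"] b(2)[of "?s *\<^sub>R x"] b(2)[of x] by simp
        ultimately have "norm ((u (?s *\<^sub>R x) - u x) /\<^sub>R h m) * norm (B (?s *\<^sub>R x) + B x) \<le> M * norm x * (2 * b)"
          using M b by (intro mult_mono) auto
        then have "\<bar>inner ((u (?s *\<^sub>R x) - u x) /\<^sub>R h m) (B (?s *\<^sub>R x) + B x)\<bar> \<le> M * norm x * (2 * b)"
          using Cauchy_Schwarz_ineq2 order_trans by blast
        then show ?thesis
          using True w by (simp add: D_def abs_mult mult_left_mono)
      next
        case False
        have n: "norm (?s *\<^sub>R x) = ?s * norm x" using h(3)[of m] by simp
        have "x \<notin> K \<and> ?s *\<^sub>R x \<notin> K"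
        proof (cases "norm x \<le> R")
          case True
          then have x: "norm x < a / 2" using False by (auto simp: A_def)
          have "?s * norm x \<le> 2 * norm x" using h(4)[of m] by (intro mult_right_mono) auto
          then show ?thesis using x a(2)[of x] a(2)[of "?s *\<^sub>R x"] a(1) n by linarith
        next
          case False
          moreover have "1 * norm x \<le> ?s * norm x" using h(3)[of m] by (intro mult_right_mono) auto
          ultimately show ?thesis using R[of x] R[of "?s *\<^sub>R x"] n by linarith
        qed
        then show ?thesis using False by (simp add: D_def u B0)
      qed
    qed
  qed
  moreover have "(\<lambda>m. LINT x|lborel. D m x) \<longlonglongrightarrow> - \<kappa> * Q 1"
  proof -
    have "((\<lambda>s. s powr (- \<kappa>) * Q 1) has_real_derivative - \<kappa> * Q 1) (at 1)"
      by (auto intro!: derivative_eq_intros)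
    then have "((\<lambda>s. s powr (- \<kappa>) * Q 1) has_vector_derivative - \<kappa> * Q 1) (at 1)"
      by (simp only: has_real_derivative_iff_has_vector_derivative)
    from difference_quotient_tendsto[OF this h(1,2)] show ?thesis
    proof (rule back_subst[where P="\<lambda>f. f \<longlonglongrightarrow> _"], intro ext)
      fix m
      have "1 + h m > 0" using h(3)[of m] by simp
      from Q_scale[OF this] show "((1 + h m) powr - \<kappa> * Q 1 - 1 powr - \<kappa> * Q 1) /\<^sub>R h m = (LINT x|lborel. D m x)"
        by (simp add: Dint)
    qed
  qed
  ultimately have "- \<kappa> * Q 1 = (LINT x|lborel. w x * inner (euler u x) (B x + B x))"
    using LIMSEQ_unique by blast
  also have "\<dots> = (LINT x|lborel. 2 * (w x * inner (euler u x) (B x)))"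
    by (intro Bochner_Integration.integral_cong refl) (simp only: inner_add_right mult_2 distrib_left)
  finally show ?thesis by (simp add: Q_def w_def B_def \<kappa>_def)
qed

text \<open>
  The mixed term of \<open>|(E + t) u + (L - t) u|\<^sup>2\<close> integrates to \<open>0\<close> by the preceding theorem, because
  \<open>2 t = n + c\<close>.
\<close>

theorem weighted_energy_identity:
  fixes \<sigma> :: "'n::{finite,linorder} \<Rightarrow> complex ^ 'm ^ 'm" and c t :: real
  assumes cl: "clifford_family \<sigma>" and K: "compact K" "0 \<notin> K"
    and u: "C1_off u" "\<And>x. x \<notin> K \<Longrightarrow> u x = 0" and t: "2 * t = real CARD('n) + c"
  shows "(LINT x|lborel. norm x powr (c + 2) * (norm (dirac \<sigma> u x))\<^sup>2) =
    (LINT x|lborel. norm x powr c * (norm (euler u x + t *\<^sub>R u x))\<^sup>2) +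
    (LINT x|lborel. norm x powr c * (norm (angular_diff \<sigma> u x - t *\<^sub>R u x))\<^sup>2)"
proof -
  define B where "B x = angular_diff \<sigma> u x - t *\<^sub>R u x" for x
  define A where "A x = euler u x + t *\<^sub>R u x" for x
  note uc = C1_off_continuous[OF u(1)] and Lc = continuous_on_angular_diff[OF u(1), of \<sigma>]
    and Ec = continuous_on_euler[OF u(1)]
  have L0: "angular_diff \<sigma> u x = 0" and E0: "euler u x = 0" if "x \<notin> K" for x
    using K that by (auto intro!: angular_diff_zero_outside[of K] euler_zero_outside[of K] u(2) compact_imp_closed)
  have i: "integrable lborel (\<lambda>x. norm x powr c * (norm (A x))\<^sup>2)"
    "integrable lborel (\<lambda>x. norm x powr c * (norm (B x))\<^sup>2)"
    "integrable lborel (\<lambda>x. norm x powr c * inner (euler u x) (B x))"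
    "integrable lborel (\<lambda>x. norm x powr c * inner (u x) (B x))"
    unfolding A_def B_def
    by (rule integrable_extend_zero[OF K]; auto intro!: continuous_intros uc Lc Ec simp: L0 E0 u)+
  have cross: "(LINT x|lborel. norm x powr c * inner (euler u x) (B x)) +
      t * (LINT x|lborel. norm x powr c * inner (u x) (B x)) = 0"
  proof -
    have "2 * (LINT x|lborel. norm x powr c * inner (euler u x) (B x)) =
        - (2 * t) * (LINT x|lborel. norm x powr c * inner (u x) (B x))"
      using weighted_cross_term[OF cl K u, of c t] unfolding t B_def by simp
    then show ?thesis by linarith
  qed
  have eq: "norm x powr (c + 2) * (norm (dirac \<sigma> u x))\<^sup>2 =
      norm x powr c * (norm (A x))\<^sup>2 + norm x powr c * (norm (B x))\<^sup>2 +
      2 * (norm x powr c * inner (euler u x) (B x) + t * (norm x powr c * inner (u x) (B x)))" for x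
  proof (cases "x = 0")
    case False
    have "u differentiable (at x)" using u(1) False by auto
    from clifford_mult_dirac[OF cl this] have "clifford_mult \<sigma> x (dirac \<sigma> u x) = A x + B x"
      by (simp add: A_def B_def)
    then have "(norm (A x + B x))\<^sup>2 = (norm x)\<^sup>2 * (norm (dirac \<sigma> u x))\<^sup>2"
      using norm_clifford_mult[OF cl, of x "dirac \<sigma> u x"] by simp
    moreover have "norm x powr (c + 2) = norm x powr c * (norm x)\<^sup>2"
      using False by (simp add: powr_add)
    ultimately have "norm x powr (c + 2) * (norm (dirac \<sigma> u x))\<^sup>2 = norm x powr c * (norm (A x + B x))\<^sup>2"
      by simp
    also have "(norm (A x + B x))\<^sup>2 = (norm (A x))\<^sup>2 + (norm (B x))\<^sup>2 + 2 * (inner (euler u x) (B x) + t * inner (u x) (B x))"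
    proof -
      have "inner (A x) (B x) = inner (euler u x) (B x) + t * inner (u x) (B x)"
        by (simp add: A_def inner_add_left)
      then show ?thesis
        by (simp add: power2_norm_eq_inner inner_add_left inner_add_right inner_commute)
    qed
    finally show ?thesis by (simp add: algebra_simps)
  qed simp
  have "(LINT x|lborel. norm x powr (c + 2) * (norm (dirac \<sigma> u x))\<^sup>2) =
    (LINT x|lborel. norm x powr c * (norm (A x))\<^sup>2) + (LINT x|lborel. norm x powr c * (norm (B x))\<^sup>2) +
    2 * ((LINT x|lborel. norm x powr c * inner (euler u x) (B x)) + t * (LINT x|lborel. norm x powr c * inner (u x) (B x)))"
    unfolding eq using i by simp
  then show ?thesis unfolding cross unfolding A_def B_def by simp
qed

section \<open>The weighted inequality\<close>

lemma test_function_support: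
  assumes "u \<in> test_functions"
  obtains K where "compact K" "0 \<notin> K" "\<And>x. x \<notin> K \<Longrightarrow> u x = 0"
proof
  show "compact (closure {x. u x \<noteq> 0})" "0 \<notin> closure {x. u x \<noteq> 0}"
    using assms by (auto simp: test_functions_def)
  show "u x = 0" if "x \<notin> closure {x. u x \<noteq> 0}" for x
    using that closure_subset[of "{x. u x \<noteq> 0}"] by auto
qed

lemma test_function_C1_off: "u \<in> test_functions \<Longrightarrow> C1_off u"
  using smooth_on_C1_off by (auto simp: test_functions_def simp del: higher_differentiable_on.simps)

lemma continuous_on_sphere_L2:
  "continuous_on (sphere 0 1) (f :: 'a::euclidean_space \<Rightarrow> complex ^ 'm) \<Longrightarrow> f \<in> L2 sphere_measure"
  by (auto simp: L2_def intro!: continuous_on_sphere_measurable continuous_on_sphere_integrable continuous_intros)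

text \<open>
  A smooth eigenfunction is its own approximating sequence in the closure of \<open>L\<close>.
\<close>

lemma angular_eigen_eigenspace:
  assumes "smooth_on UNIV p" "angular_eigen \<sigma> k p"
  shows "p \<in> eigenspace \<sigma> k"
proof -
  have "p \<in> L2 sphere_measure" "(\<lambda>\<omega>. of_int k *\<^sub>R p \<omega>) \<in> L2 sphere_measure"
    by (intro continuous_on_sphere_L2 continuous_intros smooth_on_continuous assms)+
  moreover have "smooth_on (- {0}) p" using assms(1) by (rule smooth_on_subset) simp
  ultimately show ?thesis
    using assms(2) unfolding eigenspace_def angular_op_def
    by (auto simp: angular_eigen_def intro!: exI[of _ "\<lambda>_. p"])
qed

lemma borel_measurable_component:
  fixes f :: "'a \<Rightarrow> complex ^ 'm"
  shows "f \<in> borel_measurable M \<Longrightarrow> (\<lambda>x. f x $ a) \<in> borel_measurable M"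
  by (erule measurable_compose) (intro borel_measurable_continuous_onI continuous_intros)

lemma L2_inner_integrable:
  fixes f g :: "'a \<Rightarrow> complex ^ 'm"
  assumes f: "f \<in> L2 M" and g: "g \<in> L2 M"
  shows "integrable M (\<lambda>x. \<Sum>a\<in>UNIV. f x $ a * cnj (g x $ a))"
proof (rule Bochner_Integration.integrable_sum)
  fix a
  have [measurable]: "(\<lambda>x. f x $ a) \<in> borel_measurable M" "(\<lambda>x. g x $ a) \<in> borel_measurable M"
    using f g by (auto simp: L2_def intro: borel_measurable_component)
  have cnj: "(\<lambda>x. cnj (g x $ a)) \<in> borel_measurable M"
    by (rule measurable_compose[where g=cnj]) (auto intro!: borel_measurable_continuous_onI continuous_intros)
  show "integrable M (\<lambda>x. f x $ a * cnj (g x $ a))"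
  proof (rule Bochner_Integration.integrable_bound[of M "\<lambda>x. (norm (f x))\<^sup>2 + (norm (g x))\<^sup>2"])
    show "integrable M (\<lambda>x. (norm (f x))\<^sup>2 + (norm (g x))\<^sup>2)" using f g by (simp add: L2_def)
    show "(\<lambda>x. f x $ a * cnj (g x $ a)) \<in> borel_measurable M" using cnj by measurable
    show "AE x in M. norm (f x $ a * cnj (g x $ a)) \<le> norm ((norm (f x))\<^sup>2 + (norm (g x))\<^sup>2)"
    proof (rule AE_I2)
      fix x
      have "norm (f x $ a * cnj (g x $ a)) \<le> norm (f x) * norm (g x)"
        by (simp add: norm_mult mult_mono Finite_Cartesian_Product.norm_nth_le)
      also have "\<dots> \<le> (norm (f x))\<^sup>2 + (norm (g x))\<^sup>2"
      proof -
        have "0 \<le> norm (f x) * norm (g x)" by simp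
        then show ?thesis using sum_squares_bound[of "norm (f x)" "norm (g x)"] by linarith
      qed
      finally show "norm (f x $ a * cnj (g x $ a)) \<le> norm ((norm (f x))\<^sup>2 + (norm (g x))\<^sup>2)" by simp
    qed
  qed
qed

lemma L2_real_inner:
  assumes "f \<in> L2 M" "g \<in> L2 M"
  shows "integrable M (\<lambda>x. inner (f x) (g x))" "Re (L2_inner M f g) = (LINT x|M. inner (f x) (g x))"
proof -
  have eq: "inner (f x) (g x) = Re (\<Sum>a\<in>UNIV. f x $ a * cnj (g x $ a))" for x
    by (simp only: inner_complex_vec Re_sum)
  show "integrable M (\<lambda>x. inner (f x) (g x))"
    unfolding eq by (rule integrable_Re[OF L2_inner_integrable[OF assms]])
  show "Re (L2_inner M f g) = (LINT x|M. inner (f x) (g x))"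
    unfolding eq L2_inner_def by (rule integral_Re[OF L2_inner_integrable[OF assms], symmetric])
qed

theorem dirac_hardy_inequality:
  fixes \<sigma> :: "'n::{finite,linorder} \<Rightarrow> complex ^ 'm ^ 'm" and c :: real
  assumes n: "CARD('n) \<ge> 2" and cl: "clifford_family \<sigma>" and u: "u \<in> test_functions"
    and proj: "is_angular_proj \<sigma> j u (\<lambda>_. 0)" and j: "2 * of_int j = real CARD('n) + c"
  shows "(LINT x|lborel. norm x powr c * (norm (u x))\<^sup>2) \<le>
    (LINT x|lborel. norm x powr (c + 2) * (norm (dirac \<sigma> u x))\<^sup>2)"
proof -
  obtain K where K: "compact K" "0 \<notin> K" and u0: "\<And>x. x \<notin> K \<Longrightarrow> u x = 0"
    using test_function_support[OF u] by metis
  note uC = test_function_C1_off[OF u]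
  note uc = C1_off_continuous[OF uC] and Lc = continuous_on_angular_diff[OF uC, of \<sigma>]
  have L0: "angular_diff \<sigma> u x = 0" if "x \<notin> K" for x
    using K that by (intro angular_diff_zero_outside u0 compact_imp_closed)
  define B where "B x = angular_diff \<sigma> u x - of_int j *\<^sub>R u x" for x
  let ?U = "\<lambda>r \<omega>. norm (r *\<^sub>R \<omega>) powr c * (norm (u (r *\<^sub>R \<omega>)))\<^sup>2"
  let ?V = "\<lambda>r \<omega>. norm (r *\<^sub>R \<omega>) powr c * (norm (B (r *\<^sub>R \<omega>)))\<^sup>2"
  have i: "integrable lborel (\<lambda>x. norm x powr c * (norm (u x))\<^sup>2)"
    "integrable lborel (\<lambda>x. norm x powr c * (norm (B x))\<^sup>2)"
    unfolding B_def by (rule integrable_extend_zero[OF K]; auto intro!: continuous_intros uc Lc simp: L0 u0)+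
  have "(LINT x|lborel. norm x powr c * (norm (u x))\<^sup>2) \<le> (LINT x|lborel. norm x powr c * (norm (B x))\<^sup>2)"
  proof (rule integral_polar_mono[OF i(1) _ i(2)])
    have "AE r in lborel. r > 0 \<longrightarrow>
        is_orth_proj sphere_measure (eigenspace \<sigma> j) (\<lambda>\<omega>. u (r *\<^sub>R \<omega>)) (\<lambda>\<omega>. 0)"
      using proj by (simp add: is_angular_proj_def)
    then show "AE r in lborel. r > 0 \<longrightarrow>
      integrable sphere_measure (?U r) \<and>
      integrable sphere_measure (?V r) \<and>
      (LINT \<omega>|sphere_measure. ?U r \<omega>)
      \<le> (LINT \<omega>|sphere_measure. ?V r \<omega>)"
    proof eventually_elim
      case (elim r)
      show ?case
      proof
        assume r: "r > 0"
        define v where "v x = u (r *\<^sub>R x)" for x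
        have v: "C1_off v" unfolding v_def[abs_def] using r by (intro C1_off_dilation uC) auto
        note vc = continuous_on_sphere_off[OF C1_off_continuous[OF v]]
          and Lvc = continuous_on_sphere_off[OF continuous_on_angular_diff[OF v, of \<sigma>]]
        \<comment> \<open>the assumption on the projection enters here, through the eigenfunctions \<open>p\<close>\<close>
        have gap: "(LINT \<omega>|sphere_measure. (norm (v \<omega>))\<^sup>2) \<le>
          (LINT \<omega>|sphere_measure. (norm (angular_diff \<sigma> v \<omega> - of_int j *\<^sub>R v \<omega>))\<^sup>2)"
        proof (rule angular_spectral_gap[OF n cl v])
          fix p assume p: "smooth_on UNIV p" "angular_eigen \<sigma> j p"
          have "L2_inner sphere_measure v p = 0"
            using elim r angular_eigen_eigenspace[OF p] by (auto simp: is_orth_proj_def v_def[abs_def])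
          then show "(LINT \<omega>|sphere_measure. inner (v \<omega>) (p \<omega>)) = 0"
            using L2_real_inner(2)[OF continuous_on_sphere_L2[OF vc] continuous_on_sphere_L2[OF smooth_on_continuous[OF p(1)]]]
            by simp
        qed
        have eq: "?U r \<omega> = r powr c * (norm (v \<omega>))\<^sup>2"
          "?V r \<omega> =
            r powr c * (norm (angular_diff \<sigma> v \<omega> - of_int j *\<^sub>R v \<omega>))\<^sup>2"
          if "\<omega> \<in> space sphere_measure" for \<omega>
        proof -
          have "r *\<^sub>R \<omega> \<noteq> 0" using that r by (auto simp: space_sphere_measure)
          then have "u differentiable (at (r *\<^sub>R \<omega>))" using uC by auto
          from angular_diff_dilation[OF this, of \<sigma>]
          show "?U r \<omega> = r powr c * (norm (v \<omega>))\<^sup>2"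
            "?V r \<omega> =
            r powr c * (norm (angular_diff \<sigma> v \<omega> - of_int j *\<^sub>R v \<omega>))\<^sup>2"
            using that r by (simp_all add: space_sphere_measure B_def v_def[abs_def])
        qed
        have ii: "integrable sphere_measure (\<lambda>\<omega>. (norm (v \<omega>))\<^sup>2)"
          "integrable sphere_measure (\<lambda>\<omega>. (norm (angular_diff \<sigma> v \<omega> - of_int j *\<^sub>R v \<omega>))\<^sup>2)"
          by (intro continuous_on_sphere_integrable continuous_intros vc Lvc)+
        show "integrable sphere_measure (?U r) \<and>
          integrable sphere_measure (?V r) \<and>
          (LINT \<omega>|sphere_measure. ?U r \<omega>)
          \<le> (LINT \<omega>|sphere_measure. ?V r \<omega>)"
          using ii gap
          by (simp only: Bochner_Integration.integrable_cong[OF refl eq(1)] Bochner_Integration.integrable_cong[OF refl eq(2)]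
            Bochner_Integration.integral_cong[OF refl eq(1)] Bochner_Integration.integral_cong[OF refl eq(2)])
            (simp add: mult_left_mono)
      qed
    qed
  qed auto
  also have "\<dots> \<le> (LINT x|lborel. norm x powr c * (norm (euler u x + of_int j *\<^sub>R u x))\<^sup>2) + \<dots>"
    by simp
  also have "\<dots> = (LINT x|lborel. norm x powr (c + 2) * (norm (dirac \<sigma> u x))\<^sup>2)"
    using weighted_energy_identity[OF cl K uC u0 j] by (simp add: B_def)
  finally show ?thesis .
qed

section \<open>Smooth radial profiles\<close>

text \<open>
  The functions \<open>x\<^sup>-\<^sup>m exp(-1/x)\<close>, extended by zero. Their span is closed under
  differentiation, so first derivatives suffice to see that the classical function \<open>exp(-1/x)\<close> is smooth.
\<close>

definition bump_tail :: "nat \<Rightarrow> real \<Rightarrow> real" where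
  "bump_tail m x = (if x > 0 then inverse x ^ m * exp (- inverse x) else 0)"

lemma bump_tail_tendsto_0: "((\<lambda>x::real. inverse x ^ k * exp (- inverse x)) \<longlongrightarrow> 0) (at_right 0)"
  using filterlim_compose[OF tendsto_power_div_exp_0 filterlim_inverse_at_top_right, of k]
  by (simp add: exp_minus divide_inverse)

lemma inverse_power_has_derivative:
  assumes "x \<noteq> (0::real)"
  shows "((\<lambda>x. inverse x ^ m) has_real_derivative - (real m * inverse x ^ (m + 1))) (at x)"
proof -
  have "(inverse has_real_derivative - (inverse x ^ Suc (Suc 0))) (at x)"
    by (rule DERIV_inverse[OF assms])
  from DERIV_power[OF this, of m] show ?thesis
    by (cases m) (simp_all add: mult_ac)
qed

lemma bump_tail_has_derivative:
  "(bump_tail m has_real_derivative bump_tail (m + 2) x - real m * bump_tail (m + 1) x) (at x)"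
proof -
  consider "x > 0" | "x = 0" | "x < 0" by linarith
  then show ?thesis
  proof cases
    case 1
    have "((\<lambda>x. inverse x ^ m * exp (- inverse x)) has_real_derivative
        bump_tail (m + 2) x - real m * bump_tail (m + 1) x) (at x)"
    proof (rule DERIV_cong[OF DERIV_mult[OF inverse_power_has_derivative]])
      show "((\<lambda>x. exp (- inverse x)) has_real_derivative exp (- inverse x) * inverse x ^ 2) (at x)"
        using 1 by (auto intro!: derivative_eq_intros simp: power2_eq_square)
      show "- (real m * inverse x ^ (m + 1)) * exp (- inverse x) + exp (- inverse x) * inverse x ^ 2 * inverse x ^ m =
          bump_tail (m + 2) x - real m * bump_tail (m + 1) x"
        using 1 by (simp add: bump_tail_def power2_eq_square mult_ac)
    qed (use 1 in simp)
    then show ?thesis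
      by (rule has_field_derivative_transform_within_open[where S="{0<..}"]) (use 1 in \<open>auto simp: bump_tail_def\<close>)
  next
    case 2
    have "((\<lambda>y. (bump_tail m y - bump_tail m 0) / (y - 0)) \<longlongrightarrow> 0) (at 0)"
    proof (rule filterlim_split_at)
      show "((\<lambda>y. (bump_tail m y - bump_tail m 0) / (y - 0)) \<longlongrightarrow> 0) (at_left 0)"
        by (rule tendsto_eventually)
          (auto simp: eventually_at_left_field bump_tail_def intro!: exI[of _ "-1"])
      show "((\<lambda>y. (bump_tail m y - bump_tail m 0) / (y - 0)) \<longlongrightarrow> 0) (at_right 0)"
      proof (rule Lim_transform_eventually[OF bump_tail_tendsto_0[of "Suc m"]])
        show "\<forall>\<^sub>F x in at_right 0. inverse x ^ Suc m * exp (- inverse x) = (bump_tail m x - bump_tail m 0) / (x - 0)"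
          by (auto simp: eventually_at_right_field bump_tail_def divide_inverse intro!: exI[of _ "1"])
      qed
    qed
    then show ?thesis using 2 by (simp add: has_field_derivative_iff bump_tail_def)
  next
    case 3
    have "((\<lambda>_. 0) has_real_derivative 0) (at x)" by simp
    then have "(bump_tail m has_real_derivative 0) (at x)"
      by (rule has_field_derivative_transform_within_open[where S="{..<0}"]) (use 3 in \<open>auto simp: bump_tail_def\<close>)
    then show ?thesis using 3 by (simp add: bump_tail_def)
  qed
qed

text \<open>
  For \<open>q = m = 0\<close> this is a power of \<open>s\<close> times a bump in \<open>ln s\<close> of width \<open>2 / \<epsilon>\<close>; the other parameters
  are those that differentiation creates.
\<close>

definition log_bump :: "real \<Rightarrow> real \<Rightarrow> nat \<Rightarrow> nat \<Rightarrow> real \<Rightarrow> real" where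
  "log_bump \<epsilon> a q m s = (if s > 0 then s powr a * ln s ^ q * bump_tail m (1 - (\<epsilon> * ln s)\<^sup>2) else 0)"

lemma log_bump_eq_0:
  assumes "\<epsilon> > 0" "s < exp (- 1 / \<epsilon>) \<or> s > exp (1 / \<epsilon>)"
  shows "log_bump \<epsilon> a q m s = 0"
proof (cases "s > 0")
  case True
  have "ln s < - 1 / \<epsilon> \<or> ln s > 1 / \<epsilon>"
    using assms(2) True by (metis exp_gt_zero ln_exp ln_less_cancel_iff)
  then have "\<epsilon> * ln s < - 1 \<or> \<epsilon> * ln s > 1"
    using assms(1) by (auto simp: field_simps)
  then have "(\<epsilon> * ln s)\<^sup>2 > 1"
    using abs_square_le_1[of "\<epsilon> * ln s"] by auto
  then show ?thesis by (simp add: log_bump_def bump_tail_def)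
qed (simp add: log_bump_def)

lemma log_bump_has_derivative:
  assumes \<epsilon>: "\<epsilon> > 0"
  shows "(log_bump \<epsilon> a q m has_real_derivative
     a * log_bump \<epsilon> (a - 1) q m s + real q * log_bump \<epsilon> (a - 1) (q - 1) m s
     - 2 * \<epsilon>\<^sup>2 * (log_bump \<epsilon> (a - 1) (q + 1) (m + 2) s - real m * log_bump \<epsilon> (a - 1) (q + 1) (m + 1) s)) (at s)"
proof (cases "s > 0")
  case True
  let ?y = "\<lambda>s. 1 - (\<epsilon> * ln s)\<^sup>2"
  have D1: "((\<lambda>s. s powr a) has_real_derivative a * s powr (a - 1)) (at s)"
    using True by (rule has_real_derivative_powr)
  have D2: "((\<lambda>s. ln s ^ q) has_real_derivative real q * ln s ^ (q - 1) * (1 / s)) (at s)"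
    using True by (auto intro!: derivative_eq_intros)
  have "(?y has_real_derivative - (2 * \<epsilon>\<^sup>2 * ln s / s)) (at s)"
    using True by (auto intro!: derivative_eq_intros simp: power2_eq_square field_simps)
  from DERIV_chain2[OF bump_tail_has_derivative this]
  have D3: "((\<lambda>s. bump_tail m (?y s)) has_real_derivative
      (bump_tail (m + 2) (?y s) - real m * bump_tail (m + 1) (?y s)) * - (2 * \<epsilon>\<^sup>2 * ln s / s)) (at s)" .
  have p: "s powr (a - 1) = s powr a / s" using True by (simp add: powr_diff)
  have "((\<lambda>s. s powr a * ln s ^ q * bump_tail m (?y s)) has_real_derivative
     a * log_bump \<epsilon> (a - 1) q m s + real q * log_bump \<epsilon> (a - 1) (q - 1) m s
     - 2 * \<epsilon>\<^sup>2 * (log_bump \<epsilon> (a - 1) (q + 1) (m + 2) s - real m * log_bump \<epsilon> (a - 1) (q + 1) (m + 1) s)) (at s)"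
    by (rule DERIV_cong[OF DERIV_mult[OF DERIV_mult[OF D1 D2] D3]])
      (use True in \<open>simp add: log_bump_def p field_simps\<close>)
  then show ?thesis
    by (rule has_field_derivative_transform_within_open[where S="{0<..}"]) (use True in \<open>auto simp: log_bump_def\<close>)
next
  case False
  then have s: "s < exp (- 1 / \<epsilon>)" by (metis exp_gt_zero linorder_not_le order_le_less_trans)
  have "((\<lambda>_. 0) has_real_derivative 0) (at s)" by simp
  then have "(log_bump \<epsilon> a q m has_real_derivative 0) (at s)"
    by (rule has_field_derivative_transform_within_open[where S="{..<exp (- 1 / \<epsilon>)}"])
      (use s \<epsilon> in \<open>auto simp: log_bump_eq_0\<close>)
  then show ?thesis using False by (simp add: log_bump_def)
qed

text \<open>
  A space of functions that is closed under differentiation, hence consists of smooth functions.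
\<close>

inductive radial_profile :: "real \<Rightarrow> (real \<Rightarrow> real) \<Rightarrow> bool" for \<epsilon> where
  base: "radial_profile \<epsilon> (log_bump \<epsilon> a q m)"
| add: "radial_profile \<epsilon> f \<Longrightarrow> radial_profile \<epsilon> g \<Longrightarrow> radial_profile \<epsilon> (\<lambda>s. f s + g s)"
| scale: "radial_profile \<epsilon> f \<Longrightarrow> radial_profile \<epsilon> (\<lambda>s. r * f s)"

lemma radial_profile_derivative:
  assumes \<epsilon>: "\<epsilon> > 0"
  shows "radial_profile \<epsilon> f \<Longrightarrow> \<exists>f'. radial_profile \<epsilon> f' \<and> (\<forall>s. (f has_real_derivative f' s) (at s))"
proof (induction rule: radial_profile.induct)
  case (base a q m)
  define f' where "f' s = (a * log_bump \<epsilon> (a - 1) q m s + real q * log_bump \<epsilon> (a - 1) (q - 1) m s)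
     + (- 2 * \<epsilon>\<^sup>2) * (log_bump \<epsilon> (a - 1) (q + 1) (m + 2) s + (- real m) * log_bump \<epsilon> (a - 1) (q + 1) (m + 1) s)" for s
  have "radial_profile \<epsilon> f'"
    unfolding f'_def[abs_def] by (intro radial_profile.intros)
  moreover have "(log_bump \<epsilon> a q m has_real_derivative f' s) (at s)" for s
    using log_bump_has_derivative[OF \<epsilon>, of a q m s] by (simp add: f'_def)
  ultimately show ?case by blast
next
  case (add f g)
  then obtain f' g' where "radial_profile \<epsilon> f'" "\<forall>s. (f has_real_derivative f' s) (at s)"
    "radial_profile \<epsilon> g'" "\<forall>s. (g has_real_derivative g' s) (at s)" by blast
  then show ?case
    by (intro exI[of _ "\<lambda>s. f' s + g' s"]) (auto intro: radial_profile.add DERIV_add)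
next
  case (scale f r)
  then obtain f' where "radial_profile \<epsilon> f'" "\<forall>s. (f has_real_derivative f' s) (at s)" by blast
  then show ?case
    by (intro exI[of _ "\<lambda>s. r * f' s"]) (auto intro: radial_profile.scale DERIV_cmult)
qed

lemma hom_poly_sum_has_derivative:
  "hom_poly_sum p \<Longrightarrow> (p has_derivative frechet_derivative p (at x)) (at x)"
proof (induction rule: hom_poly_sum.induct)
  case (hom d p)
  then show ?case by (rule hom_poly_has_derivative)
next
  case (add p q)
  from has_derivative_add[OF add.IH] show ?case
    using has_derivative_imp_differentiable frechet_derivative_works by blast
qed

lemma hom_poly_sum_deriv:
  "hom_poly_sum p \<Longrightarrow> hom_poly_sum (\<lambda>x. frechet_derivative p (at x) v)"
proof (induction rule: hom_poly_sum.induct)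
  case (hom d p)
  then show ?case by (rule hom_poly_sum.hom[OF hom_poly_deriv])
next
  case (add p q)
  have "frechet_derivative (\<lambda>x. p x + q x) (at x) v = frechet_derivative p (at x) v + frechet_derivative q (at x) v" for x
    using frechet_derivative_at[OF has_derivative_add[OF add.hyps[THEN hom_poly_sum_has_derivative]], of x, symmetric]
    by simp
  then show ?case using hom_poly_sum.add[OF add.IH] by simp
qed

lemma radial_times_has_derivative:
  fixes p :: "'a::real_inner \<Rightarrow> 'b::real_normed_vector"
  assumes f: "(f has_real_derivative f') (at (inner x x))" and p: "(p has_derivative p') (at x)"
  shows "((\<lambda>x. f (inner x x) *\<^sub>R p x) has_derivative
    (\<lambda>h. f (inner x x) *\<^sub>R p' h + (2 * f' * inner x h) *\<^sub>R p x)) (at x)"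
proof -
  have s: "((\<lambda>x. inner x x) has_derivative (\<lambda>h. 2 * inner x h)) (at x)"
    by (auto intro!: derivative_eq_intros simp: inner_commute)
  from has_derivative_compose[OF s] f
  have "((\<lambda>x. f (inner x x)) has_derivative (\<lambda>h. f' * (2 * inner x h))) (at x)"
    by (simp add: has_field_derivative_def)
  from has_derivative_scaleR[OF this p] show ?thesis by (simp add: mult_ac)
qed

text \<open>
  Differentiating such a product gives a sum of products of the same kind, so induction on the order
  of differentiation applies.
\<close>

lemma radial_times_smooth:
  assumes \<epsilon>: "\<epsilon> > 0" and f: "radial_profile \<epsilon> f" and p: "hom_poly_sum p"
  shows "smooth_on UNIV (\<lambda>x. f (inner x x) *\<^sub>R p x)"
proof -
  have "higher_differentiable_on UNIV (\<lambda>x. f (inner x x) *\<^sub>R p x) k" for k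
    using f p
  proof (induction k arbitrary: f p)
    case (0 f p)
    obtain f' where f': "\<And>s. (f has_real_derivative f' s) (at s)"
      using radial_profile_derivative[OF \<epsilon> 0(1)] by blast
    have "(\<lambda>x. f (inner x x) *\<^sub>R p x) differentiable (at x)" for x
      using radial_times_has_derivative[OF f' hom_poly_sum_has_derivative[OF 0(2)]]
      by (rule has_derivative_imp_differentiable)
    then show ?case
      by (auto intro!: continuous_at_imp_continuous_on differentiable_imp_continuous_within)
  next
    case (Suc k)
    obtain f' where f': "radial_profile \<epsilon> f'" "\<And>s. (f has_real_derivative f' s) (at s)"
      using radial_profile_derivative[OF \<epsilon> Suc(2)] by blast
    note D = radial_times_has_derivative[OF f'(2) hom_poly_sum_has_derivative[OF Suc.prems(2)]]
    have "higher_differentiable_on UNIV (\<lambda>x. frechet_derivative (\<lambda>x. f (inner x x) *\<^sub>R p x) (at x) v) k" for v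
    proof -
      have "frechet_derivative (\<lambda>x. f (inner x x) *\<^sub>R p x) (at x) v =
        f (inner x x) *\<^sub>R frechet_derivative p (at x) v + f' (inner x x) *\<^sub>R (\<Sum>i\<in>UNIV. (2 * v $ i) *\<^sub>R ((x $ i) *\<^sub>R p x))" for x
      proof -
        have "(\<Sum>i\<in>UNIV. (2 * v $ i) *\<^sub>R ((x $ i) *\<^sub>R p x)) = (\<Sum>i\<in>UNIV. 2 * v $ i * x $ i) *\<^sub>R p x"
          by (simp add: scaleR_sum_left)
        also have "(\<Sum>i\<in>UNIV. 2 * v $ i * x $ i) = 2 * inner x v"
          by (simp add: inner_vec_def sum_distrib_left mult_ac)
        finally show ?thesis
          using frechet_derivative_at[OF D, of x, symmetric] by (simp add: mult_ac)
      qed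
      moreover have "higher_differentiable_on UNIV (\<lambda>x. f (inner x x) *\<^sub>R frechet_derivative p (at x) v) k"
        using Suc.prems by (intro Suc.IH hom_poly_sum_deriv)
      moreover have "higher_differentiable_on UNIV (\<lambda>x. f' (inner x x) *\<^sub>R (\<Sum>i\<in>UNIV. (2 * v $ i) *\<^sub>R ((x $ i) *\<^sub>R p x))) k"
        by (intro Suc.IH f' hom_poly_sum_sum hom_poly_sum_scaleR hom_poly_sum_coord Suc.prems)
      ultimately show ?thesis by (simp add: higher_differentiable_on_add)
    qed
    then show ?case using has_derivative_imp_differentiable[OF D] by simp
  qed
  then show ?thesis by (simp add: smooth_on_def)
qed

section \<open>Monogenic polynomials\<close>

text \<open>
  These are the powers \<open>(x\<^sub>i + x\<^sub>k \<sigma>\<^sub>i \<sigma>\<^sub>k)\<^sup>d v\<close>. For \<open>i \<noteq> k\<close>, where \<open>(\<sigma>\<^sub>i \<sigma>\<^sub>k)\<^sup>2 = -1\<close>, they are the holomorphic powers in the plane of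
  the two coordinates, and the Dirac operator annihilates them.
\<close>

primrec plane_monogenic :: "('n \<Rightarrow> complex ^ 'm ^ 'm) \<Rightarrow> 'n \<Rightarrow> 'n \<Rightarrow> complex ^ 'm \<Rightarrow> nat \<Rightarrow> real ^ 'n \<Rightarrow> complex ^ 'm" where
  "plane_monogenic \<sigma> i k v 0 = (\<lambda>x. v)"
| "plane_monogenic \<sigma> i k v (Suc d) = (\<lambda>x. (x $ i) *\<^sub>R plane_monogenic \<sigma> i k v d x +
     (x $ k) *\<^sub>R (\<sigma> i *v (\<sigma> k *v plane_monogenic \<sigma> i k v d x)))"

lemma hom_poly_plane_monogenic: "hom_poly d (plane_monogenic \<sigma> i k v d)"
proof (induction d)
  case (Suc d)
  then show ?case
    unfolding plane_monogenic.simps by (intro hom_poly_add hom_poly_coord hom_poly_mv)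
qed auto

lemma scaleR_combine_step:
  fixes y z :: "'b::real_vector"
  shows "a *\<^sub>R (r *\<^sub>R y) + b *\<^sub>R (r *\<^sub>R z) + (a *\<^sub>R y + b *\<^sub>R z) = (r + 1) *\<^sub>R (a *\<^sub>R y + b *\<^sub>R z)"
  by (simp add: algebra_simps)

lemma plane_monogenic_pderiv:
  fixes \<sigma> :: "'n::{finite,linorder} \<Rightarrow> complex ^ 'm ^ 'm"
  assumes ik: "i \<noteq> k"
  shows "pderiv_at l (plane_monogenic \<sigma> i k v (Suc d)) x = real (Suc d) *\<^sub>R
    (if l = i then plane_monogenic \<sigma> i k v d x
     else if l = k then \<sigma> i *v (\<sigma> k *v plane_monogenic \<sigma> i k v d x) else 0)"
proof -
  let ?M = "plane_monogenic \<sigma> i k v"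
  have step: "pderiv_at l (?M (Suc d)) x = (x $ i) *\<^sub>R pderiv_at l (?M d) x + (x $ k) *\<^sub>R (\<sigma> i *v (\<sigma> k *v pderiv_at l (?M d) x))
      + (if l = i then ?M d x else if l = k then \<sigma> i *v (\<sigma> k *v ?M d x) else 0)" for d
  proof -
    note H = hom_poly_has_derivative[OF hom_poly_plane_monogenic, of \<sigma> i k v d x]
    have "((\<lambda>x. (x $ i) *\<^sub>R ?M d x + (x $ k) *\<^sub>R (\<sigma> i *v (\<sigma> k *v ?M d x))) has_derivative
      (\<lambda>h. ((x $ i) *\<^sub>R frechet_derivative (?M d) (at x) h + (h $ i) *\<^sub>R ?M d x) +
         ((x $ k) *\<^sub>R (\<sigma> i *v (\<sigma> k *v frechet_derivative (?M d) (at x) h)) + (h $ k) *\<^sub>R (\<sigma> i *v (\<sigma> k *v ?M d x))))) (at x)"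
      by (intro has_derivative_add has_derivative_scaleR bounded_linear.has_derivative[OF bounded_linear_mv] H
         bounded_linear_imp_has_derivative bounded_linear_vec_nth)
    from pderiv_at_eq[OF this, of l] show ?thesis
      using ik by (auto simp: axis_def pderiv_at_def)
  qed
  show ?thesis
  proof (induction d)
    case 0
    show ?case unfolding step by (simp add: pderiv_at_const mv_simps)
  next
    case (Suc d)
    have r: "real (Suc (Suc d)) = real (Suc d) + 1" by simp
    have J: "\<sigma> i *v (\<sigma> k *v (c *\<^sub>R y)) = c *\<^sub>R (\<sigma> i *v (\<sigma> k *v y))" for c :: real and y
      by (simp only: mv_simps)
    consider "l = i" | "l = k" "l \<noteq> i" | "l \<noteq> i" "l \<noteq> k" by blast
    then show ?case
    proof cases
      case 1
      then show ?thesis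
        unfolding step[of "Suc d"] Suc.IH r
        by (simp only: simp_thms if_True if_False J scaleR_combine_step plane_monogenic.simps(2))
    next
      case 2
      then show ?thesis
        unfolding step[of "Suc d"] Suc.IH r
        by (simp only: simp_thms if_True if_False J scaleR_combine_step plane_monogenic.simps(2) mv_simps)
    next
      case 3
      then show ?thesis
        unfolding step[of "Suc d"] Suc.IH r by (simp add: mv_simps)
    qed
  qed
qed

text \<open>
  A solution of the Dirac equation that is homogeneous of degree \<open>d\<close> satisfies \<open>L p = x D p - E p = - d p\<close>.
\<close>

lemma plane_monogenic_eigen:
  fixes \<sigma> :: "'n::{finite,linorder} \<Rightarrow> complex ^ 'm ^ 'm"
  assumes cl: "clifford_family \<sigma>" and ik: "i \<noteq> k"
  shows "angular_eigen \<sigma> (- int d) (plane_monogenic \<sigma> i k v d)"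
proof -
  have "dirac \<sigma> (plane_monogenic \<sigma> i k v d) x = 0" for x
  proof (cases d)
    case 0
    then show ?thesis by (simp add: dirac_def pderiv_at_const mv_simps)
  next
    case (Suc e)
    let ?p = "plane_monogenic \<sigma> i k v e x"
    have "dirac \<sigma> (plane_monogenic \<sigma> i k v d) x =
       (\<Sum>l\<in>UNIV. real (Suc e) *\<^sub>R ((if l = i then \<sigma> i *v ?p else 0) + (if l = k then \<sigma> k *v (\<sigma> i *v (\<sigma> k *v ?p)) else 0)))"
      unfolding dirac_def Suc plane_monogenic_pderiv[OF ik]
      by (intro sum.cong refl) (use ik in \<open>auto simp: mv_simps simp del: of_nat_Suc\<close>)
    also have "\<dots> = real (Suc e) *\<^sub>R (\<sigma> i *v ?p + \<sigma> k *v (\<sigma> i *v (\<sigma> k *v ?p)))"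
      by (simp add: scaleR_sum_right[symmetric] sum.distrib del: of_nat_Suc)
    also have "\<sigma> k *v (\<sigma> i *v (\<sigma> k *v ?p)) = - (\<sigma> i *v ?p)"
      using clifford_swap[OF cl ik, of "\<sigma> k *v ?p"] by (simp add: clifford_square[OF cl])
    finally show ?thesis by simp
  qed
  then have "real d *\<^sub>R plane_monogenic \<sigma> i k v d x + angular_diff \<sigma> (plane_monogenic \<sigma> i k v d) x = 0" for x
    using hom_poly_clifford_dirac[OF cl hom_poly_plane_monogenic[of d \<sigma> i k v], of x] by (simp add: clifford_mult_simps)
  then show ?thesis
    unfolding angular_eigen_def by (simp add: eq_neg_iff_add_eq_0 add.commute)
qed

text \<open>
  Monogenic polynomials serve the eigenvalues \<open>k \<le> 0\<close>; their products with \<open>x\<close> serve \<open>k \<ge> n - 1\<close>.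
\<close>

lemma exists_hom_poly_eigen:
  fixes \<sigma> :: "'n::{finite,linorder} \<Rightarrow> complex ^ 'm ^ 'm"
  assumes n: "CARD('n) \<ge> 2" and cl: "clifford_family \<sigma>" and k: "k \<notin> {1..int CARD('n) - 2}"
  obtains d \<phi> x where "hom_poly d \<phi>" "angular_eigen \<sigma> k \<phi>" "x \<noteq> 0" "\<phi> x \<noteq> 0"
proof -
  obtain i l :: 'n where il: "i \<noteq> l"
    using n by (metis One_nat_def Suc_1 card_le_Suc0_iff_eq finite not_less_eq_eq UNIV_I)
  define v :: "complex ^ 'm" where "v = (\<chi> _. 1)"
  have v: "v \<noteq> 0" by (simp add: v_def vec_eq_iff)
  have ax: "axis i (1::real) \<noteq> 0" by (simp add: axis_eq_0_iff)
  let ?M = "plane_monogenic \<sigma> i l v"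
  have Mi: "?M d (axis i 1) = v" for d
    using il by (induction d) (auto simp: axis_def)
  show ?thesis
  proof (cases "k \<le> 0")
    case True
    then have "- int (nat (- k)) = k" by simp
    then show ?thesis
      using that[OF hom_poly_plane_monogenic[of "nat (- k)" \<sigma> i l v], of "axis i 1"] plane_monogenic_eigen[OF cl il, of "nat (- k)" v]
      by (simp add: Mi v ax)
  next
    case False
    define d where "d = nat (k - int CARD('n) + 1)"
    have d: "int CARD('n) - 1 - k = - int d" using False k by (simp add: d_def)
    have "angular_eigen \<sigma> k (\<lambda>x. clifford_mult \<sigma> x (?M d x))"
      by (rule clifford_mult_eigen[OF cl hom_poly_plane_monogenic]) (simp only: d plane_monogenic_eigen[OF cl il])
    moreover have "clifford_mult \<sigma> (axis i 1) (?M d (axis i 1)) \<noteq> 0"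
      using clifford_square[OF cl, of i v] v by (auto simp: clifford_mult_axis Mi mv_simps)
    ultimately show ?thesis
      using that[OF hom_poly_clifford_mult[OF hom_poly_plane_monogenic]] ax by blast
  qed
qed

text \<open>
  Euler's identity says that \<open>s\<^sup>-\<^sup>d p(s x)\<close> has derivative \<open>0\<close> in \<open>s\<close>.
\<close>

lemma hom_poly_homogeneous:
  assumes p: "hom_poly d p" and s: "s > 0"
  shows "p (s *\<^sub>R x) = s ^ d *\<^sub>R p x"
proof -
  define f where "f s = inverse s ^ d *\<^sub>R p (s *\<^sub>R x)" for s :: real
  have "(f has_derivative (\<lambda>h. 0)) (at s within {0<..})" if "s > 0" for s
  proof -
    let ?D = "frechet_derivative p (at (s *\<^sub>R x))"
    have lin: "linear ?D" using has_derivative_linear[OF hom_poly_has_derivative[OF p]] .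
    have "((\<lambda>s. s *\<^sub>R x) has_derivative (\<lambda>h. h *\<^sub>R x)) (at s)" by (auto intro!: derivative_eq_intros)
    from has_derivative_compose[OF this hom_poly_has_derivative[OF p]]
    have 1: "((\<lambda>s. p (s *\<^sub>R x)) has_derivative (\<lambda>h. ?D (h *\<^sub>R x))) (at s)" .
    have 2: "((\<lambda>s. inverse s ^ d) has_derivative (\<lambda>h. - (real d * inverse s ^ (d + 1)) * h)) (at s)"
      using inverse_power_has_derivative[of s d] that unfolding has_field_derivative_def by blast
    have E: "?D (h *\<^sub>R x) = (h * inverse s * real d) *\<^sub>R p (s *\<^sub>R x)" for h
    proof -
      have "(h * inverse s) *\<^sub>R (s *\<^sub>R x) = h *\<^sub>R x" using that by simp
      then have "?D (h *\<^sub>R x) = (h * inverse s) *\<^sub>R ?D (s *\<^sub>R x)"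
        by (metis linear_scale[OF lin])
      then show ?thesis using hom_poly_euler[OF p, of "s *\<^sub>R x"] by (simp add: euler_def)
    qed
    have "(f has_derivative (\<lambda>h. 0)) (at s)"
      using has_derivative_scaleR[OF 2 1] unfolding f_def[abs_def] E by (simp add: mult_ac scaleR_add_left[symmetric])
    then show ?thesis by (rule has_derivative_at_withinI)
  qed
  from has_derivative_zero_constant[OF _ this] obtain c where c: "\<And>s. s > 0 \<Longrightarrow> f s = c" by auto
  have "f s = f 1" using c[OF s] c[of 1] by simp
  then have "s ^ d *\<^sub>R (inverse s ^ d *\<^sub>R p (s *\<^sub>R x)) = s ^ d *\<^sub>R p x" by (simp add: f_def)
  moreover have "s ^ d * inverse s ^ d = 1" using s by (simp add: power_mult_distrib[symmetric])
  ultimately show ?thesis by simp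
qed

section \<open>Orthogonality to the eigenspaces\<close>

lemma L2_inner_scale: "L2_inner M (\<lambda>x. c *s f x) g = c * L2_inner M f g"
  unfolding L2_inner_def integral_mult_right_zero[symmetric]
  by (simp add: sum_distrib_left mult_ac)

text \<open>
  Strong convergence in \<open>L\<^sup>2\<close> implies weak convergence. The estimate \<open>2 |a b| \<le> \<delta> a\<^sup>2 + b\<^sup>2 / \<delta>\<close> takes the
  place of the integral form of the Cauchy-Schwarz inequality.
\<close>

lemma L2_weak_tendsto:
  fixes v h :: "'a \<Rightarrow> complex ^ 'm"
  assumes v: "v \<in> L2 M" and h: "h \<in> L2 M" and F: "\<And>l. F l \<in> L2 M"
    and lim: "(\<lambda>l::nat. LINT x|M. (norm (F l x - h x))\<^sup>2) \<longlonglongrightarrow> 0"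
  shows "(\<lambda>l. LINT x|M. inner (v x) (F l x)) \<longlonglongrightarrow> (LINT x|M. inner (v x) (h x))"
proof (rule LIMSEQ_I)
  fix e :: real assume e: "e > 0"
  define V where "V = (LINT x|M. (norm (v x))\<^sup>2)"
  define \<delta> where "\<delta> = e / (2 * (V + 1))"
  have V: "V \<ge> 0" by (simp add: V_def)
  have \<delta>: "\<delta> > 0" using e V by (simp add: \<delta>_def)
  have dV: "\<delta> * V < e / 2" using e V by (simp add: \<delta>_def field_simps)
  have "\<delta> * (e / 2) > 0" using e \<delta> by simp
  from LIMSEQ_D[OF lim this] obtain N where N: "\<And>l. l \<ge> N \<Longrightarrow> (LINT x|M. (norm (F l x - h x))\<^sup>2) < \<delta> * (e / 2)"
    by force
  have [measurable]: "v \<in> borel_measurable M" "h \<in> borel_measurable M" "F l \<in> borel_measurable M" for l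
    using v h F by (auto simp: L2_def)
  have y: "integrable M (\<lambda>x. (norm (F l x - h x))\<^sup>2)" for l
  proof (rule Bochner_Integration.integrable_bound[of M "\<lambda>x. 2 * (norm (F l x))\<^sup>2 + 2 * (norm (h x))\<^sup>2"])
    show "integrable M (\<lambda>x. 2 * (norm (F l x))\<^sup>2 + 2 * (norm (h x))\<^sup>2)" using F[of l] h by (simp add: L2_def)
    show "AE x in M. norm ((norm (F l x - h x))\<^sup>2) \<le> norm (2 * (norm (F l x))\<^sup>2 + 2 * (norm (h x))\<^sup>2)"
    proof (rule AE_I2)
      fix x
      have "0 \<le> (norm (F l x + h x))\<^sup>2" by simp
      then have "(norm (F l x - h x))\<^sup>2 \<le> 2 * (norm (F l x))\<^sup>2 + 2 * (norm (h x))\<^sup>2"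
        by (simp add: power2_norm_eq_inner inner_add_left inner_add_right inner_diff_left inner_diff_right inner_commute)
      then show "norm ((norm (F l x - h x))\<^sup>2) \<le> norm (2 * (norm (F l x))\<^sup>2 + 2 * (norm (h x))\<^sup>2)" by simp
    qed
  qed measurable
  show "\<exists>N. \<forall>l\<ge>N. norm ((LINT x|M. inner (v x) (F l x)) - (LINT x|M. inner (v x) (h x))) < e"
  proof (intro exI[of _ N] allI impI)
    fix l assume l: "l \<ge> N"
    have "(LINT x|M. inner (v x) (F l x)) - (LINT x|M. inner (v x) (h x)) = (LINT x|M. inner (v x) (F l x - h x))"
      using L2_real_inner(1)[OF v F[of l]] L2_real_inner(1)[OF v h] by (simp add: inner_diff_right)
    also have "norm \<dots> \<le> (LINT x|M. \<delta> * (norm (v x))\<^sup>2 + (1 / \<delta>) * (norm (F l x - h x))\<^sup>2)"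
    proof (rule order_trans[OF integral_norm_bound integral_mono])
      show "integrable M (\<lambda>x. norm (inner (v x) (F l x - h x)))"
        using L2_real_inner(1)[OF v F[of l]] L2_real_inner(1)[OF v h] by (simp add: inner_diff_right)
      show "integrable M (\<lambda>x. \<delta> * (norm (v x))\<^sup>2 + (1 / \<delta>) * (norm (F l x - h x))\<^sup>2)"
        using v y[of l] by (simp add: L2_def)
      fix x
      let ?a = "norm (v x)" and ?b = "norm (F l x - h x)"
      have "norm (inner (v x) (F l x - h x)) \<le> ?a * ?b"
        using Cauchy_Schwarz_ineq2[of "v x" "F l x - h x"] by simp
      also have "?a * ?b \<le> 2 * (?a * ?b)" by simp
      also have "\<dots> \<le> \<delta> * ?a\<^sup>2 + (1 / \<delta>) * ?b\<^sup>2"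
      proof -
        have "0 \<le> (1 / \<delta>) * (\<delta> * ?a - ?b)\<^sup>2" using \<delta> by simp
        also have "(1 / \<delta>) * (\<delta> * ?a - ?b)\<^sup>2 = \<delta> * ?a\<^sup>2 + (1 / \<delta>) * ?b\<^sup>2 - 2 * (?a * ?b)"
          using \<delta> by (simp add: power2_eq_square field_simps)
        finally show ?thesis by simp
      qed
      finally show "norm (inner (v x) (F l x - h x)) \<le> \<delta> * ?a\<^sup>2 + (1 / \<delta>) * ?b\<^sup>2" .
    qed
    also have "\<dots> = \<delta> * V + (1 / \<delta>) * (LINT x|M. (norm (F l x - h x))\<^sup>2)"
      using v y[of l] by (simp add: L2_def V_def)
    also have "(1 / \<delta>) * (LINT x|M. (norm (F l x - h x))\<^sup>2) \<le> (1 / \<delta>) * (\<delta> * (e / 2))"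
      using N[OF l] \<delta> by (intro mult_left_mono) auto
    also have "(1 / \<delta>) * (\<delta> * (e / 2)) = e / 2" using \<delta> by simp
    finally show "norm ((LINT x|M. inner (v x) (F l x)) - (LINT x|M. inner (v x) (h x))) < e"
      using dV by simp
  qed
qed

text \<open>
  Elements of \<open>E\<^sub>j\<close> are known through approximations \<open>F\<^sub>l\<close> with \<open>F\<^sub>l \<rightarrow> h\<close> and \<open>L F\<^sub>l \<rightarrow> j h\<close>. As
  \<open>k \<langle>v, F\<^sub>l\<rangle> = \<langle>L v, F\<^sub>l\<rangle> = \<langle>v, L F\<^sub>l\<rangle>\<close>, the limit is \<open>k \<langle>v, h\<rangle> = j \<langle>v, h\<rangle>\<close>.
\<close>

lemma eigen_orthogonal_eigenspace:
  fixes \<sigma> :: "'n::{finite,linorder} \<Rightarrow> complex ^ 'm ^ 'm"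
  assumes cl: "clifford_family \<sigma>" and v: "C1_off v" "\<And>x. angular_diff \<sigma> v x = of_int k *\<^sub>R v x"
    and h: "h \<in> eigenspace \<sigma> j" and "k \<noteq> j"
  shows "(LINT \<omega>|sphere_measure. inner (v \<omega>) (h \<omega>)) = 0"
proof -
  let ?I = "\<lambda>f. LINT \<omega>|sphere_measure. inner (v \<omega>) (f \<omega>)"
  obtain F where hL: "h \<in> L2 sphere_measure" "(\<lambda>\<omega>. of_int j *\<^sub>R h \<omega>) \<in> L2 sphere_measure"
    and F: "\<And>l. smooth_on (- {0}) (F l)"
    and lim: "(\<lambda>l::nat. LINT \<omega>|sphere_measure. (norm (F l \<omega> - h \<omega>))\<^sup>2) \<longlonglongrightarrow> 0"
      "(\<lambda>l. LINT \<omega>|sphere_measure. (norm (angular_diff \<sigma> (F l) \<omega> - of_int j *\<^sub>R h \<omega>))\<^sup>2) \<longlonglongrightarrow> 0"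
    using h unfolding eigenspace_def angular_op_def by blast
  note FC = C1_off_smooth[OF F]
  have vL: "v \<in> L2 sphere_measure"
    by (intro continuous_on_sphere_L2 continuous_on_sphere_off C1_off_continuous v)
  have FL: "F l \<in> L2 sphere_measure" "angular_diff \<sigma> (F l) \<in> L2 sphere_measure" for l
    by (intro continuous_on_sphere_L2 continuous_on_sphere_off C1_off_continuous FC continuous_on_angular_diff)+
  have "?I (angular_diff \<sigma> (F l)) = of_int k * ?I (F l)" for l
    using angular_diff_symmetric[OF cl v(1) FC, of l] by (simp add: v(2))
  then have "(\<lambda>l. of_int k * ?I (F l)) \<longlonglongrightarrow> ?I (\<lambda>\<omega>. of_int j *\<^sub>R h \<omega>)"
    using L2_weak_tendsto[OF vL hL(2) FL(2) lim(2)] by simp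
  moreover have "(\<lambda>l. of_int k * ?I (F l)) \<longlonglongrightarrow> of_int k * ?I h"
    by (intro tendsto_intros L2_weak_tendsto[OF vL hL(1) FL(1) lim(1)])
  ultimately have "?I (\<lambda>\<omega>. of_int j *\<^sub>R h \<omega>) = of_int k * ?I h"
    using LIMSEQ_unique by blast
  then show ?thesis using \<open>k \<noteq> j\<close> by simp
qed

section \<open>Sharpness\<close>

definition separated :: "real \<Rightarrow> real \<Rightarrow> (real ^ 'n \<Rightarrow> complex ^ 'm) \<Rightarrow> real ^ 'n \<Rightarrow> complex ^ 'm" where
  "separated \<epsilon> a \<phi> x = log_bump \<epsilon> a 0 0 (inner x x) *\<^sub>R \<phi> x"

lemma log_bump_inner_eq_0:
  assumes \<epsilon>: "\<epsilon> > 0" and x: "norm x < exp (- 1 / (2 * \<epsilon>)) \<or> norm x > exp (1 / (2 * \<epsilon>))"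
  shows "log_bump \<epsilon> a q m (inner x x) = 0"
proof (rule log_bump_eq_0[OF \<epsilon>])
  have 1: "exp (- 1 / \<epsilon>) = (exp (- 1 / (2 * \<epsilon>)))\<^sup>2" "exp (1 / \<epsilon>) = (exp (1 / (2 * \<epsilon>)))\<^sup>2"
    by (simp_all add: exp_double[symmetric])
  show "inner x x < exp (- 1 / \<epsilon>) \<or> inner x x > exp (1 / \<epsilon>)"
    unfolding 1 power2_norm_eq_inner[symmetric]
    using x by (auto intro: power_strict_mono)
qed

lemma separated_test_function:
  fixes \<phi> :: "real ^ 'n \<Rightarrow> complex ^ 'm"
  assumes \<epsilon>: "\<epsilon> > 0" and \<phi>: "hom_poly d \<phi>"
  shows "separated \<epsilon> a \<phi> \<in> test_functions"
proof -
  define K where "K = cball (0 :: real ^ 'n) (exp (1 / (2 * \<epsilon>))) - ball 0 (exp (- 1 / (2 * \<epsilon>)))"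
  have K: "compact K" "0 \<notin> K" unfolding K_def by (auto intro!: compact_diff)
  have "{x. separated \<epsilon> a \<phi> x \<noteq> 0} \<subseteq> K"
    using log_bump_inner_eq_0[OF \<epsilon>, of _ a 0 0] by (force simp: K_def separated_def)
  then have sub: "closure {x. separated \<epsilon> a \<phi> x \<noteq> 0} \<subseteq> K"
    using K compact_imp_closed by (intro closure_minimal) auto
  then have "compact (closure {x. separated \<epsilon> a \<phi> x \<noteq> 0})"
    using compact_Int_closed[OF K(1) closed_closure] by (metis inf.absorb_iff2)
  moreover have "smooth_on UNIV (separated \<epsilon> a \<phi>)"
    unfolding separated_def[abs_def]
    by (intro radial_times_smooth[OF \<epsilon>] radial_profile.base hom_poly_sum.hom[OF \<phi>])
  ultimately show ?thesis using sub K by (auto simp: test_functions_def)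
qed

lemma separated_has_derivative:
  assumes \<epsilon>: "\<epsilon> > 0" and \<phi>: "hom_poly d \<phi>"
  shows "(separated \<epsilon> a \<phi> has_derivative (\<lambda>h. log_bump \<epsilon> a 0 0 (inner x x) *\<^sub>R frechet_derivative \<phi> (at x) h +
    (2 * (a * log_bump \<epsilon> (a - 1) 0 0 (inner x x) - 2 * \<epsilon>\<^sup>2 * log_bump \<epsilon> (a - 1) 1 2 (inner x x)) * inner x h) *\<^sub>R \<phi> x)) (at x)"
  using radial_times_has_derivative[OF log_bump_has_derivative[OF \<epsilon>, of a 0 0 "inner x x"] hom_poly_has_derivative[OF \<phi>]]
  unfolding separated_def[abs_def] by (simp add: numeral_2_eq_2)

lemma angular_diff_separated:
  assumes \<epsilon>: "\<epsilon> > 0" and \<phi>: "hom_poly d \<phi>" "angular_eigen \<sigma> k \<phi>"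
  shows "angular_diff \<sigma> (separated \<epsilon> a \<phi>) x = of_int k *\<^sub>R separated \<epsilon> a \<phi> x"
proof -
  have "inner x ((x $ i) *\<^sub>R axis l 1 - (x $ l) *\<^sub>R axis i 1) = 0" for i l
    by (simp add: inner_diff_right inner_axis)
  then have "angular_diff \<sigma> (separated \<epsilon> a \<phi>) x = log_bump \<epsilon> a 0 0 (inner x x) *\<^sub>R angular_diff \<sigma> \<phi> x"
    unfolding angular_diff_directional[OF separated_has_derivative[OF \<epsilon> \<phi>(1)]]
      angular_diff_directional[OF hom_poly_has_derivative[OF \<phi>(1)]]
    by (simp add: mv_simps scaleR_sum_right)
  then show ?thesis using \<phi>(2) by (simp add: angular_eigen_def separated_def)
qed

text \<open>
  With this exponent \<open>a\<close> the power of \<open>|x|\<close> is annihilated by \<open>E + t\<close>, so the derivative falls on the bump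
  and produces the small factor \<open>\<epsilon>\<close>.
\<close>

lemma euler_separated:
  assumes \<epsilon>: "\<epsilon> > 0" and \<phi>: "hom_poly d \<phi>" and a: "a = - (t + real d) / 2"
  shows "euler (separated \<epsilon> a \<phi>) x + t *\<^sub>R separated \<epsilon> a \<phi> x =
    (- 4 * \<epsilon>\<^sup>2 * (inner x x * log_bump \<epsilon> (a - 1) 1 2 (inner x x))) *\<^sub>R \<phi> x"
proof -
  let ?s = "inner x x"
  have s: "?s * log_bump \<epsilon> (a - 1) 0 0 ?s = log_bump \<epsilon> a 0 0 ?s"
    by (auto simp: log_bump_def powr_diff)
  have "frechet_derivative \<phi> (at x) x = real d *\<^sub>R \<phi> x"
    using hom_poly_euler[OF \<phi>, of x] by (simp add: euler_def)
  then have "euler (separated \<epsilon> a \<phi>) x + t *\<^sub>R separated \<epsilon> a \<phi> x =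
     (log_bump \<epsilon> a 0 0 ?s * real d + 2 * (a * log_bump \<epsilon> (a - 1) 0 0 ?s - 2 * \<epsilon>\<^sup>2 * log_bump \<epsilon> (a - 1) 1 2 ?s) * ?s
       + t * log_bump \<epsilon> a 0 0 ?s) *\<^sub>R \<phi> x"
    by (simp add: euler_eq[OF separated_has_derivative[OF \<epsilon> \<phi>]] scaleR_add_left separated_def)
  also have "log_bump \<epsilon> a 0 0 ?s * real d + 2 * (a * log_bump \<epsilon> (a - 1) 0 0 ?s - 2 * \<epsilon>\<^sup>2 * log_bump \<epsilon> (a - 1) 1 2 ?s) * ?s
       + t * log_bump \<epsilon> a 0 0 ?s =
     (real d + t + 2 * a) * log_bump \<epsilon> a 0 0 ?s - 4 * \<epsilon>\<^sup>2 * (?s * log_bump \<epsilon> (a - 1) 1 2 ?s)"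
    unfolding s[symmetric] by (simp add: algebra_simps)
  also have "real d + t + 2 * a = 0" by (simp add: a field_simps)
  finally show ?thesis by simp
qed

text \<open>
  Eigenfunctions for distinct eigenvalues are orthogonal in the real inner product. Applying this to
  the eigenfunction multiplied by \<open>-\<i>\<close> as well gives orthogonality in the complex one.
\<close>

lemma separated_angular_proj:
  fixes \<sigma> :: "'n::{finite,linorder} \<Rightarrow> complex ^ 'm ^ 'm"
  assumes cl: "clifford_family \<sigma>" and \<epsilon>: "\<epsilon> > 0" and \<phi>: "hom_poly d \<phi>" "angular_eigen \<sigma> k \<phi>" and "k \<noteq> j"
  shows "is_angular_proj \<sigma> j (separated \<epsilon> a \<phi>) (\<lambda>_. 0)"
proof -
  let ?u = "separated \<epsilon> a \<phi>"
  have orth: "(LINT \<omega>|sphere_measure. inner (separated \<epsilon> a \<psi> (r *\<^sub>R \<omega>)) (h \<omega>)) = 0"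
    if \<psi>: "hom_poly d \<psi>" "angular_eigen \<sigma> k \<psi>" and h: "h \<in> eigenspace \<sigma> j" and r: "r > 0" for \<psi> h and r :: real
  proof (rule eigen_orthogonal_eigenspace[OF cl _ _ h \<open>k \<noteq> j\<close>])
    show "C1_off (\<lambda>\<omega>. separated \<epsilon> a \<psi> (r *\<^sub>R \<omega>))"
      using r by (intro C1_off_dilation test_function_C1_off separated_test_function[OF \<epsilon> \<psi>(1)]) auto
    show "angular_diff \<sigma> (\<lambda>\<omega>. separated \<epsilon> a \<psi> (r *\<^sub>R \<omega>)) x = of_int k *\<^sub>R separated \<epsilon> a \<psi> (r *\<^sub>R x)" for x
      by (subst angular_diff_dilation)
        (auto simp: angular_diff_separated[OF \<epsilon> \<psi>] intro: has_derivative_imp_differentiable[OF separated_has_derivative[OF \<epsilon> \<psi>(1)]])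
  qed
  \<comment> \<open>\<open>Im z = Re (- \<i> z)\<close>\<close>
  define c where "c = - \<i>"
  have bl: "bounded_linear (\<lambda>v :: complex ^ 'm. c *s v)"
    by (rule linear_conv_bounded_linear[THEN iffD1], rule linearI) (simp_all add: vec_eq_iff algebra_simps)
  define \<psi> where "\<psi> x = c *s \<phi> x" for x
  have \<psi>: "hom_poly d \<psi>" unfolding \<psi>_def[abs_def] by (rule hom_poly_bounded_linear[OF bl \<phi>(1)])
  have "angular_diff \<sigma> \<psi> x = c *s angular_diff \<sigma> \<phi> x" for x
    unfolding \<psi>_def[abs_def]
      angular_diff_directional[OF bounded_linear.has_derivative[OF bl hom_poly_has_derivative[OF \<phi>(1)]]]
      angular_diff_directional[OF hom_poly_has_derivative[OF \<phi>(1)]]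
    by (simp add: linear_sum[OF bounded_linear.linear[OF bl]] vector_scalar_commute)
  then have \<psi>': "angular_eigen \<sigma> k \<psi>"
    using \<phi>(2) by (simp add: angular_eigen_def \<psi>_def linear_scale[OF bounded_linear.linear[OF bl]])
  have uc: "continuous_on S ?u" for S
    using separated_test_function[OF \<epsilon> \<phi>(1), of a] by (auto simp: test_functions_def intro: smooth_on_continuous)
  have zero: "(\<lambda>_. 0) \<in> eigenspace \<sigma> j"
    by (rule angular_eigen_eigenspace[OF hom_poly_smooth[OF hom_poly_zero]]) (simp add: angular_eigen_def angular_diff_const)
  have op: "is_orth_proj sphere_measure (eigenspace \<sigma> j) (\<lambda>\<omega>. ?u (r *\<^sub>R \<omega>)) (\<lambda>\<omega>. 0)" if r: "r > 0" for r :: real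
  proof -
    have uL: "(\<lambda>\<omega>. ?u (r *\<^sub>R \<omega>)) \<in> L2 sphere_measure"
      by (rule continuous_on_sphere_L2) (auto intro!: continuous_on_compose2[OF uc[of UNIV]] continuous_intros)
    have uL': "(\<lambda>\<omega>. c *s ?u (r *\<^sub>R \<omega>)) \<in> L2 sphere_measure"
      by (rule continuous_on_sphere_L2)
        (auto intro!: bounded_linear.continuous_on[OF bl] continuous_on_compose2[OF uc[of UNIV]] continuous_intros)
    have "L2_inner sphere_measure (\<lambda>\<omega>. ?u (r *\<^sub>R \<omega>)) h = 0" if h: "h \<in> eigenspace \<sigma> j" for h
    proof (rule complex_eqI)
      have hL: "h \<in> L2 sphere_measure" using h by (auto simp: eigenspace_def angular_op_def)
      show "Re (L2_inner sphere_measure (\<lambda>\<omega>. ?u (r *\<^sub>R \<omega>)) h) = Re 0"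
        using orth[OF \<phi> h r] by (simp add: L2_real_inner(2)[OF uL hL])
      have "Im (L2_inner sphere_measure (\<lambda>\<omega>. ?u (r *\<^sub>R \<omega>)) h) = Re (L2_inner sphere_measure (\<lambda>\<omega>. c *s ?u (r *\<^sub>R \<omega>)) h)"
        by (simp only: L2_inner_scale) (simp add: c_def)
      also have "\<dots> = (LINT \<omega>|sphere_measure. inner (separated \<epsilon> a \<psi> (r *\<^sub>R \<omega>)) (h \<omega>))"
        unfolding L2_real_inner(2)[OF uL' hL]
        by (simp only: separated_def \<psi>_def linear_scale[OF bounded_linear.linear[OF bl]])
      also have "\<dots> = 0" by (rule orth[OF \<psi> \<psi>' h r])
      finally show "Im (L2_inner sphere_measure (\<lambda>\<omega>. ?u (r *\<^sub>R \<omega>)) h) = Im 0" by simp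
    qed
    then show ?thesis using uL zero by (simp add: is_orth_proj_def)
  qed
  obtain K where K: "compact K" "0 \<notin> K" "\<And>x. x \<notin> K \<Longrightarrow> ?u x = 0"
    using test_function_support[OF separated_test_function[OF \<epsilon> \<phi>(1)]] by metis
  have "integrable lborel (\<lambda>x. (norm (?u x))\<^sup>2)"
    by (rule integrable_extend_zero[OF K(1,2)]) (auto intro!: continuous_intros uc simp: K(3))
  moreover have "?u \<in> borel_measurable lborel"
    using borel_measurable_continuous_onI[OF uc] by simp
  ultimately show ?thesis using op by (simp add: is_angular_proj_def L2_def)
qed

text \<open>
  The density \<open>g\<close> is homogeneous of degree \<open>-n\<close>, so its integral over an annulus depends on the ratio of
  the radii only. This replaces the integral of \<open>dr / r\<close>.
\<close>

lemma hom_poly_annulus_integral: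
  fixes \<phi> :: "real ^ 'n::finite \<Rightarrow> complex ^ 'm"
  assumes \<phi>: "hom_poly d \<phi>" and nz: "x0 \<noteq> 0" "\<phi> x0 \<noteq> 0" and \<rho>: "\<rho> > 1"
  defines "g \<equiv> \<lambda>x. norm x powr (- real CARD('n) - 2 * real d) * (norm (\<phi> x))\<^sup>2"
  defines "A \<equiv> \<lambda>\<alpha>. {x :: real ^ 'n::finite. \<alpha> \<le> norm x \<and> norm x \<le> \<alpha> * \<rho>}"
  shows "\<alpha> > 0 \<Longrightarrow> integrable lborel (\<lambda>x. indicator (A \<alpha>) x * g x)"
    and "\<alpha> > 0 \<Longrightarrow> (LINT x|lborel. indicator (A \<alpha>) x * g x) = (LINT x|lborel. indicator (A 1) x * g x)"
    and "(LINT x|lborel. indicator (A 1) x * g x) > 0"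
proof -
  have gc: "continuous_on (- {0}) g"
    unfolding g_def by (auto intro!: continuous_intros hom_poly_continuous[OF \<phi>])
  have int: "integrable lborel (\<lambda>x. indicator (A \<alpha>) x * g x)" if "\<alpha> > 0" for \<alpha>
  proof -
    have "A \<alpha> = cball 0 (\<alpha> * \<rho>) - ball 0 \<alpha>" by (auto simp: A_def)
    then have "compact (A \<alpha>)" by (simp add: compact_diff)
    moreover have "continuous_on (A \<alpha>) g"
      using that by (intro continuous_on_subset[OF gc]) (auto simp: A_def)
    ultimately show ?thesis using borel_integrable_compact[of "A \<alpha>" g] by simp
  qed
  then show "\<alpha> > 0 \<Longrightarrow> integrable lborel (\<lambda>x. indicator (A \<alpha>) x * g x)" .
  show "(LINT x|lborel. indicator (A \<alpha>) x * g x) = (LINT x|lborel. indicator (A 1) x * g x)" if \<alpha>: "\<alpha> > 0"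
  proof -
    have "(\<lambda>x. indicator (A \<alpha>) x * g x) \<in> borel_measurable borel"
      using borel_measurable_integrable[OF int[OF \<alpha>]] by simp
    from integral_dilation[OF this \<alpha>]
    have "(LINT x|lborel. indicator (A \<alpha>) x * g x) =
       \<alpha> ^ CARD('n) * (LINT x|lborel. indicator (A \<alpha>) (\<alpha> *\<^sub>R x) * g (\<alpha> *\<^sub>R x))" by simp
    also have "(\<lambda>x. indicator (A \<alpha>) (\<alpha> *\<^sub>R x) * g (\<alpha> *\<^sub>R x)) =
       (\<lambda>x. (\<alpha> powr (- real CARD('n))) * (indicator (A 1) x * g x))"
    proof
      fix x :: "real ^ 'n::finite"
      have "\<alpha> *\<^sub>R x \<in> A \<alpha> \<longleftrightarrow> x \<in> A 1" using \<alpha> by (simp add: A_def)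
      then have "indicator (A \<alpha>) (\<alpha> *\<^sub>R x) = (indicator (A 1) x :: real)" by (simp add: indicator_def)
      moreover have "g (\<alpha> *\<^sub>R x) = \<alpha> powr (- real CARD('n)) * g x"
      proof -
        have "g (\<alpha> *\<^sub>R x) = (\<alpha> powr (- real CARD('n) - 2 * real d) * (\<alpha> ^ d)\<^sup>2) * g x"
          using \<alpha> by (simp add: g_def hom_poly_homogeneous[OF \<phi> \<alpha>] powr_mult power_mult_distrib)
        also have "(\<alpha> ^ d)\<^sup>2 = \<alpha> powr (2 * real d)"
          using powr_realpow[OF \<alpha>, of "d * 2"] by (simp add: power_mult mult.commute)
        finally show ?thesis by (simp add: powr_add[symmetric])
      qed
      ultimately show "indicator (A \<alpha>) (\<alpha> *\<^sub>R x) * g (\<alpha> *\<^sub>R x) = \<alpha> powr (- real CARD('n)) * (indicator (A 1) x * g x)"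
        by simp
    qed
    also have "\<alpha> ^ CARD('n) * (LINT x|lborel. \<alpha> powr (- real CARD('n)) * (indicator (A 1) x * g x)) =
      (\<alpha> powr real CARD('n) * \<alpha> powr (- real CARD('n))) * (LINT x|lborel. indicator (A 1) x * g x)"
      using \<alpha> by (simp add: powr_realpow)
    also have "\<alpha> powr real CARD('n) * \<alpha> powr (- real CARD('n)) = 1"
      using \<alpha> by (simp add: powr_add[symmetric])
    finally show ?thesis by simp
  qed
  have nonneg: "0 \<le> indicator (A 1) x * g x" for x by (simp add: g_def)
  show "(LINT x|lborel. indicator (A 1) x * g x) > 0"
  proof (rule ccontr)
    assume "\<not> ?thesis"
    moreover have "0 \<le> (LINT x|lborel. indicator (A 1) x * g x)"
      by (intro Bochner_Integration.integral_nonneg nonneg)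
    ultimately have "(LINT x|lborel. indicator (A 1) x * g x) = 0" by linarith
    then have ae: "AE x in lborel. indicator (A 1) x * g x = 0"
      using integral_nonneg_eq_0_iff_AE[OF int[of 1]] nonneg by simp
    \<comment> \<open>an open set on which \<open>g\<close> is positive; if it is null, it is empty, but it meets the ray through \<open>x0\<close>\<close>
    define N where "N = {x. 1 < norm x \<and> norm x < \<rho> \<and> \<phi> x \<noteq> 0}"
    have "open N"
    proof -
      have "open {x. \<phi> x \<noteq> 0}"
        using open_vimage[OF _ hom_poly_continuous[OF \<phi>], of "- {0}"] by (simp add: vimage_def open_Compl)
      moreover have "open {x :: real ^ 'n::finite. 1 < norm x}" "open {x :: real ^ 'n::finite. norm x < \<rho>}"
        by (intro open_Collect_less continuous_intros)+
      moreover have "N = {x. 1 < norm x} \<inter> ({x. norm x < \<rho>} \<inter> {x. \<phi> x \<noteq> 0})" by (auto simp: N_def)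
      ultimately show ?thesis by auto
    qed
    have "AE x in lborel. x \<notin> N"
      using ae by eventually_elim (auto simp: N_def A_def g_def)
    then have "emeasure lborel N = 0"
      using \<open>open N\<close> by (subst (asm) AE_iff_measurable[OF _ refl]) auto
    then have "negligible N"
      using \<open>open N\<close> by (simp add: negligible_iff_null_sets null_sets_def emeasure_completion)
    then have N: "N = {}" using open_not_negligible[OF \<open>open N\<close>] by blast
    define s where "s = (1 + \<rho>) / 2 / norm x0"
    have s: "s > 0" using nz \<rho> by (simp add: s_def)
    have "norm (s *\<^sub>R x0) = (1 + \<rho>) / 2" using nz \<rho> by (simp add: s_def)
    moreover have "\<phi> (s *\<^sub>R x0) \<noteq> 0" using nz s by (simp add: hom_poly_homogeneous[OF \<phi> s])
    ultimately have "s *\<^sub>R x0 \<in> N" using \<rho> by (simp add: N_def)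
    then show False using N by simp
  qed
qed

lemma bump_tail_0_ge:
  assumes "\<bar>y\<bar> \<le> 1 / 2"
  shows "exp (- 4 / 3) \<le> bump_tail 0 (1 - y\<^sup>2)"
proof -
  have "y\<^sup>2 \<le> (1 / 2)\<^sup>2" using assms by (intro power2_le_iff_abs_le[THEN iffD2]) auto
  then have "3 / 4 \<le> 1 - y\<^sup>2" by (simp add: power2_eq_square)
  then have "inverse (1 - y\<^sup>2) \<le> inverse (3 / 4)" by (intro le_imp_inverse_le) auto
  then show ?thesis using \<open>3 / 4 \<le> 1 - y\<^sup>2\<close> by (simp add: bump_tail_def)
qed

lemma bump_tail_2_bounds: "0 \<le> bump_tail 2 y" "bump_tail 2 y \<le> 2"
proof -
  show "0 \<le> bump_tail 2 y" by (simp add: bump_tail_def)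
  show "bump_tail 2 y \<le> 2"
  proof (cases "y > 0")
    case True
    let ?z = "inverse y"
    have "?z > 0" using True by simp
    then have "?z\<^sup>2 \<le> 2 * exp ?z" using exp_lower_Taylor_quadratic[of ?z] by linarith
    then show ?thesis using True by (simp add: bump_tail_def exp_minus field_simps)
  qed (simp add: bump_tail_def)
qed

text \<open>
  Let \<open>u = r\<^sup>-\<^sup>t \<eta>(\<epsilon> ln r\<^sup>2)\<close> times an eigenfunction on the sphere with eigenvalue \<open>k\<close>, \<open>|k - j| = 1\<close>, \<open>t = j\<close> and
  \<open>\<eta>(y) = exp(-1 / (1 - y\<^sup>2))\<close> for \<open>|y| < 1\<close>. The energy identity turns the assumption into
  \<open>(C - 1) \<integral> |x|\<^sup>c |u|\<^sup>2 dx \<le> \<integral> |x|\<^sup>c |(E + t) u|\<^sup>2 dx\<close>. With \<open>\<rho> = exp(1 / (4 \<epsilon>))\<close>, the left integral is bounded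
  below on the annulus \<open>1 \<le> |x| \<le> \<rho>\<close>. The right one lives on \<open>\<rho>\<^sup>-\<^sup>2 \<le> |x| \<le> \<rho>\<^sup>2\<close>, a union of four annuli of
  equal mass, and carries a factor \<open>\<epsilon>\<^sup>2\<close>. Hence \<open>C > 1\<close> is impossible for small \<open>\<epsilon>\<close>.
\<close>

theorem dirac_hardy_sharp:
  fixes \<sigma> :: "'n::{finite,linorder} \<Rightarrow> complex ^ 'm ^ 'm" and c C :: real
  assumes n: "CARD('n) \<ge> 2" and cl: "clifford_family \<sigma>" and j: "j \<notin> {1..int CARD('n) - 2}"
    and jc: "2 * of_int j = real CARD('n) + c"
    and C: "\<And>u. u \<in> test_functions \<Longrightarrow> is_angular_proj \<sigma> j u (\<lambda>_. 0) \<Longrightarrow>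
      C * (LINT x|lborel. norm x powr c * (norm (u x))\<^sup>2) \<le>
      (LINT x|lborel. norm x powr (c + 2) * (norm (dirac \<sigma> u x))\<^sup>2)"
  shows "C \<le> 1"
proof -
  \<comment> \<open>for \<open>j \<le> 0\<close> the eigenvalue below \<open>j\<close>, otherwise \<open>j \<ge> n - 1\<close> and the eigenvalue above it exists\<close>
  define k where "k = (if j \<le> 0 then j - 1 else j + 1)"
  have k: "k \<notin> {1..int CARD('n) - 2}" "k \<noteq> j" "(real_of_int k - real_of_int j)\<^sup>2 = 1"
    using j by (auto simp: k_def)
  obtain d \<phi> x0 where \<phi>: "hom_poly d \<phi>" "angular_eigen \<sigma> k \<phi>" "x0 \<noteq> 0" "\<phi> x0 \<noteq> 0"
    using exists_hom_poly_eigen[OF n cl k(1)] by metis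
  define t where "t = real_of_int j"
  define a where "a = - (t + real d) / 2"
  define g where "g x = norm x powr (- real CARD('n) - 2 * real d) * (norm (\<phi> x))\<^sup>2" for x
  have key: "(C - 1) * (exp (- 4 / 3))\<^sup>2 \<le> 256 * \<epsilon>\<^sup>2" if \<epsilon>: "\<epsilon> > 0" and "C > 1" for \<epsilon>
  proof -
    define \<rho> where "\<rho> = exp (1 / (4 * \<epsilon>))"
    have \<rho>: "\<rho> > 1" using \<epsilon> by (simp add: \<rho>_def)
    have \<rho>2: "\<rho>\<^sup>2 = exp (1 / (2 * \<epsilon>))" "inverse (\<rho>\<^sup>2) = exp (- 1 / (2 * \<epsilon>))"
      using \<epsilon> by (simp_all add: \<rho>_def exp_double[symmetric] exp_minus[symmetric])
    define A where "A \<alpha> = {x :: real ^ 'n::{finite,linorder}. \<alpha> \<le> norm x \<and> norm x \<le> \<alpha> * \<rho>}" for \<alpha>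
    define J where "J = (LINT x|lborel. indicator (A 1) x * g x)"
    note bounds = hom_poly_annulus_integral[OF \<phi>(1,3,4) \<rho>, folded g_def A_def, folded J_def]
    let ?u = "separated \<epsilon> a \<phi>"
    let ?w = "\<lambda>x. norm x powr c"
    let ?Y = "\<lambda>x. euler ?u x + t *\<^sub>R ?u x"
    have test: "?u \<in> test_functions" by (rule separated_test_function[OF \<epsilon> \<phi>(1)])
    obtain K where K: "compact K" "0 \<notin> K" and u0: "\<And>x. x \<notin> K \<Longrightarrow> ?u x = 0"
      using test_function_support[OF test] by metis
    note uC = test_function_C1_off[OF test]
    have E0: "euler ?u x = 0" if "x \<notin> K" for x
      using that K by (intro euler_zero_outside[of K] u0 compact_imp_closed)
    have iu: "integrable lborel (\<lambda>x. ?w x * (norm (?u x))\<^sup>2)"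
      by (rule integrable_extend_zero[OF K]) (auto intro!: continuous_intros C1_off_continuous[OF uC] simp: u0)
    have iY: "integrable lborel (\<lambda>x. ?w x * (norm (?Y x))\<^sup>2)"
      by (rule integrable_extend_zero[OF K])
        (auto intro!: continuous_intros C1_off_continuous[OF uC] continuous_on_euler[OF uC] simp: u0 E0)
    have weight: "norm x powr c * (inner x x powr a * r)\<^sup>2 * (norm (\<phi> x))\<^sup>2 = r\<^sup>2 * g x" if "x \<noteq> 0" for x r
    proof -
      have "inner x x = norm x powr 2" using that by (simp add: power2_norm_eq_inner)
      then have "inner x x powr a = norm x powr (2 * a)" by (simp only: powr_powr)
      then have "norm x powr c * (inner x x powr a)\<^sup>2 = norm x powr (c + 2 * a + 2 * a)"
        by (simp only: power2_eq_square powr_add mult.assoc)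
      also have "c + 2 * a + 2 * a = - real CARD('n) - 2 * real d"
        using jc by (simp add: a_def t_def field_simps)
      finally have "norm x powr c * (inner x x powr a)\<^sup>2 = norm x powr (- real CARD('n) - 2 * real d)" .
      then show ?thesis by (simp add: g_def power_mult_distrib mult_ac)
    qed
    have lnx: "ln (inner x x) = 2 * ln (norm x)" if "x \<noteq> 0" for x :: "real ^ 'n::{finite,linorder}"
      using that by (simp add: power2_norm_eq_inner[symmetric] ln_realpow)
    have energy: "(LINT x|lborel. norm x powr (c + 2) * (norm (dirac \<sigma> ?u x))\<^sup>2) =
      (LINT x|lborel. ?w x * (norm (?Y x))\<^sup>2) + (LINT x|lborel. ?w x * (norm (?u x))\<^sup>2)"
    proof -
      have "(norm (angular_diff \<sigma> ?u x - t *\<^sub>R ?u x))\<^sup>2 = (norm (?u x))\<^sup>2" for x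
      proof -
        have "angular_diff \<sigma> ?u x - t *\<^sub>R ?u x = (of_int k - of_int j) *\<^sub>R ?u x"
          by (simp add: angular_diff_separated[OF \<epsilon> \<phi>(1,2)] t_def scaleR_left_diff_distrib)
        then show ?thesis using k(3) by (simp add: power_mult_distrib)
      qed
      then show ?thesis
        using weighted_energy_identity[OF cl K uC u0, of t c] jc by (simp add: t_def)
    qed
    have lower: "(exp (- 4 / 3))\<^sup>2 * J \<le> (LINT x|lborel. ?w x * (norm (?u x))\<^sup>2)"
    proof -
      have "(exp (- 4 / 3))\<^sup>2 * J = (LINT x|lborel. (exp (- 4 / 3))\<^sup>2 * (indicator (A 1) x * g x))"
        by (simp add: J_def)
      also have "\<dots> \<le> (LINT x|lborel. ?w x * (norm (?u x))\<^sup>2)"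
      proof (rule integral_mono)
        show "integrable lborel (\<lambda>x. (exp (- 4 / 3))\<^sup>2 * (indicator (A 1) x * g x))"
          using bounds(1)[of 1] by simp
        fix x
        show "(exp (- 4 / 3))\<^sup>2 * (indicator (A 1) x * g x) \<le> ?w x * (norm (?u x))\<^sup>2"
        proof (cases "x \<in> A 1")
          case True
          then have x: "1 \<le> norm x" "norm x \<le> \<rho>" "x \<noteq> 0" by (auto simp: A_def)
          let ?b = "bump_tail 0 (1 - (\<epsilon> * ln (inner x x))\<^sup>2)"
          have "0 \<le> ln (norm x)" using x by simp
          moreover have "ln (norm x) \<le> ln \<rho>" using x \<rho> by (intro ln_mono) auto
          then have "ln (norm x) \<le> 1 / (4 * \<epsilon>)" by (simp add: \<rho>_def)
          ultimately have "\<bar>\<epsilon> * ln (inner x x)\<bar> \<le> 1 / 2"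
            using \<epsilon> by (simp add: lnx[OF x(3)] abs_mult field_simps)
          from bump_tail_0_ge[OF this] have "(exp (- 4 / 3))\<^sup>2 \<le> ?b\<^sup>2" by (intro power_mono) auto
          then have "(exp (- 4 / 3))\<^sup>2 * g x \<le> ?b\<^sup>2 * g x" by (intro mult_right_mono) (auto simp: g_def)
          also have "\<dots> = ?w x * (norm (?u x))\<^sup>2"
            unfolding weight[OF x(3), of ?b, symmetric] using x(3)
            by (simp add: separated_def log_bump_def power_mult_distrib mult.assoc)
          finally show ?thesis using True by simp
        qed simp
      qed (rule iu)
      finally show ?thesis .
    qed
    have upper: "(LINT x|lborel. ?w x * (norm (?Y x))\<^sup>2) \<le> 256 * \<epsilon>\<^sup>2 * J"
    proof -
      \<comment> \<open>the four annuli with inner radii \<open>\<rho>\<^sup>-\<^sup>2\<close>, \<open>\<rho>\<^sup>-\<^sup>1\<close>, \<open>1\<close>, \<open>\<rho>\<close>\<close>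
      let ?S = "\<lambda>x. indicator (A (inverse (\<rho>\<^sup>2))) x * g x + indicator (A (inverse \<rho>)) x * g x
          + indicator (A 1) x * g x + indicator (A \<rho>) x * g x"
      have iS: "integrable lborel (\<lambda>x. indicator (A \<alpha>) x * g x)" if "\<alpha> \<in> {inverse (\<rho>\<^sup>2), inverse \<rho>, 1, \<rho>}" for \<alpha>
        using bounds(1) \<rho> that by auto
      have "(LINT x|lborel. ?w x * (norm (?Y x))\<^sup>2) \<le> (LINT x|lborel. 64 * \<epsilon>\<^sup>2 * ?S x)"
      proof (rule integral_mono[OF iY])
        show "integrable lborel (\<lambda>x. 64 * \<epsilon>\<^sup>2 * ?S x)"
          by (intro integrable_mult_right Bochner_Integration.integrable_add iS) auto
        fix x
        have g0: "0 \<le> g x" by (simp add: g_def)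
        have S0: "0 \<le> 64 * \<epsilon>\<^sup>2 * ?S x"
          using g0 by (intro mult_nonneg_nonneg add_nonneg_nonneg) auto
        have Y: "?Y x = (- 4 * \<epsilon>\<^sup>2 * (inner x x * log_bump \<epsilon> (a - 1) 1 2 (inner x x))) *\<^sub>R \<phi> x"
          by (rule euler_separated[OF \<epsilon> \<phi>(1) a_def])
        show "?w x * (norm (?Y x))\<^sup>2 \<le> 64 * \<epsilon>\<^sup>2 * ?S x"
        proof (cases "norm x < exp (- 1 / (2 * \<epsilon>)) \<or> norm x > exp (1 / (2 * \<epsilon>))")
          case True
          then show ?thesis using log_bump_inner_eq_0[OF \<epsilon> True, of "a - 1" 1 2] S0 by (simp add: Y)
        next
          case False
          then have "inverse (\<rho>\<^sup>2) \<le> norm x" unfolding \<rho>2(2) by auto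
          moreover have "norm x \<le> \<rho>\<^sup>2" using False unfolding \<rho>2(1) by auto
          ultimately have x: "inverse (\<rho>\<^sup>2) \<le> norm x" "norm x \<le> \<rho>\<^sup>2" by auto
          have nx: "norm x > 0" using False exp_gt_zero[of "- 1 / (2 * \<epsilon>)"] by linarith
          then have x0: "x \<noteq> 0" by simp
          let ?l = "ln (inner x x)"
          let ?b = "bump_tail 2 (1 - (\<epsilon> * ?l)\<^sup>2)"
          have "ln (norm x) \<le> ln (exp (1 / (2 * \<epsilon>)))" "- 1 / (2 * \<epsilon>) \<le> ln (norm x)"
            using False nx by (auto simp: not_less ln_ge_iff simp del: ln_exp)
          then have "ln (norm x) \<le> 1 / (2 * \<epsilon>)" "- 1 / (2 * \<epsilon>) \<le> ln (norm x)" by simp_all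
          then have l: "\<bar>\<epsilon> * ?l\<bar> \<le> 1"
            using \<epsilon> by (auto simp: lnx[OF x0] abs_le_iff field_simps)
          have "\<bar>4 * \<epsilon> * (\<epsilon> * ?l) * ?b\<bar> \<le> 4 * \<epsilon> * 1 * 2"
            unfolding abs_mult using l \<epsilon> bump_tail_2_bounds[of "1 - (\<epsilon> * ?l)\<^sup>2"]
            by (intro mult_mono) auto
          then have "\<bar>4 * \<epsilon> * (\<epsilon> * ?l) * ?b\<bar>\<^sup>2 \<le> (8 * \<epsilon>)\<^sup>2" using \<epsilon> by (intro power_mono) auto
          then have q: "(4 * \<epsilon> * (\<epsilon> * ?l) * ?b)\<^sup>2 \<le> 64 * \<epsilon>\<^sup>2" by (simp add: power_mult_distrib)
          have "inner x x * log_bump \<epsilon> (a - 1) 1 2 (inner x x) = inner x x powr a * (?l * ?b)"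
            using x0 by (simp add: log_bump_def powr_diff)
          then have "?Y x = (- (inner x x powr a * (4 * \<epsilon> * (\<epsilon> * ?l) * ?b))) *\<^sub>R \<phi> x"
            unfolding Y by (simp add: power2_eq_square mult_ac)
          then have "?w x * (norm (?Y x))\<^sup>2 = (4 * \<epsilon> * (\<epsilon> * ?l) * ?b)\<^sup>2 * g x"
            unfolding weight[OF x0, of "4 * \<epsilon> * (\<epsilon> * ?l) * ?b", symmetric]
            by (simp add: power_mult_distrib mult.assoc)
          also have "\<dots> \<le> 64 * \<epsilon>\<^sup>2 * g x" by (rule mult_right_mono[OF q g0])
          also have "\<dots> \<le> 64 * \<epsilon>\<^sup>2 * ?S x"
          proof (rule mult_left_mono)
            have r: "inverse (\<rho>\<^sup>2) * \<rho> = inverse \<rho>" "inverse \<rho> * \<rho> = 1" "\<rho> * \<rho> = \<rho>\<^sup>2"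
              using \<rho> by (simp_all add: power2_eq_square field_simps)
            have "x \<in> A (inverse (\<rho>\<^sup>2)) \<or> x \<in> A (inverse \<rho>) \<or> x \<in> A 1 \<or> x \<in> A \<rho>"
              using x unfolding A_def by (simp add: r) linarith
            then show "g x \<le> ?S x" using g0 by (auto simp: indicator_def)
          qed simp
          finally show ?thesis .
        qed
      qed
      also have "\<dots> = 64 * \<epsilon>\<^sup>2 * (J + J + J + J)"
        using iS bounds(2) \<rho> by (simp add: J_def[symmetric])
      finally show ?thesis by simp
    qed
    have "is_angular_proj \<sigma> j ?u (\<lambda>_. 0)" by (rule separated_angular_proj[OF cl \<epsilon> \<phi>(1,2) k(2)])
    from C[OF test this] have "(C - 1) * (LINT x|lborel. ?w x * (norm (?u x))\<^sup>2) \<le> (LINT x|lborel. ?w x * (norm (?Y x))\<^sup>2)"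
      unfolding energy by (simp add: algebra_simps)
    moreover have "(C - 1) * ((exp (- 4 / 3))\<^sup>2 * J) \<le> (C - 1) * (LINT x|lborel. ?w x * (norm (?u x))\<^sup>2)"
      using lower \<open>C > 1\<close> by (intro mult_left_mono) auto
    ultimately have "((C - 1) * (exp (- 4 / 3))\<^sup>2) * J \<le> (256 * \<epsilon>\<^sup>2) * J"
      using upper by (simp only: mult.assoc)
    then show ?thesis using bounds(3) by (rule mult_right_le_imp_le)
  qed
  show ?thesis
  proof (rule ccontr)
    assume "\<not> C \<le> 1"
    then have C1: "C > 1" by simp
    define P where "P = (C - 1) * (exp (- 4 / 3))\<^sup>2"
    have P: "P > 0" using C1 by (simp add: P_def)
    \<comment> \<open>this \<open>\<epsilon>\<close> makes the bound half of \<open>P\<close>\<close>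
    have "sqrt (P / 512) > 0" using P by simp
    from key[OF this C1] have "P \<le> 256 * (P / 512)" using P by (simp add: P_def)
    then show False using P by simp
  qed
qed

theorem theorem4p1:
  fixes \<sigma> :: "'n::{finite,linorder} \<Rightarrow> complex ^ 'm ^ 'm"
    and b :: real and j :: int
  assumes "CARD('n) \<ge> 2"
    and "clifford_family \<sigma>"
    and "real_of_int j = (real CARD('n) - 2 - b) / 2"
    and "j \<notin> {1..int CARD('n) - 2}"
  shows "(\<forall>u\<in>test_functions. is_angular_proj \<sigma> j u (\<lambda>_. 0) \<longrightarrow>
            (LINT x|lborel. norm x powr (- b) * (norm (dirac \<sigma> u x))\<^sup>2)
              \<ge> (LINT x|lborel. norm x powr (- b - 2) * (norm (u x))\<^sup>2))
       \<and> (\<forall>C::real. (\<forall>u\<in>test_functions. is_angular_proj \<sigma> j u (\<lambda>_. 0) \<longrightarrow>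
            (LINT x|lborel. norm x powr (- b) * (norm (dirac \<sigma> u x))\<^sup>2)
              \<ge> C * (LINT x|lborel. norm x powr (- b - 2) * (norm (u x))\<^sup>2))
          \<longrightarrow> C \<le> 1)"
proof -
  have j: "2 * of_int j = real CARD('n) + (- b - 2)"
    using assms(3) by simp
  show ?thesis
  proof (intro conjI ballI allI impI)
    fix u :: "real ^ 'n::{finite,linorder} \<Rightarrow> complex ^ 'm"
    assume u: "u \<in> test_functions" "is_angular_proj \<sigma> j u (\<lambda>_. 0)"
    show "(LINT x|lborel. norm x powr (- b - 2) * (norm (u x))\<^sup>2) \<le>
        (LINT x|lborel. norm x powr (- b) * (norm (dirac \<sigma> u x))\<^sup>2)"
      using dirac_hardy_inequality[OF assms(1,2) u j] by simp
  next
    fix C :: real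
    assume C: "\<forall>u\<in>test_functions. is_angular_proj \<sigma> j u (\<lambda>_. 0) \<longrightarrow>
            (LINT x|lborel. norm x powr (- b) * (norm (dirac \<sigma> u x))\<^sup>2)
              \<ge> C * (LINT x|lborel. norm x powr (- b - 2) * (norm (u x))\<^sup>2)"
    show "C \<le> 1"
      by (rule dirac_hardy_sharp[OF assms(1,2,4) j]) (use C in auto)
  qed
qed

end
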